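(* Let $1\le k\ne k'\le n$ and fix the distinguished elements $h:=\partial_k-\partial_{k'}$ and $e:=x^{\epsilon_k}(\partial_k-2\partial_{k'})$. The corresponding quantization of $U(\mathbf{S}^+_{\mathbb{Z}})$ over $U(\mathbf{S}^+_{\mathbb{Z}})[[t]]$ by the Drinfel'd twist $\mathcal{F}(k,k')=\sum_{r\ge0}\frac{(-1)^r}{r!}h^{[r]}\otimes e^rt^r$, with the product undeformed, is given on elements $x^\alpha\partial\in\mathbf{S}^+_{\mathbb{Z}}$ by $$\Delta(x^\alpha\partial)=x^\alpha\partial\otimes(1-et)^{\alpha_k-\alpha_{k'}}+\sum_{\ell=0}^\infty(-1)^\ell h^{\langle\ell\rangle}\otimes(1-et)^{-\ell}\cdot x^{\alpha+\ell\epsilon_k}\bigl(A_\ell\partial-B_\ell(\partial_k-2\partial_{k'})\bigr)t^\ell,$$ $$S(x^\alpha\partial)=-(1-et)^{-(\alpha_k-\alpha_{k'})}\cdot\Bigl(\sum_{\ell=0}^\infty x^{\alpha+\ell\epsilon_k}\bigl(A_\ell\partial-B_\ell(\partial_k-2\partial_{k'})\bigr)\cdot h_1^{\langle\ell\rangle}t^\ell\Bigr),\qquad\varepsilon(x^\alpha\partial)=0,$$ where $A_\ell=\frac1{\ell!}\prod_{j=0}^{\ell-1}(\alpha_k-2\alpha_{k'}+j)$, $B_\ell=\partial(\epsilon_k)A_{\ell-1}$, with $A_0=1$, $A_{-1}=0$.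
   Context: Let $D_i=\frac{\partial}{\partial x_i}$, $\partial_i=x_iD_i$, $T=\bigoplus_{i=1}^n\mathbb{Z}\partial_i$, $\epsilon_i$ the $i$-th standard basis vector of $\mathbb{Z}^n$; for $\partial=\sum a_i\partial_i\in T$ and $\beta\in\mathbb{Z}^n$ put $\partial(\beta)=\sum a_i\beta_i$. Elements $x^\alpha\partial$ ($\alpha\in\mathbb{Z}^n$, $\partial\in T$) have bracket $[x^\alpha\partial,x^\beta\partial']=x^{\alpha+\beta}(\partial(\beta)\partial'-\partial'(\alpha)\partial)$, and $x^\alpha D_i$ is identified with $x^{\alpha-\epsilon_i}\partial_i$. $\mathbf{S}^+_{\mathbb{Z}}$ is the $\mathbb{Z}$-form, spanned over $\mathbb{Z}$ by the elements $\alpha_nx^{\alpha-\epsilon_n}D_i-\alpha_ix^{\alpha-\epsilon_i}D_n=x^{\alpha-\epsilon_i-\epsilon_n}(\alpha_n\partial_i-\alpha_i\partial_n)$ ($\alpha\in\mathbb{Z}_+^n$, $1\le i<n$), of the characteristic $0$ Lie algebra $\mathbf{S}^+$ of derivations $\sum a_iD_i$ with polynomial coefficients $a_i$ in $x_1,\dots,x_n$ and $\sum D_i(a_i)=0$. $U(\cdot)$ is the universal enveloping algebra with its standard Hopf structure $(m,\iota,\Delta_0,\varepsilon_0,S_0)$, extended to power series in $t$. For $x$ in an algebra and a scalar $a$: $x_a^{\langle r\rangle}=(x+a)(x+a+1)\cdots(x+a+r-1)$, $x^{\langle r\rangle}=x_0^{\langle r\rangle}$, $x^{[r]}=x(x-1)\cdots(x-r+1)$.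 Quantization of $U(L)$ by a Drinfel'd twist $\mathcal{F}$ over $U(L)[[t]]$: $U(L)[[t]]$ with $U(L)[[t]]/tU(L)[[t]]\cong U(L)$, with the twisted structure $\Delta(a)=\mathcal{F}\Delta_0(a)\mathcal{F}^{-1}$, $S(a)=wS_0(a)w^{-1}$, $w=m(\mathrm{Id}\otimes S_0)(\mathcal{F})$, product and counit unchanged, where $\mathcal{F}$ is determined by the classical $r$-matrix (here $r=h\otimes e-e\otimes h$).
   Formalization: For n≥3 the ℤ-span of the given elements is not closed under the bracket, so U(S^+_ℤ) is undefined; S^+_ℤ is taken to be the Lie ring these elements generate. The twist F, having denominators r!, is taken after extension of scalars to ℚ. *)

theory Defs
  imports
    "HOL-Library.Multiset"
    "HOL-Library.Poly_Mapping"
    "HOL-Computational_Algebra.Formal_Power_Series"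
    "HOL-Analysis.Finite_Cartesian_Product"
begin

section \<open>Lie rings\<close>

class lie_ring = ab_group_add +
  fixes lie :: "'a \<Rightarrow> 'a \<Rightarrow> 'a"
  assumes lie_add_left: "lie (x + y) z = lie x z + lie y z"
    and lie_add_right: "lie x (y + z) = lie x y + lie x z"
    and lie_self: "lie x x = 0"
    and lie_jacobi: "lie x (lie y z) + lie y (lie z x) + lie z (lie x y) = 0"


section \<open>The universal enveloping ring of a Lie ring\<close>

text \<open>
  \<open>U(L)\<close> over \<open>\<int>\<close> is the associative unital ring generated by the abelian group \<open>L\<close> subject to
  \<open>x y - y x = [x, y]\<close>: terms in the ring operations over generators from \<open>L\<close>, modulo the
  congruence generated by the ring axioms and these relations.
\<close>

datatype 'l uterm =
    UZero | UOne | UGen 'l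
  | UAdd "'l uterm" "'l uterm" | UNeg "'l uterm" | UMul "'l uterm" "'l uterm"

inductive urel :: "'l::lie_ring uterm \<Rightarrow> 'l uterm \<Rightarrow> bool" where
  u_refl: "urel a a"
| u_sym: "urel a b \<Longrightarrow> urel b a"
| u_trans: "urel a b \<Longrightarrow> urel b c \<Longrightarrow> urel a c"
| u_cong_add: "urel a a' \<Longrightarrow> urel b b' \<Longrightarrow> urel (UAdd a b) (UAdd a' b')"
| u_cong_neg: "urel a a' \<Longrightarrow> urel (UNeg a) (UNeg a')"
| u_cong_mul: "urel a a' \<Longrightarrow> urel b b' \<Longrightarrow> urel (UMul a b) (UMul a' b')"
| u_add_assoc: "urel (UAdd (UAdd a b) c) (UAdd a (UAdd b c))"
| u_add_comm: "urel (UAdd a b) (UAdd b a)"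
| u_add_zero: "urel (UAdd UZero a) a"
| u_add_neg: "urel (UAdd (UNeg a) a) UZero"
| u_mul_assoc: "urel (UMul (UMul a b) c) (UMul a (UMul b c))"
| u_mul_one_left: "urel (UMul UOne a) a"
| u_mul_one_right: "urel (UMul a UOne) a"
| u_distrib_right: "urel (UMul (UAdd a b) c) (UAdd (UMul a c) (UMul b c))"
| u_distrib_left: "urel (UMul a (UAdd b c)) (UAdd (UMul a b) (UMul a c))"
| u_gen_add: "urel (UGen (x + y)) (UAdd (UGen x) (UGen y))"
| u_gen_lie: "urel (UGen (lie x y)) (UAdd (UMul (UGen x) (UGen y)) (UNeg (UMul (UGen y) (UGen x))))"

quotient_type (overloaded) 'l uea = "'l::lie_ring uterm" / urel
  by (rule equivpI) (auto intro!: reflpI sympI transpI intro: urel.intros)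

primrec uterm_counit :: "'l uterm \<Rightarrow> int" where
  "uterm_counit UZero = 0"
| "uterm_counit UOne = 1"
| "uterm_counit (UGen x) = 0"
| "uterm_counit (UAdd a b) = uterm_counit a + uterm_counit b"
| "uterm_counit (UNeg a) = - uterm_counit a"
| "uterm_counit (UMul a b) = uterm_counit a * uterm_counit b"

lift_definition counit0 :: "'l::lie_ring uea \<Rightarrow> int" is uterm_counit
proof -
  fix a b :: "'l uterm"
  show "urel a b \<Longrightarrow> uterm_counit a = uterm_counit b"
    by (induction rule: urel.induct) (auto simp: algebra_simps)
qed

instantiation uea :: (lie_ring) ring_1
begin

lift_definition zero_uea :: "'a uea" is UZero .
lift_definition one_uea :: "'a uea" is UOne .
lift_definition plus_uea :: "'a uea \<Rightarrow> 'a uea \<Rightarrow> 'a uea" is UAdd by (rule urel.u_cong_add)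
lift_definition uminus_uea :: "'a uea \<Rightarrow> 'a uea" is UNeg by (rule urel.u_cong_neg)
lift_definition times_uea :: "'a uea \<Rightarrow> 'a uea \<Rightarrow> 'a uea" is UMul by (rule urel.u_cong_mul)
definition minus_uea :: "'a uea \<Rightarrow> 'a uea \<Rightarrow> 'a uea" where "minus_uea a b = a + - b"

instance
proof
  fix a b c :: "'a uea"
  show "a + b + c = a + (b + c)" by transfer (rule urel.u_add_assoc)
  show "a + b = b + a" by transfer (rule urel.u_add_comm)
  show "0 + a = a" by transfer (rule urel.u_add_zero)
  show "- a + a = 0" by transfer (rule urel.u_add_neg)
  show "a - b = a + - b" by (rule minus_uea_def)
  show "a * b * c = a * (b * c)" by transfer (rule urel.u_mul_assoc)
  show "1 * a = a" by transfer (rule urel.u_mul_one_left)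
  show "a * 1 = a" by transfer (rule urel.u_mul_one_right)
  show "(a + b) * c = a * c + b * c" by transfer (rule urel.u_distrib_right)
  show "a * (b + c) = a * b + a * c" by transfer (rule urel.u_distrib_left)
  have "counit0 (0 :: 'a uea) = 0" "counit0 (1 :: 'a uea) = 1"
    by (transfer, simp)+
  then show "(0 :: 'a uea) \<noteq> 1" by fastforce
qed

end

lift_definition ugen :: "'l::lie_ring \<Rightarrow> 'l uea" is UGen .

lemma ugen_add: "ugen (x + y) = ugen x + ugen y"
  by transfer (rule urel.u_gen_add)

lemma ugen_lie: "ugen (lie x y) = ugen x * ugen y - ugen y * ugen x"
  unfolding minus_uea_def by transfer (rule urel.u_gen_lie)

lemma counit0_simps [simp]:
  "counit0 0 = 0" "counit0 1 = 1" "counit0 (ugen x) = 0"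
  "counit0 (a + b) = counit0 a + counit0 b" "counit0 (a * b) = counit0 a * counit0 b"
  by (transfer, simp)+


section \<open>Tensor products over the integers\<close>

text \<open>
  \<open>A \<otimes>\<^sub>\<int> B\<close> as finite formal sums \<open>\<Sum> a\<^sub>i \<otimes> b\<^sub>i\<close> (multisets of pairs) modulo the congruence generated by
  biadditivity. The negative of \<open>a \<otimes> b\<close> is \<open>(- a) \<otimes> b\<close>, so no formal negatives are needed.
\<close>

inductive trel :: "('a::ab_group_add \<times> 'b::ab_group_add) multiset \<Rightarrow> ('a \<times> 'b) multiset \<Rightarrow> bool" where
  t_refl: "trel M M"
| t_sym: "trel M N \<Longrightarrow> trel N M"
| t_trans: "trel M N \<Longrightarrow> trel N P \<Longrightarrow> trel M P"
| t_cong_add: "trel M M' \<Longrightarrow> trel N N' \<Longrightarrow> trel (M + N) (M' + N')"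
| t_add_left: "trel {#(a + a', b)#} {#(a, b), (a', b)#}"
| t_add_right: "trel {#(a, b + b')#} {#(a, b), (a, b')#}"
| t_zero_left: "trel {#(0, b)#} {#}"
| t_zero_right: "trel {#(a, 0)#} {#}"

quotient_type (overloaded) ('a, 'b) tensor =
    "('a::ab_group_add \<times> 'b::ab_group_add) multiset" / trel
  by (rule equivpI) (auto intro!: reflpI sympI transpI intro: trel.intros)

lift_definition tens :: "'a::ab_group_add \<Rightarrow> 'b::ab_group_add \<Rightarrow> ('a, 'b) tensor" (infixr "\<otimes>" 72)
  is "\<lambda>a b. {#(a, b)#}" .

definition tensor_lift ::
    "('a::ab_group_add \<Rightarrow> 'b::ab_group_add \<Rightarrow> 'c::ab_group_add) \<Rightarrow> ('a, 'b) tensor \<Rightarrow> 'c" where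
  \<comment> \<open>independent of the representative for biadditive \<open>f\<close>, the only case of interest\<close>
  "tensor_lift f z = (\<Sum>(a, b)\<in>#rep_tensor z. f a b)"

lemma trel_neg:
  "trel M N \<Longrightarrow> trel (image_mset (map_prod uminus id) M) (image_mset (map_prod uminus id) N)"
proof (induction rule: trel.induct)
  case (t_add_left a a' b)
  then show ?case using trel.t_add_left[of "- a" "- a'" b] by (simp add: add.commute)
qed (auto intro: trel.intros)

lemma trel_sum_mset:
  "(\<And>x. x \<in># M \<Longrightarrow> trel (f x) (g x)) \<Longrightarrow> trel (\<Sum>x\<in>#M. f x) (\<Sum>x\<in>#M. g x)"
  by (induction M) (auto intro: trel.intros)

definition mset_times :: "('a::times \<times> 'b::times) multiset \<Rightarrow> ('a \<times> 'b) multiset \<Rightarrow> ('a \<times> 'b) multiset" where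
  "mset_times M N = (\<Sum>(a, b)\<in>#M. {#(a * c, b * d). (c, d)\<in>#N#})"

lemma mset_times_simps [simp]:
  "mset_times {#} N = {#}"
  "mset_times (M + M') N = mset_times M N + mset_times M' N"
  "mset_times {#(a, b)#} N = {#(a * c, b * d). (c, d)\<in>#N#}"
  "mset_times (add_mset (a, b) M) N = {#(a * c, b * d). (c, d)\<in>#N#} + mset_times M N"
  by (simp_all add: mset_times_def)

lemma mset_times_right [simp]:
  "mset_times M {#} = {#}"
  "mset_times M (N + N') = mset_times M N + mset_times M N'"
  by (induction M) (auto simp: ac_simps)

lemma trel_one_times:
  fixes a :: "'a::ring" and b :: "'b::ring"
  assumes "trel M N"
  shows "trel {#(a * c, b * d). (c, d)\<in>#M#} {#(a * c, b * d). (c, d)\<in>#N#}"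
  using assms
proof (induction rule: trel.induct)
  case (t_add_left a' a'' b')
  then show ?case using trel.t_add_left[of "a * a'" "a * a''" "b * b'"] by (simp add: distrib_left)
next
  case (t_add_right a' b' b'')
  then show ?case using trel.t_add_right[of "a * a'" "b * b'" "b * b''"] by (simp add: distrib_left)
qed (auto intro: trel.intros)

lemma trel_times_right:
  fixes M :: "('a::ring \<times> 'b::ring) multiset"
  assumes "trel N N'"
  shows "trel (mset_times M N) (mset_times M N')"
  proof (induction M)
  case (add p M)
  then show ?case using trel_one_times[OF assms] by (cases p) (auto intro: trel.intros)
qed (simp add: trel.t_refl)

lemma trel_times_left:
  fixes M :: "('a::ring \<times> 'b::ring) multiset"
  assumes "trel M M'"
  shows "trel (mset_times M N) (mset_times M' N)"
  using assms
proof (induction rule: trel.induct)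
  case (t_add_left a a' b)
  have "trel {#((a + a') * c, b * d). (c, d)\<in>#N#}
      ({#(a * c, b * d). (c, d)\<in>#N#} + {#(a' * c, b * d). (c, d)\<in>#N#})"
  proof (induction N)
    case (add p N)
    obtain c d where "p = (c, d)" by (cases p)
    then show ?case
      using trel.t_cong_add[OF trel.t_add_left[of "a * c" "a' * c" "b * d"] add.IH]
      by (simp add: distrib_right add_mset_commute)
  qed (auto intro: trel.intros)
  then show ?case by (simp add: add.commute)
next
  case (t_add_right a b b')
  have "trel {#(a * c, (b + b') * d). (c, d)\<in>#N#}
      ({#(a * c, b * d). (c, d)\<in>#N#} + {#(a * c, b' * d). (c, d)\<in>#N#})"
  proof (induction N)
    case (add p N)
    obtain c d where "p = (c, d)" by (cases p)
    then show ?case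
      using trel.t_cong_add[OF trel.t_add_right[of "a * c" "b * d" "b' * d"] add.IH]
      by (simp add: distrib_right add_mset_commute)
  qed (auto intro: trel.intros)
  then show ?case by (simp add: add.commute)
next
  case (t_zero_left b)
  show ?case
  proof (induction N)
    case (add p N)
    then show ?case
      using trel.t_cong_add[OF trel.t_zero_left[of "b * snd p"] add.IH]
      by (simp add: split_beta)
  qed (auto intro: trel.intros)
next
  case (t_zero_right a)
  show ?case
  proof (induction N)
    case (add p N)
    then show ?case
      using trel.t_cong_add[OF trel.t_zero_right[of "a * fst p"] add.IH]
      by (simp add: split_beta)
  qed (auto intro: trel.intros)
qed (auto intro: trel.intros)

instantiation tensor :: (ab_group_add, ab_group_add) ab_group_add
begin

lift_definition zero_tensor :: "('a, 'b) tensor" is "{#}" .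
lift_definition plus_tensor :: "('a, 'b) tensor \<Rightarrow> ('a, 'b) tensor \<Rightarrow> ('a, 'b) tensor" is "(+)"
  by (rule trel.t_cong_add)
lift_definition uminus_tensor :: "('a, 'b) tensor \<Rightarrow> ('a, 'b) tensor"
  is "image_mset (map_prod uminus id)" by (rule trel_neg)
definition minus_tensor :: "('a, 'b) tensor \<Rightarrow> ('a, 'b) tensor \<Rightarrow> ('a, 'b) tensor" where
  "minus_tensor y z = y + - z"

instance
proof
  fix x y z :: "('a, 'b) tensor"
  show "x + y + z = x + (y + z)" by transfer (simp add: add.assoc trel.t_refl)
  show "x + y = y + x" by transfer (simp add: add.commute trel.t_refl)
  show "0 + x = x" by transfer (simp add: trel.t_refl)
  show "- x + x = 0"
  proof transfer
    fix M :: "('a \<times> 'b) multiset"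
    show "trel (image_mset (map_prod uminus id) M + M) {#}"
    proof (induction M)
      case (add p M)
      obtain a b where p: "p = (a, b)" by (cases p)
      have "trel {#(- a, b), (a, b)#} {#}"
        using trel.t_trans[OF trel.t_sym[OF trel.t_add_left[of "- a" a b]]] trel.t_zero_left[of b] by simp
      from trel.t_cong_add[OF this add.IH] show ?case by (simp add: p add_mset_commute)
    qed (auto intro: trel.intros)
  qed
  show "x - y = x + - y" by (rule minus_tensor_def)
qed

end

lemma abs_tensor_cases: obtains M where "z = abs_tensor M"
  by (metis Quotient3_abs_rep[OF Quotient3_tensor])

lemma sum_mset_trel:
  fixes f :: "'a::ab_group_add \<Rightarrow> 'b::ab_group_add \<Rightarrow> 'c::ab_group_add"
  assumes l: "\<And>a a' b. f (a + a') b = f a b + f a' b"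
    and r: "\<And>a b b'. f a (b + b') = f a b + f a b'"
    and "trel M N"
  shows "(\<Sum>(a, b)\<in>#M. f a b) = (\<Sum>(a, b)\<in>#N. f a b)"
proof -
  have "f 0 b = 0" "f a 0 = 0" for a b
    using l[of 0 0 b] r[of a 0 0] by simp_all
  with \<open>trel M N\<close> show ?thesis
    by (induction rule: trel.induct) (simp_all add: l r)
qed

lemma tensor_lift_abs:
  fixes f :: "'a::ab_group_add \<Rightarrow> 'b::ab_group_add \<Rightarrow> 'c::ab_group_add"
  assumes l: "\<And>a a' b. f (a + a') b = f a b + f a' b"
    and r: "\<And>a b b'. f a (b + b') = f a b + f a b'"
  shows "tensor_lift f (abs_tensor M) = (\<Sum>(a, b)\<in>#M. f a b)"
  unfolding tensor_lift_def
  by (rule sum_mset_trel[of f, OF l r]) (simp add: Quotient3_rep_abs[OF Quotient3_tensor] trel.t_refl)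

lemma tensor_lift_tens:
  fixes f :: "'a::ab_group_add \<Rightarrow> 'b::ab_group_add \<Rightarrow> 'c::ab_group_add"
  assumes l: "\<And>a a' b. f (a + a') b = f a b + f a' b"
    and r: "\<And>a b b'. f a (b + b') = f a b + f a b'"
  shows "tensor_lift f (a \<otimes> b) = f a b"
  by (simp add: tens.abs_eq tensor_lift_abs[of f, OF l r])

lemma tensor_lift_add:
  fixes f :: "'a::ab_group_add \<Rightarrow> 'b::ab_group_add \<Rightarrow> 'c::ab_group_add"
  assumes l: "\<And>a a' b. f (a + a') b = f a b + f a' b"
    and r: "\<And>a b b'. f a (b + b') = f a b + f a b'"
  shows "tensor_lift f (y + z) = tensor_lift f y + tensor_lift f z"
proof -
  obtain M N where "y = abs_tensor M" "z = abs_tensor N"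
    using abs_tensor_cases[of y] abs_tensor_cases[of z] by metis
  then show ?thesis by (simp add: plus_tensor.abs_eq tensor_lift_abs[of f, OF l r])
qed

text \<open>
  The tensor product of two nonzero rings may vanish, which the class \<open>ring_1\<close> forbids.
  All rings here have a homomorphism to \<open>\<rat>\<close>, a property that tensor products inherit.
\<close>

class augmented_ring = ring_1 +
  fixes aug :: "'a \<Rightarrow> rat"
  assumes aug_one: "aug 1 = 1"
    and aug_add: "aug (x + y) = aug x + aug y"
    and aug_mult: "aug (x * y) = aug x * aug y"

instantiation rat :: augmented_ring
begin
definition aug_rat :: "rat \<Rightarrow> rat" where "aug_rat x = x"
instance by standard (simp_all add: aug_rat_def)
end

instantiation uea :: (lie_ring) augmented_ring
begin
definition aug_uea :: "'a uea \<Rightarrow> rat" where "aug_uea x = of_int (counit0 x)"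
instance by standard (simp_all add: aug_uea_def)
end

instantiation tensor :: (augmented_ring, augmented_ring) augmented_ring
begin

lift_definition times_tensor :: "('a, 'b) tensor \<Rightarrow> ('a, 'b) tensor \<Rightarrow> ('a, 'b) tensor"
  is mset_times
  by (meson trel.t_trans trel_times_left trel_times_right)
lift_definition one_tensor :: "('a, 'b) tensor" is "{#(1, 1)#}" .
definition aug_tensor :: "('a, 'b) tensor \<Rightarrow> rat" where
  "aug_tensor = tensor_lift (\<lambda>a b. aug a * aug b)"

instance
proof
  have assoc1: "mset_times {#(a * c, b * d). (c, d)\<in>#N#} P = {#(a * c, b * d). (c, d)\<in>#mset_times N P#}"
    for a :: 'a and b :: 'b and N P
    by (induction N) (auto simp: multiset.map_comp comp_def case_prod_unfold mult.assoc)
  fix x y z :: "('a, 'b) tensor"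
  show "x * y * z = x * (y * z)"
  proof transfer
    fix M N P :: "('a \<times> 'b) multiset"
    have "mset_times (mset_times M N) P = mset_times M (mset_times N P)"
      by (induction M) (auto simp: assoc1)
    then show "trel (mset_times (mset_times M N) P) (mset_times M (mset_times N P))"
      by (simp add: trel.t_refl)
  qed
  show "1 * x = x" by transfer (simp add: trel.t_refl)
  show "x * 1 = x"
  proof transfer
    fix M :: "('a \<times> 'b) multiset"
    have "mset_times M {#(1, 1)#} = M" by (induction M) auto
    then show "trel (mset_times M {#(1, 1)#}) M" by (simp add: trel.t_refl)
  qed
  show "(x + y) * z = x * z + y * z" by transfer (simp add: trel.t_refl)
  show "x * (y + z) = x * y + x * z" by transfer (simp add: trel.t_refl)
  have aug_zero: "aug (0 :: 'c::augmented_ring) = 0"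
    using aug_add[of "0 :: 'c" 0] by simp
  have eq: "aug (abs_tensor M) = (\<Sum>(a, b)\<in>#M. aug a * aug b)" for M :: "('a \<times> 'b) multiset"
    unfolding aug_tensor_def by (rule tensor_lift_abs) (simp_all add: aug_add algebra_simps)
  show one: "aug (1 :: ('a, 'b) tensor) = 1"
    by (simp add: one_tensor.abs_eq eq aug_one)
  have "aug (0 :: ('a, 'b) tensor) = 0"
    by (simp add: zero_tensor.abs_eq eq)
  with one show "(0 :: ('a, 'b) tensor) \<noteq> 1" by force
  show "aug (x + y) = aug x + aug y"
    unfolding aug_tensor_def by (rule tensor_lift_add) (simp_all add: aug_add algebra_simps)
  have mono: "(\<Sum>(a, b)\<in>#{#(a * c, b * d). (c, d)\<in>#N#}. aug a * aug b)
      = aug a * aug b * (\<Sum>(a, b)\<in>#N. aug a * aug b)" for a :: 'a and b :: 'b and N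
    by (induction N) (auto simp: aug_mult algebra_simps)
  have "(\<Sum>(a, b)\<in>#mset_times M N. aug a * aug b)
      = (\<Sum>(a, b)\<in>#M. aug a * aug b) * (\<Sum>(a, b)\<in>#N. aug a * aug b)"
    for M N :: "('a \<times> 'b) multiset"
    by (induction M) (auto simp: mono algebra_simps)
  moreover obtain M N where "x = abs_tensor M" "y = abs_tensor N"
    using abs_tensor_cases[of x] abs_tensor_cases[of y] by metis
  ultimately show "aug (x * y) = aug x * aug y"
    by (simp add: times_tensor.abs_eq eq)
qed

end

lemma tens_mult: "(a \<otimes> b) * (c \<otimes> d) = (a * c) \<otimes> (b * d)"
  by transfer (simp add: trel.t_refl)

lemma tens_add_left: "(a + a') \<otimes> b = a \<otimes> b + a' \<otimes> b"
  by transfer (use trel.t_add_left in \<open>simp add: add_mset_commute\<close>)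

lemma tens_add_right: "a \<otimes> (b + b') = a \<otimes> b + a \<otimes> b'"
  by transfer (use trel.t_add_right in \<open>simp add: add_mset_commute\<close>)

lemma tens_zero [simp]: "0 \<otimes> b = 0" "a \<otimes> 0 = 0"
  using tens_add_left[of 0 0 b] tens_add_right[of a 0 0] by simp_all

lemma tens_one: "1 \<otimes> 1 = 1"
  by transfer (simp add: trel.t_refl)

definition tensor_map ::
    "('a::ab_group_add \<Rightarrow> 'c::ab_group_add) \<Rightarrow> ('b::ab_group_add \<Rightarrow> 'd::ab_group_add)
      \<Rightarrow> ('a, 'b) tensor \<Rightarrow> ('c, 'd) tensor" where
  "tensor_map f g = tensor_lift (\<lambda>a b. f a \<otimes> g b)"

definition tensor_assoc ::
    "('a::ab_group_add, ('b::ab_group_add, 'c::ab_group_add) tensor) tensor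
      \<Rightarrow> (('a, 'b) tensor, 'c) tensor" where
  "tensor_assoc = tensor_lift (\<lambda>a. tensor_lift (\<lambda>b c. (a \<otimes> b) \<otimes> c))"

definition tensor_mult :: "('a::ring_1, 'a) tensor \<Rightarrow> 'a" where
  "tensor_mult = tensor_lift (*)"


section \<open>The standard Hopf structure of the enveloping ring\<close>

primrec uterm_comult :: "'l::lie_ring uterm \<Rightarrow> ('l uea, 'l uea) tensor" where
  "uterm_comult UZero = 0"
| "uterm_comult UOne = 1"
| "uterm_comult (UGen x) = ugen x \<otimes> 1 + 1 \<otimes> ugen x"
| "uterm_comult (UAdd a b) = uterm_comult a + uterm_comult b"
| "uterm_comult (UNeg a) = - uterm_comult a"
| "uterm_comult (UMul a b) = uterm_comult a * uterm_comult b"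

lemma tens_minus: "- (a \<otimes> b) = (- a) \<otimes> b" "a \<otimes> (- b) = (- a) \<otimes> b"
proof -
  have "(- a) \<otimes> b + a \<otimes> b = 0" by (simp flip: tens_add_left)
  then show l: "- (a \<otimes> b) = (- a) \<otimes> b" by (simp add: neg_eq_iff_add_eq_0 add.commute)
  have "a \<otimes> (- b) + a \<otimes> b = 0" by (simp flip: tens_add_right)
  then show "a \<otimes> (- b) = (- a) \<otimes> b" by (simp add: eq_neg_iff_add_eq_0 flip: l)
qed

lemma tens_diff: "(a - a') \<otimes> b = a \<otimes> b - a' \<otimes> b" "a \<otimes> (b - b') = a \<otimes> b - a \<otimes> b'"
  using tens_add_left[of a "- a'" b] tens_add_right[of a b "- b'"] by (simp_all add: tens_minus)

lift_definition comult0 :: "'l::lie_ring uea \<Rightarrow> ('l uea, 'l uea) tensor" is uterm_comult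
proof -
  fix a b :: "'l uterm"
  show "urel a b \<Longrightarrow> uterm_comult a = uterm_comult b"
  proof (induction rule: urel.induct)
    case (u_gen_lie x y)
    show ?case
      by (simp add: ugen_lie distrib_left distrib_right tens_mult tens_diff)
  qed (simp_all add: ugen_add tens_add_left tens_add_right algebra_simps)
qed

primrec uterm_antipode :: "'l::lie_ring uterm \<Rightarrow> 'l uea" where
  "uterm_antipode UZero = 0"
| "uterm_antipode UOne = 1"
| "uterm_antipode (UGen x) = - ugen x"
| "uterm_antipode (UAdd a b) = uterm_antipode a + uterm_antipode b"
| "uterm_antipode (UNeg a) = - uterm_antipode a"
| "uterm_antipode (UMul a b) = uterm_antipode b * uterm_antipode a"

lift_definition antipode0 :: "'l::lie_ring uea \<Rightarrow> 'l uea" is uterm_antipode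
proof -
  fix a b :: "'l uterm"
  show "urel a b \<Longrightarrow> uterm_antipode a = uterm_antipode b"
    by (induction rule: urel.induct) (simp_all add: ugen_add ugen_lie algebra_simps)
qed


section \<open>Power series in \<open>t\<close>\<close>

text \<open>\<open>t\<close> is \<open>fps_X\<close>; it is central, also over noncommutative coefficient rings.\<close>

definition map_fps :: "('a \<Rightarrow> 'b) \<Rightarrow> 'a fps \<Rightarrow> 'b fps" where
  "map_fps f A = Abs_fps (\<lambda>n. f (fps_nth A n))"

definition fps_series :: "(nat \<Rightarrow> 'a::comm_monoid_add fps) \<Rightarrow> 'a fps" where
  \<comment> \<open>\<open>\<Sum>\<^sub>l c\<^sub>l t\<^sup>l\<close>, the \<open>t\<close>-adically convergent sum; the \<open>c\<^sub>l\<close> are themselves power series\<close>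
  "fps_series c = Abs_fps (\<lambda>n. \<Sum>l\<le>n. fps_nth (c l) (n - l))"

definition fps_tens ::
    "'a::ab_group_add fps \<Rightarrow> 'b::ab_group_add fps \<Rightarrow> ('a, 'b) tensor fps" (infixr "\<otimes>\<^sub>t" 72) where
  \<comment> \<open>image of \<open>A \<otimes> B\<close> in the completed tensor product \<open>A[[t]] \<otimes> B[[t]] = (A \<otimes> B)[[t]]\<close> over \<open>\<int>[[t]]\<close>\<close>
  "A \<otimes>\<^sub>t B = Abs_fps (\<lambda>n. \<Sum>i\<le>n. fps_nth A i \<otimes> fps_nth B (n - i))"

definition t_linear :: "('a::ring_1 fps \<Rightarrow> 'b::ring_1 fps) \<Rightarrow> bool" where
  \<comment> \<open>additive, \<open>\<int>[[t]]\<close>-linear and \<open>t\<close>-adically continuous\<close>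
  "t_linear f \<longleftrightarrow> (\<forall>A B. f (A + B) = f A + f B)
     \<and> (\<forall>A. f A = fps_series (\<lambda>i. f (fps_const (fps_nth A i))))"

definition fps_tensor_map ::
    "('a::ring_1 fps \<Rightarrow> 'c::augmented_ring fps) \<Rightarrow> ('b::ring_1 fps \<Rightarrow> 'd::augmented_ring fps)
      \<Rightarrow> ('a, 'b) tensor fps \<Rightarrow> ('c, 'd) tensor fps" where
  \<comment> \<open>\<open>f \<otimes> g\<close> on the completed tensor product, for \<open>t_linear\<close> maps\<close>
  "fps_tensor_map f g P =
     fps_series (\<lambda>i. tensor_lift (\<lambda>a b. f (fps_const a) \<otimes>\<^sub>t g (fps_const b)) (fps_nth P i))"

definition is_unit_elt :: "'a::monoid_mult \<Rightarrow> bool" where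
  "is_unit_elt u \<longleftrightarrow> (\<exists>v. u * v = 1 \<and> v * u = 1)"

definition unit_inv :: "'a::monoid_mult \<Rightarrow> 'a" where
  "unit_inv u = (THE v. u * v = 1 \<and> v * u = 1)"

definition unit_powi :: "'a::monoid_mult \<Rightarrow> int \<Rightarrow> 'a" where
  "unit_powi u m = (if m \<ge> 0 then u ^ nat m else unit_inv u ^ nat (- m))"

primrec falling :: "'a::ring_1 \<Rightarrow> nat \<Rightarrow> 'a" where
  "falling x 0 = 1"
| "falling x (Suc r) = falling x r * (x - of_nat r)"

primrec rising :: "int \<Rightarrow> 'a::ring_1 \<Rightarrow> nat \<Rightarrow> 'a" where
  "rising a x 0 = 1"
| "rising a x (Suc r) = rising a x r * (x + of_int a + of_nat r)"


section \<open>Drinfel'd twists and the quantizations they define\<close>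

definition hom_ring :: "('a::ring_1 \<Rightarrow> 'b::ring_1) \<Rightarrow> bool" where
  "hom_ring f \<longleftrightarrow> f 1 = 1 \<and> (\<forall>x y. f (x + y) = f x + f y) \<and> (\<forall>x y. f (x * y) = f x * f y)"

text \<open>Topological Hopf algebra over \<open>\<int>[[t]]\<close> on \<open>A[[t]]\<close> with the product and unit of \<open>A\<close>.\<close>

definition hopf_fps ::
    "('a::augmented_ring fps \<Rightarrow> ('a, 'a) tensor fps) \<Rightarrow> ('a fps \<Rightarrow> int fps) \<Rightarrow> ('a fps \<Rightarrow> 'a fps) \<Rightarrow> bool" where
  "hopf_fps \<Delta> \<epsilon> S \<longleftrightarrow>
     hom_ring \<Delta> \<and> t_linear \<Delta> \<and> hom_ring \<epsilon> \<and> t_linear \<epsilon> \<and> t_linear S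
   \<and> (\<forall>a. fps_tensor_map \<Delta> id (\<Delta> a) = map_fps tensor_assoc (fps_tensor_map id \<Delta> (\<Delta> a)))
   \<and> (\<forall>a. map_fps tensor_mult (fps_tensor_map (map_fps of_int \<circ> \<epsilon>) id (\<Delta> a)) = a)
   \<and> (\<forall>a. map_fps tensor_mult (fps_tensor_map id (map_fps of_int \<circ> \<epsilon>) (\<Delta> a)) = a)
   \<and> (\<forall>a. map_fps tensor_mult (fps_tensor_map S id (\<Delta> a)) = map_fps of_int (\<epsilon> a))
   \<and> (\<forall>a. map_fps tensor_mult (fps_tensor_map id S (\<Delta> a)) = map_fps of_int (\<epsilon> a))"

text \<open>
  The twists below have denominators \<open>r!\<close>, so they live over \<open>\<rat> \<otimes> (U(L) \<otimes> U(L))\<close>, that is,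
  over \<open>U(L\<^sub>\<rat>) \<otimes> U(L\<^sub>\<rat>)\<close>.
\<close>

type_synonym 'a rat_ext = "(rat, 'a) tensor"

definition rat_map :: "('a::ab_group_add \<Rightarrow> 'b::ab_group_add) \<Rightarrow> 'a rat_ext \<Rightarrow> 'b rat_ext" where
  "rat_map f = tensor_map id f"

definition rat_emb :: "'a::ab_group_add fps \<Rightarrow> 'a rat_ext fps" where
  "rat_emb = map_fps (\<lambda>a. 1 \<otimes> a)"

definition drinfeld_twist :: "('l::lie_ring uea, 'l uea) tensor rat_ext fps \<Rightarrow> bool" where
  \<comment> \<open>\<open>(F \<otimes> 1) (\<Delta>\<^sub>0 \<otimes> Id)(F) = (1 \<otimes> F) (Id \<otimes> \<Delta>\<^sub>0)(F)\<close> and \<open>(\<epsilon>\<^sub>0 \<otimes> Id)(F) = 1 = (Id \<otimes> \<epsilon>\<^sub>0)(F)\<close>\<close>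
  "drinfeld_twist F \<longleftrightarrow>
     is_unit_elt F
   \<and> map_fps (rat_map (\<lambda>z. z \<otimes> 1)) F * map_fps (rat_map (tensor_map comult0 id)) F
     = map_fps (rat_map tensor_assoc)
         (map_fps (rat_map (\<lambda>z. 1 \<otimes> z)) F * map_fps (rat_map (tensor_map id comult0)) F)
   \<and> map_fps (rat_map (tensor_lift (\<lambda>a b. of_int (counit0 a) * b))) F = 1
   \<and> map_fps (rat_map (tensor_lift (\<lambda>a b. a * of_int (counit0 b)))) F = 1"

definition twist_w :: "('l::lie_ring uea, 'l uea) tensor rat_ext fps \<Rightarrow> 'l uea rat_ext fps" where
  "twist_w F = map_fps (rat_map (tensor_lift (\<lambda>a b. a * antipode0 b))) F"

text \<open>
  \<open>(\<Delta>, \<epsilon>, S)\<close> makes \<open>U(L)[[t]]\<close>, with undeformed product, the quantization of \<open>U(L)\<close> by \<open>F\<close>: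
  it is the restriction to \<open>U(L)[[t]]\<close> of the structure twisted by \<open>F\<close>, and reduces modulo \<open>t\<close>
  to the standard structure.
\<close>

definition twist_quantization ::
    "('l::lie_ring uea, 'l uea) tensor rat_ext fps
      \<Rightarrow> ('l uea fps \<Rightarrow> ('l uea, 'l uea) tensor fps) \<Rightarrow> ('l uea fps \<Rightarrow> int fps)
      \<Rightarrow> ('l uea fps \<Rightarrow> 'l uea fps) \<Rightarrow> bool" where
  "twist_quantization F \<Delta> \<epsilon> S \<longleftrightarrow>
     drinfeld_twist F \<and> is_unit_elt (twist_w F)
   \<and> hopf_fps \<Delta> \<epsilon> S
   \<and> (\<forall>a. rat_emb (\<Delta> a) = F * rat_emb (map_fps comult0 a) * unit_inv F)
   \<and> (\<forall>a. rat_emb (S a) = twist_w F * rat_emb (map_fps antipode0 a) * unit_inv (twist_w F))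
   \<and> (\<forall>a. \<epsilon> a = map_fps counit0 a)
   \<and> (\<forall>a. fps_nth (\<Delta> a) 0 = comult0 (fps_nth a 0) \<and> fps_nth (S a) 0 = antipode0 (fps_nth a 0))"

definition twist_elt :: "'l::lie_ring \<Rightarrow> 'l \<Rightarrow> ('l uea, 'l uea) tensor rat_ext fps" where
  "twist_elt h e =
     Abs_fps (\<lambda>r. ((- 1) ^ r / fact r) \<otimes> (falling (ugen h) r \<otimes> ugen e ^ r))"


section \<open>The Lie ring of the special type\<close>

text \<open>
  \<open>T = \<Oplus> \<int> \<partial>\<^sub>i\<close> is \<open>int ^ 'n\<close>; the indices \<open>1, \<dots>, n\<close> are the elements of the finite linear order \<open>'n\<close>,
  with \<open>n\<close> the largest one. A finite sum of elements \<open>x\<^sup>\<alpha> \<partial>\<close> is the finitely supported map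
  sending \<open>\<alpha>\<close> to the \<open>T\<close>-coefficient of \<open>x\<^sup>\<alpha>\<close>.
\<close>

type_synonym 'n wvec = "(int ^ 'n) \<Rightarrow>\<^sub>0 (int ^ 'n)"

definition tapp :: "int ^ 'n::finite \<Rightarrow> int ^ 'n \<Rightarrow> int" where
  "tapp d \<beta> = (\<Sum>i\<in>UNIV. d $ i * \<beta> $ i)"

definition xd :: "int ^ 'n::finite \<Rightarrow> int ^ 'n \<Rightarrow> 'n wvec" where
  "xd \<alpha> d = Poly_Mapping.single \<alpha> d"

definition wlie1 :: "int ^ 'n::finite \<Rightarrow> int ^ 'n \<Rightarrow> int ^ 'n \<Rightarrow> int ^ 'n \<Rightarrow> 'n wvec" where
  "wlie1 \<alpha> d \<beta> d' = xd (\<alpha> + \<beta>) (tapp d \<beta> *s d' - tapp d' \<alpha> *s d)"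

definition wlie :: "'n::finite wvec \<Rightarrow> 'n wvec \<Rightarrow> 'n wvec" where
  "wlie f g = (\<Sum>\<alpha>\<in>Poly_Mapping.keys f. \<Sum>\<beta>\<in>Poly_Mapping.keys g.
     wlie1 \<alpha> (Poly_Mapping.lookup f \<alpha>) \<beta> (Poly_Mapping.lookup g \<beta>))"

abbreviation eps :: "'n::finite \<Rightarrow> int ^ 'n" where
  "eps i \<equiv> axis i 1"

abbreviation last_index :: "'n::{finite, linorder}" where
  "last_index \<equiv> Max UNIV"

definition S_gen :: "int ^ 'n::{finite, linorder} \<Rightarrow> 'n \<Rightarrow> 'n wvec" where
  "S_gen \<alpha> i = xd (\<alpha> - eps i - eps last_index) (\<alpha> $ last_index *s eps i - \<alpha> $ i *s eps last_index)"

text \<open>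
  For \<open>n \<ge> 3\<close> the additive span of the elements \<open>S_gen \<alpha> i\<close> is not closed under the bracket:
  for \<open>n = 3\<close> it contains \<open>x\<^sub>3 (2\<partial>\<^sub>1 - \<partial>\<^sub>3)\<close> and \<open>x\<^sub>3 (2\<partial>\<^sub>2 - \<partial>\<^sub>3)\<close>, but not their bracket
  \<open>2 x\<^sub>3\<^sup>2 (\<partial>\<^sub>1 - \<partial>\<^sub>2)\<close>, as its elements of weight \<open>2\<epsilon>\<^sub>3\<close> are spanned by \<open>x\<^sub>3\<^sup>2 (3\<partial>\<^sub>1 - \<partial>\<^sub>3)\<close> and
  \<open>x\<^sub>3\<^sup>2 (3\<partial>\<^sub>2 - \<partial>\<^sub>3)\<close>. The Lie ring is therefore the one spanned under addition and bracket.
\<close>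

inductive_set S_Z :: "'n::{finite, linorder} wvec set" where
  gen: "(\<And>j. \<alpha> $ j \<ge> 0) \<Longrightarrow> i \<noteq> last_index \<Longrightarrow> S_gen \<alpha> i \<in> S_Z"
| zero: "0 \<in> S_Z"
| diff: "f \<in> S_Z \<Longrightarrow> g \<in> S_Z \<Longrightarrow> f - g \<in> S_Z"
| bracket: "f \<in> S_Z \<Longrightarrow> g \<in> S_Z \<Longrightarrow> wlie f g \<in> S_Z"

lemma S_Z_uminus: "f \<in> S_Z \<Longrightarrow> - f \<in> S_Z"
  using S_Z.diff[OF S_Z.zero, of f] by simp

lemma S_Z_add: "f \<in> S_Z \<Longrightarrow> g \<in> S_Z \<Longrightarrow> f + g \<in> S_Z"
  using S_Z.diff[OF _ S_Z_uminus, of f g] by simp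

lemma tapp_simps:
  "tapp (d + d') \<beta> = tapp d \<beta> + tapp d' \<beta>" "tapp d (\<beta> + \<beta>') = tapp d \<beta> + tapp d \<beta>'"
  "tapp (d - d') \<beta> = tapp d \<beta> - tapp d' \<beta>" "tapp (c *s d) \<beta> = c * tapp d \<beta>"
  "tapp 0 \<beta> = 0" "tapp d 0 = 0"
  by (simp_all add: tapp_def sum.distrib sum_subtractf sum_distrib_left algebra_simps)

lemma wlie1_add:
  "wlie1 \<alpha> (d + d') \<beta> b = wlie1 \<alpha> d \<beta> b + wlie1 \<alpha> d' \<beta> b"
  "wlie1 \<alpha> d \<beta> (b + b') = wlie1 \<alpha> d \<beta> b + wlie1 \<alpha> d \<beta> b'"
  unfolding wlie1_def xd_def single_add[symmetric]
  by (rule arg_cong[where f = "Poly_Mapping.single _"]; simp add: tapp_simps vec_eq_iff algebra_simps)+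

lemma wlie1_zero: "wlie1 \<alpha> 0 \<beta> b = 0" "wlie1 \<alpha> d \<beta> 0 = 0"
  using wlie1_add(1)[of \<alpha> 0 0 \<beta> b] wlie1_add(2)[of \<alpha> d \<beta> 0 0] by simp_all

lemma wlie_superset:
  assumes "finite A" "finite B" "Poly_Mapping.keys f \<subseteq> A" "Poly_Mapping.keys g \<subseteq> B"
  shows "wlie f g = (\<Sum>\<alpha>\<in>A. \<Sum>\<beta>\<in>B. wlie1 \<alpha> (Poly_Mapping.lookup f \<alpha>) \<beta> (Poly_Mapping.lookup g \<beta>))"
proof -
  have "(\<Sum>\<beta>\<in>Poly_Mapping.keys g. wlie1 \<alpha> (Poly_Mapping.lookup f \<alpha>) \<beta> (Poly_Mapping.lookup g \<beta>))
      = (\<Sum>\<beta>\<in>B. wlie1 \<alpha> (Poly_Mapping.lookup f \<alpha>) \<beta> (Poly_Mapping.lookup g \<beta>))" for \<alpha>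
    by (rule sum.mono_neutral_left) (use assms in \<open>auto simp: in_keys_iff wlie1_zero\<close>)
  then show ?thesis
    unfolding wlie_def
    by (simp, intro sum.mono_neutral_left) (use assms in \<open>auto simp: in_keys_iff wlie1_zero\<close>)
qed

lemma wlie_add:
  "wlie (f + f') g = wlie f g + wlie f' g" "wlie f (g + g') = wlie f g + wlie f g'"
proof -
  let ?A = "Poly_Mapping.keys f \<union> Poly_Mapping.keys f'" and ?B = "Poly_Mapping.keys g \<union> Poly_Mapping.keys g'"
  have f: "Poly_Mapping.keys (f + f') \<subseteq> ?A" and g: "Poly_Mapping.keys (g + g') \<subseteq> ?B"
    by (rule Poly_Mapping.keys_add)+
  show "wlie (f + f') g = wlie f g + wlie f' g"
    using wlie_superset[of ?A "Poly_Mapping.keys g" _ g] f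
    by (simp add: lookup_add wlie1_add sum.distrib)
  show "wlie f (g + g') = wlie f g + wlie f g'"
    using wlie_superset[of "Poly_Mapping.keys f" ?B f] g
    by (simp add: lookup_add wlie1_add sum.distrib)
qed

lemma wlie_xd: "wlie (xd \<alpha> d) (xd \<beta> d') = wlie1 \<alpha> d \<beta> d'"
  using wlie_superset[of "{\<alpha>}" "{\<beta>}" "xd \<alpha> d" "xd \<beta> d'"] by (simp add: xd_def)

lemma wlie_zero: "wlie 0 g = 0" "wlie f 0 = 0"
  using wlie_add(1)[of 0 0 g] wlie_add(2)[of f 0 0] by simp_all

lemma wvec_induct [case_names zero single add]:
  fixes f :: "'n::finite wvec"
  assumes "P 0" "\<And>\<alpha> d. P (xd \<alpha> d)" "\<And>f g. P f \<Longrightarrow> P g \<Longrightarrow> P (f + g)"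
  shows "P f"
proof -
  have "P (\<Sum>\<alpha>\<in>A. xd \<alpha> (Poly_Mapping.lookup f \<alpha>))" if "finite A" for A
    using that by (induction A) (auto intro: assms)
  moreover have "f = (\<Sum>\<alpha>\<in>Poly_Mapping.keys f. xd \<alpha> (Poly_Mapping.lookup f \<alpha>))"
    by (rule poly_mapping_eqI)
      (simp add: lookup_sum xd_def lookup_single when_def in_keys_iff)
  ultimately show ?thesis by (metis Poly_Mapping.finite_keys)
qed

lemma wlie_antisym: "wlie f g = - wlie g f"
proof (induction f rule: wvec_induct)
  case (single \<alpha> d)
  show ?case
  proof (induction g rule: wvec_induct)
    case (single \<beta> d')
    show ?case
      unfolding wlie_xd wlie1_def
      by (simp add: xd_def add.commute flip: single_uminus)
  qed (simp_all add: wlie_zero wlie_add)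
qed (simp_all add: wlie_zero wlie_add)

lemma wlie_self: "wlie f f = 0"
proof (induction f rule: wvec_induct)
  case (single \<alpha> d)
  show ?case unfolding wlie_xd wlie1_def by (simp add: xd_def)
next
  case (add f g)
  then show ?case using wlie_antisym[of f g] by (simp add: wlie_add)
qed (simp add: wlie_zero)

lemma add3_zero:
  fixes a :: "'a::ab_group_add"
  assumes "a + b + c = 0" "a' + b' + c' = 0"
  shows "(a + a') + (b + b') + (c + c') = 0"
proof -
  have "(a + a') + (b + b') + (c + c') = (a + b + c) + (a' + b' + c')" by (simp add: ac_simps)
  with assms show ?thesis by simp
qed

lemma wlie_jacobi: "wlie f (wlie g h) + wlie g (wlie h f) + wlie h (wlie f g) = 0"
proof (induction f rule: wvec_induct)
  case (single \<alpha> a)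
  show ?case
  proof (induction g rule: wvec_induct)
    case (single \<beta> b)
    show ?case
    proof (induction h rule: wvec_induct)
      case (single \<gamma> c)
      have k: "\<beta> + (\<gamma> + \<alpha>) = \<alpha> + (\<beta> + \<gamma>)" "\<gamma> + (\<alpha> + \<beta>) = \<alpha> + (\<beta> + \<gamma>)"
        by (simp_all add: ac_simps)
      show ?case
        unfolding wlie_xd wlie1_def k
        unfolding xd_def single_add[symmetric]
        by (rule trans[OF arg_cong[where f = "Poly_Mapping.single _" and y = 0] single_zero])
          (simp add: tapp_simps vec_eq_iff algebra_simps)
    next
      case (add h h')
      then show ?case unfolding wlie_add by (rule add3_zero)
    qed (simp_all add: wlie_zero)
  next
    case (add g g')
    then show ?case unfolding wlie_add by (rule add3_zero)
  qed (simp_all add: wlie_zero)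
next
  case (add f f')
  then show ?case unfolding wlie_add by (rule add3_zero)
qed (simp_all add: wlie_zero)

typedef (overloaded) 'n sz = "S_Z :: 'n::{finite, linorder} wvec set"
  by (rule exI) (rule S_Z.zero)

setup_lifting type_definition_sz

instantiation sz :: ("{finite, linorder}") lie_ring
begin

lift_definition zero_sz :: "'a sz" is 0 by (rule S_Z.zero)
lift_definition plus_sz :: "'a sz \<Rightarrow> 'a sz \<Rightarrow> 'a sz" is "(+)" by (rule S_Z_add)
lift_definition uminus_sz :: "'a sz \<Rightarrow> 'a sz" is uminus by (rule S_Z_uminus)
lift_definition minus_sz :: "'a sz \<Rightarrow> 'a sz \<Rightarrow> 'a sz" is "(-)" by (rule S_Z.diff)
lift_definition lie_sz :: "'a sz \<Rightarrow> 'a sz \<Rightarrow> 'a sz" is wlie by (rule S_Z.bracket)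

instance
proof
  fix x y z :: "'a sz"
  show "x + y + z = x + (y + z)" by transfer (rule add.assoc)
  show "x + y = y + x" by transfer (rule add.commute)
  show "0 + x = x" by transfer simp
  show "- x + x = 0" by transfer simp
  show "x - y = x + - y" by transfer simp
  show "lie (x + y) z = lie x z + lie y z" by transfer (rule wlie_add)
  show "lie x (y + z) = lie x y + lie x z" by transfer (rule wlie_add)
  show "lie x x = 0" by transfer (rule wlie_self)
  show "lie x (lie y z) + lie y (lie z x) + lie z (lie x y) = 0" by transfer (rule wlie_jacobi)
qed

end

definition sxd :: "(int, 'n) vec \<Rightarrow> (int, 'n) vec \<Rightarrow> 'n::{finite, linorder} sz" where
  \<comment> \<open>\<open>x\<^sup>\<alpha> \<partial>\<close> as an element of the Lie ring; meaningful only if \<open>xd \<alpha> \<partial> \<in> S_Z\<close>\<close>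
  "sxd \<alpha> d = Abs_sz (xd \<alpha> d)"


section \<open>The coefficients of the quantization\<close>

definition h_dir :: "'n::finite \<Rightarrow> 'n \<Rightarrow> int ^ 'n" where
  "h_dir k k' = eps k - eps k'"

definition e_dir :: "'n::finite \<Rightarrow> 'n \<Rightarrow> int ^ 'n" where
  "e_dir k k' = eps k - 2 *s eps k'"

definition A_coeff :: "'n::finite \<Rightarrow> 'n \<Rightarrow> int ^ 'n \<Rightarrow> nat \<Rightarrow> int" where
  \<comment> \<open>the division is exact: \<open>l!\<close> divides a product of \<open>l\<close> consecutive integers\<close>
  "A_coeff k k' \<alpha> l = (\<Prod>j<l. \<alpha> $ k - 2 * \<alpha> $ k' + int j) div fact l"

definition B_coeff :: "'n::finite \<Rightarrow> 'n \<Rightarrow> int ^ 'n \<Rightarrow> int ^ 'n \<Rightarrow> nat \<Rightarrow> int" where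
  "B_coeff k k' \<alpha> d l = (if l = 0 then 0 else tapp d (eps k) * A_coeff k k' \<alpha> (l - 1))"

definition shift_exp :: "'n::finite \<Rightarrow> int ^ 'n \<Rightarrow> nat \<Rightarrow> int ^ 'n" where
  "shift_exp k \<alpha> l = \<alpha> + int l *s eps k"

definition shift_dir :: "'n::finite \<Rightarrow> 'n \<Rightarrow> int ^ 'n \<Rightarrow> int ^ 'n \<Rightarrow> nat \<Rightarrow> int ^ 'n" where
  "shift_dir k k' \<alpha> d l = A_coeff k k' \<alpha> l *s d - B_coeff k k' \<alpha> d l *s e_dir k k'"

end

(*
  Put u = 1 - et, H = h \<otimes> 1 and let D_l = (ad e)^l / l!, extended to the enveloping ring. The twist is
  formally F = (1 \<otimes> u)^H, so conjugation by F sends x \<otimes> 1, for x of h-weight m, to x \<otimes> u^m, and 1 \<otimes> y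
  to \<Sum> (-H)^[l] u^(-l) D_l(y) t^l; likewise w = \<Sum> h^[r] (et)^r / r! conjugates x into
  \<Sum> h^[l] D_l(x) t^l u^(-m). These formulas are integral. Torsion-freeness of U(L) would need a
  Poincare-Birkhoff-Witt theorem over the integers; it is avoided by taking the formulas as
  definitions over the integers and checking every ring and Hopf identity on generators, where each
  one reduces to the Chu-Vandermonde identity for falling factorials of commuting elements. Only the
  comparison with F and w is made over the rationals.

  That D_l preserves the Lie ring is checked on S_gen by the Leibniz rule: the images are combinations of
  the fields D_b(x^\<alpha>) D_a - D_a(x^\<alpha>) D_b, where those with a, b both different from n
  occur only with even coefficients, and twice such a field is a combination of brackets of generators.
*)
theory Submission
  imports Defs
begin

text \<open>The assignment of x \<otimes> u^m to x depends on the weight m, so it is not visibly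
  additive on the Lie ring. As u^m has the coefficients \<open>tcoeff n m\<close> times (-e)^n, each
  power of t asks only for an operator that multiplies the weight-m part of x by an integer
  depending on m. Such operators preserve the Lie ring because it is graded by exponents. The
  resulting maps are defined on all of U(L) and evaluated on weight vectors. Identities in an
  integer exponent are reduced to one multiplication by the unit u: the step goes upwards by
  multiplying and downwards by cancelling u. The binomial expansions of powers and falling
  factorials follow from one Pascal recursion. The divided powers of ad e are given by their closed
  form with integral coefficients. Their composition and Leibniz rules are first proved multiplied
  by an integer, which may be cancelled because the Lie ring consists of integral vector fields and
  is torsion-free. No such cancellation takes place in U(L). The even coefficients come from the -2
  in e: applied to a field with index k, the divided powers produce twice a field with index
  k'.\<close>

lemma additive_zero:
  fixes f :: "'a::ab_group_add \<Rightarrow> 'b::ab_group_add"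
  assumes "\<And>x y. f (x + y) = f x + f y"
  shows "f 0 = 0"
  using assms[of 0 0] by simp

lemma additive_minus:
  fixes f :: "'a::ab_group_add \<Rightarrow> 'b::ab_group_add"
  assumes "\<And>x y. f (x + y) = f x + f y"
  shows "f (- x) = - f x"
  using assms[of "- x" x] additive_zero[of f, OF assms] by (simp add: eq_neg_iff_add_eq_0)

lemma additive_diff:
  fixes f :: "'a::ab_group_add \<Rightarrow> 'b::ab_group_add"
  assumes "\<And>x y. f (x + y) = f x + f y"
  shows "f (x - y) = f x - f y"
  using assms[of x "- y"] additive_minus[of f y, OF assms] by simp

lemma additive_sum:
  fixes f :: "'a::ab_group_add \<Rightarrow> 'b::ab_group_add"
  assumes "\<And>x y. f (x + y) = f x + f y"
  shows "f (\<Sum>i\<in>I. g i) = (\<Sum>i\<in>I. f (g i))"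
  by (induction I rule: infinite_finite_induct) (simp_all add: assms additive_zero[of f, OF assms])

text \<open>Lifts a commutation rule to right-nested products, so that together with
  \<open>mult.assoc\<close> it can rewrite in the middle of a product.\<close>

lemma mult_swap_assoc: "a * b = b' * a' \<Longrightarrow> a * (b * c) = b' * (a' * (c :: 'a::semigroup_mult))"
  by (simp flip: mult.assoc)

lemma of_nat_mult_left: "a * (of_nat n * b) = of_nat n * (a * (b :: 'a::semiring_1))"
  by (rule mult_swap_assoc) (simp add: mult_of_nat_commute)

section \<open>Falling factorials in noncommutative rings\<close>

text \<open>Integers are central, so z carries every factor x - j to y - j. In the applications y
  differs from x by an integer, the weight of z.\<close>

lemma falling_intertwine:
  assumes "z * x = y * z"
  shows "z * falling x n = falling y n * (z :: 'a::ring_1)"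
proof (induction n)
  case (Suc n)
  have "z * falling x (Suc n) = falling y n * (z * (x - of_nat n))"
    using Suc by (simp flip: mult.assoc)
  also have "z * (x - of_nat n) = (y - of_nat n) * z"
    by (simp add: algebra_simps assms mult_of_nat_commute)
  finally show ?case by (simp add: mult.assoc)
qed simp

lemma falling_commute:
  "z * x = x * z \<Longrightarrow> z * falling x n = falling x n * (z :: 'a::ring_1)"
  by (rule falling_intertwine)

lemma falling_Suc_left: "falling x (Suc n) = x * falling (x - 1) (n :: nat)"
  for x :: "'a::ring_1"
proof (induction n)
  case (Suc n)
  have "falling x (Suc (Suc n)) = x * falling (x - 1) n * (x - of_nat (Suc n))"
    using Suc by simp
  then show ?case by (simp add: mult.assoc diff_diff_eq)
qed simp

lemma falling_Suc_right: "falling x (Suc n) = (x - of_nat n) * falling x (n :: nat)"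
  for x :: "'a::ring_1"
  using falling_commute[of "x - of_nat n" x n]
  by (simp add: algebra_simps mult_of_nat_commute)

lemma falling_add: "falling x (m + n) = falling x m * falling (x - of_nat m) n"
  for x :: "'a::ring_1"
  by (induction n) (simp_all add: mult.assoc diff_diff_eq)

lemma falling_zero: "falling 0 n = (if n = 0 then 1 else (0 :: 'a::ring_1))"
  by (cases n) (simp_all add: falling_Suc_left del: falling.simps(2))

text \<open>The difference equation of the falling factorials. It drives every passage from an
  exponent m to m + 1.\<close>

lemma falling_add_one: "falling (x + 1) (Suc n) = falling x (Suc n) + of_nat (Suc n) * falling x n"
  for x :: "'a::ring_1"
proof -
  have "falling (x + 1) (Suc n) = (x + 1) * falling x n"
    using falling_Suc_left[of "x + 1" n] by simp
  moreover have "falling x (Suc n) = (x - of_nat n) * falling x n"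
    by (rule falling_Suc_right)
  ultimately show ?thesis by (simp add: algebra_simps)
qed

lemma sum_Pascal:
  fixes f :: "nat \<Rightarrow> 'a::ring_1"
  shows "(\<Sum>i\<le>Suc n. of_nat (Suc n choose i) * f i)
       = (\<Sum>i\<le>n. of_nat (n choose i) * f (Suc i)) + (\<Sum>i\<le>n. of_nat (n choose i) * f i)"
proof -
  have "(\<Sum>i\<le>Suc n. of_nat (Suc n choose i) * f i)
      = f 0 + (\<Sum>i\<le>n. of_nat (n choose i) * f (Suc i)) + (\<Sum>i\<le>n. of_nat (n choose Suc i) * f (Suc i))"
    by (simp only: sum.atMost_Suc_shift) (simp add: distrib_right sum.distrib add.assoc)
  moreover have "f 0 + (\<Sum>i\<le>n. of_nat (n choose Suc i) * f (Suc i)) = (\<Sum>i\<le>Suc n. of_nat (n choose i) * f i)"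
    by (simp only: sum.atMost_Suc_shift) simp
  moreover have "\<dots> = (\<Sum>i\<le>n. of_nat (n choose i) * f i)" by (simp add: binomial_eq_0)
  ultimately show ?thesis by (simp add: ac_simps)
qed

text \<open>Common scheme of the binomial expansions: an additive operator advances F, and it splits
  the term at (i, k) into the terms at (i + 1, k) and (i, k + 1) of the Pascal triangle. The
  operator may depend on n = i + k, as the next factor of a falling factorial does.\<close>

lemma Pascal_sum:
  fixes T :: "nat \<Rightarrow> nat \<Rightarrow> 'a::ring_1"
  assumes F: "F 0 = T 0 0" "\<And>n. F (Suc n) = \<Phi> n (F n)"
    and add: "\<And>n x y. \<Phi> n (x + y) = \<Phi> n x + \<Phi> n y"
    and T: "\<And>i k. \<Phi> (i + k) (T i k) = T (Suc i) k + T i (Suc k)"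
  shows "F n = (\<Sum>i\<le>n. of_nat (n choose i) * T i (n - i))"
proof (induction n)
  case (Suc n)
  have c: "\<Phi> n (of_nat c * x) = of_nat c * \<Phi> n x" for c x
    by (induction c) (simp_all add: distrib_right add additive_zero[of "\<Phi> n", OF add])
  have "F (Suc n) = (\<Sum>i\<le>n. of_nat (n choose i) * \<Phi> n (T i (n - i)))"
    by (simp only: F Suc additive_sum[of "\<Phi> n", OF add] c)
  also have "\<dots> = (\<Sum>i\<le>n. of_nat (n choose i) * T (Suc i) (Suc n - Suc i))
      + (\<Sum>i\<le>n. of_nat (n choose i) * T i (Suc n - i))"
    unfolding sum.distrib[symmetric]
  proof (rule sum.cong[OF refl])
    fix i assume "i \<in> {..n}"
    then show "of_nat (n choose i) * \<Phi> n (T i (n - i))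
        = of_nat (n choose i) * T (Suc i) (Suc n - Suc i) + of_nat (n choose i) * T i (Suc n - i)"
      using T[of i "n - i"] by (simp add: Suc_diff_le distrib_left)
  qed
  also have "\<dots> = (\<Sum>i\<le>Suc n. of_nat (Suc n choose i) * T i (Suc n - i))"
    by (rule sum_Pascal[symmetric])
  finally show ?case .
qed (simp add: F)

text \<open>The next factor x + y - (i + k) splits as (x - i) + (y - k), which extends either one of
  the two falling factorials.\<close>

lemma falling_vandermonde:
  fixes x y :: "'a::ring_1"
  assumes "x * y = y * x"
  shows "falling (x + y) n = (\<Sum>i\<le>n. of_nat (n choose i) * (falling x i * falling y (n - i)))"
proof (rule Pascal_sum[where \<Phi> = "\<lambda>n z. z * (x + y - of_nat n)"])
  fix i k
  have "falling x i * falling y k * x = falling x i * x * falling y k"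
    using falling_commute[OF assms, of k] by (simp add: mult.assoc)
  moreover have "falling x i * falling y k * of_nat i = falling x i * of_nat i * falling y k"
    by (simp add: mult.assoc mult_of_nat_commute)
  ultimately show "falling x i * falling y k * (x + y - of_nat (i + k))
      = falling x (Suc i) * falling y k + falling x i * falling y (Suc k)"
    by (simp add: algebra_simps)
qed (simp_all add: distrib_right)

lemma falling_minus: "falling (- x) n = (- 1) ^ n * rising 0 x n" for x :: "'a::ring_1"
proof (induction n)
  case (Suc n)
  then show ?case by (simp add: mult.assoc distrib_left right_diff_distrib)
qed simp

text \<open>Reads the shifted rising factorial of the antipode formula from its largest factor
  downwards, where \<open>falling_intertwine\<close> applies.\<close>

lemma rising_one: "rising 1 x n = falling (x + of_nat n) n" for x :: "'a::ring_1"
proof (induction n)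
  case (Suc n)
  have "rising 1 x (Suc n) = falling (x + of_nat n) n * (x + 1 + of_nat n)" using Suc by simp
  also have "\<dots> = (x + 1 + of_nat n) * falling (x + of_nat n) n"
  proof (rule falling_commute[symmetric])
    have "(z + 1) * z = z * (z + 1)" for z :: 'a by (simp add: distrib_left distrib_right)
    from this[of "x + of_nat n"] show "(x + 1 + of_nat n) * (x + of_nat n) = (x + of_nat n) * (x + 1 + of_nat n)"
      by (simp add: ac_simps)
  qed
  also have "\<dots> = falling (x + of_nat (Suc n)) (Suc n)"
    unfolding falling_Suc_left by (simp add: algebra_simps)
  finally show ?case .
qed simp

section \<open>Ring homomorphisms and integer powers of units\<close>

lemma hom_ringI:
  "f 1 = 1 \<Longrightarrow> (\<And>x y. f (x + y) = f x + f y) \<Longrightarrow> (\<And>x y. f (x * y) = f x * f y) \<Longrightarrow> hom_ring f"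
  by (simp add: hom_ring_def)

context
  fixes f :: "'a::ring_1 \<Rightarrow> 'b::ring_1"
  assumes f: "hom_ring f"
begin

lemma hom_one: "f 1 = 1" and hom_add: "f (x + y) = f x + f y" and hom_mult: "f (x * y) = f x * f y"
  using f by (simp_all add: hom_ring_def)

lemma hom_zero: "f 0 = 0" by (rule additive_zero) (rule hom_add)
lemma hom_minus: "f (- x) = - f x" by (rule additive_minus) (rule hom_add)
lemma hom_diff: "f (x - y) = f x - f y" by (rule additive_diff) (rule hom_add)
lemma hom_sum: "f (\<Sum>i\<in>I. g i) = (\<Sum>i\<in>I. f (g i))" by (rule additive_sum) (rule hom_add)
lemma hom_of_nat: "f (of_nat n) = of_nat n" by (induction n) (simp_all add: hom_zero hom_add hom_one)
lemma hom_of_int: "f (of_int n) = of_int n" by (cases n rule: int_diff_cases) (simp add: hom_diff hom_of_nat)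
lemma hom_power: "f (x ^ n) = f x ^ n" by (induction n) (simp_all add: hom_one hom_mult)
lemma hom_falling: "f (falling x n) = falling (f x) n"
  by (induction n) (simp_all add: hom_one hom_mult hom_diff hom_of_nat)

lemmas homs = hom_one hom_add hom_mult hom_zero hom_minus hom_diff hom_sum hom_of_nat hom_of_int hom_power hom_falling

end

lemma hom_ring_comp: "hom_ring f \<Longrightarrow> hom_ring g \<Longrightarrow> hom_ring (\<lambda>x. f (g x))"
  by (simp add: hom_ring_def)

lemma hom_ring_id: "hom_ring (\<lambda>x. x)" by (simp add: hom_ring_def)

section \<open>Integer powers of a unit\<close>

lemma unit_inv_eq:
  assumes "u * v = 1" "v * u = (1 :: 'a::monoid_mult)"
  shows "unit_inv u = v"
  unfolding unit_inv_def
proof (rule the_equality)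
  show "v' = v" if "u * v' = 1 \<and> v' * u = 1" for v'
    using assms that by (metis mult.assoc mult_1_left mult_1_right)
qed (use assms in simp)

lemma unit_inv:
  assumes "is_unit_elt (u :: 'a::monoid_mult)"
  shows "u * unit_inv u = 1" "unit_inv u * u = 1"
  using assms unit_inv_eq unfolding is_unit_elt_def by blast+

lemma unit_powi_0: "unit_powi u 0 = 1" and unit_powi_1: "unit_powi u 1 = u"
  by (simp_all add: unit_powi_def)

lemma unit_powi_Suc:
  assumes u: "is_unit_elt (u :: 'a::monoid_mult)"
  shows "unit_powi u (m + 1) = u * unit_powi u m" "unit_powi u (m + 1) = unit_powi u m * u"
proof -
  have "u ^ nat (m + 1) = u * u ^ nat m" "u ^ nat (m + 1) = u ^ nat m * u" if "m \<ge> 0"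
    using that by (simp_all add: nat_add_distrib power_commutes)
  moreover have "unit_inv u ^ nat (- (m + 1)) = u * unit_inv u ^ nat (- m)"
      "unit_inv u ^ nat (- (m + 1)) = unit_inv u ^ nat (- m) * u" if "m < 0"
  proof -
    from that have k: "nat (- m) = Suc (nat (- (m + 1)))" by simp
    have "x = u * (unit_inv u * x)" "x = x * unit_inv u * u" for x
      using unit_inv[OF u] by (metis mult.assoc mult_1_left mult_1_right)+
    note inv = this
    show "unit_inv u ^ nat (- (m + 1)) = u * unit_inv u ^ nat (- m)"
      unfolding k power_Suc by (rule inv(1))
    show "unit_inv u ^ nat (- (m + 1)) = unit_inv u ^ nat (- m) * u"
      unfolding k power_Suc2 by (rule inv(2))
  qed
  moreover have "m = -1 \<or> m \<ge> 0 \<or> m < -1" by linarith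
  ultimately show "unit_powi u (m + 1) = u * unit_powi u m" "unit_powi u (m + 1) = unit_powi u m * u"
    by (auto simp: unit_powi_def)
qed

lemma unit_powi_cancel:
  assumes u: "is_unit_elt (u :: 'a::monoid_mult)" and "x * u = y * u"
  shows "x = y"
  using assms unit_inv[OF u] by (metis mult.assoc mult_1_right)

text \<open>The downward step also relates m and m + 1, so both steps use the same equation: the
  upward one multiplies it by a unit, the downward one cancels that unit.\<close>

lemma int_shift_induct [case_names zero up down]:
  assumes "P (0::int)" "\<And>m. P m \<Longrightarrow> P (m + 1)" "\<And>m. P (m + 1) \<Longrightarrow> P m"
  shows "P m"
proof (induction m rule: int_induct[of _ 0])
  case (step2 i)
  then show ?case using assms(3)[of "i - 1"] by simp
qed (use assms in auto)

lemma unit_powi_add: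
  assumes u: "is_unit_elt (u :: 'a::monoid_mult)"
  shows "unit_powi u (m + n) = unit_powi u m * unit_powi u n"
proof (induction n rule: int_shift_induct)
  case (up n)
  then show ?case
    using unit_powi_Suc(2)[OF u, of "m + n"] unit_powi_Suc(2)[OF u, of n] by (simp add: add.assoc mult.assoc)
next
  case (down n)
  then have "unit_powi u (m + n) * u = unit_powi u m * unit_powi u n * u"
    using unit_powi_Suc(2)[OF u, of "m + n"] unit_powi_Suc(2)[OF u, of n] by (simp add: add.assoc mult.assoc)
  then show ?case by (rule unit_powi_cancel[OF u])
qed (simp add: unit_powi_0)

text \<open>A family over the integers that one factor u advances by one is determined by any
  member. An identity for all powers of u thus reduces to a single step and one known value, usually
  at 0.\<close>

lemma unit_powi_intertwine:
  assumes u: "is_unit_elt (u :: 'a::monoid_mult)" and a: "\<And>m. a m * u = a (m + 1)"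
  shows "a (m + j) = a m * unit_powi u j"
proof (induction j rule: int_shift_induct)
  case (up j)
  then show ?case using a[of "m + j"] unit_powi_Suc(2)[OF u, of j] by (simp add: add.assoc mult.assoc)
next
  case (down j)
  then have "a (m + j) * u = a m * unit_powi u j * u"
    using a[of "m + j"] unit_powi_Suc(2)[OF u, of j] by (simp add: add.assoc mult.assoc)
  then show ?case by (rule unit_powi_cancel[OF u])
qed (simp add: unit_powi_0)

lemma is_unit_elt_hom: "hom_ring f \<Longrightarrow> is_unit_elt u \<Longrightarrow> is_unit_elt (f u)"
  unfolding is_unit_elt_def by (metis hom_mult hom_one)

lemma hom_unit_powi:
  assumes f: "hom_ring f" and u: "is_unit_elt u"
  shows "f (unit_powi u m) = unit_powi (f u) m"
  using unit_powi_intertwine[OF is_unit_elt_hom[OF f u], of "\<lambda>m. f (unit_powi u m)" 0 m]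
  by (simp add: unit_powi_0 hom_one[OF f] unit_powi_Suc(2)[OF u] hom_mult[OF f])

lemma unit_powi_commute:
  assumes u: "is_unit_elt u" and c: "x * u = u * (x :: 'a::monoid_mult)"
  shows "x * unit_powi u m = unit_powi u m * x"
proof (induction m rule: int_shift_induct)
  case (up m)
  then show ?case using unit_powi_Suc(2)[OF u, of m] c by (metis mult.assoc)
next
  case (down m)
  then have "x * unit_powi u m * u = unit_powi u m * x * u"
    using unit_powi_Suc(2)[OF u, of m] c by (metis mult.assoc)
  then show ?case by (rule unit_powi_cancel[OF u])
qed (simp add: unit_powi_0)

lemma unit_powi_cancel_left:
  assumes u: "is_unit_elt (u :: 'a::monoid_mult)" and "u * x = u * y"
  shows "x = y"
  using assms unit_inv[OF u] by (metis mult.assoc mult_1_left)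

lemma unit_powi_intertwine_left:
  assumes u: "is_unit_elt (u :: 'a::monoid_mult)" and a: "\<And>m. u * a m = a (m + 1)"
  shows "unit_powi u j * a m = a (m + j)"
proof (induction j rule: int_shift_induct)
  case (up j)
  then show ?case using a[of "m + j"] by (simp add: unit_powi_Suc(1)[OF u] mult.assoc add.assoc)
next
  case (down j)
  then have "u * (unit_powi u j * a m) = u * a (m + j)"
    using a[of "m + j"] by (simp add: unit_powi_Suc(1)[OF u] mult.assoc add.assoc)
  then show ?case by (rule unit_powi_cancel_left[OF u])
qed (simp add: unit_powi_0)

lemma unit_powi_one: "unit_powi 1 m = (1 :: 'a::monoid_mult)"
proof -
  have "unit_inv 1 = (1 :: 'a)" by (rule unit_inv_eq) simp_all
  then show ?thesis by (simp add: unit_powi_def)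
qed

lemma unit_conj:
  assumes "is_unit_elt (u :: 'a::monoid_mult)" "x * u = u * y"
  shows "x = u * y * unit_inv u"
proof -
  have "x = x * (u * unit_inv u)" by (simp add: unit_inv[OF assms(1)])
  then show ?thesis by (simp add: assms(2) flip: mult.assoc)
qed

section \<open>Convergent series in \<open>t\<close>\<close>

lemma sum_triangle:
  fixes f :: "nat \<Rightarrow> nat \<Rightarrow> 'a::comm_monoid_add"
  shows "(\<Sum>l\<le>n. \<Sum>i\<le>n - l. f l i) = (\<Sum>m\<le>n. \<Sum>l\<le>m. f l (m - l))"
proof -
  have "(\<Sum>l\<le>n. \<Sum>i\<le>n - l. f l i) = (\<Sum>(l, i)\<in>{(l, i). l + i \<le> n}. f l i)"
    by (subst sum.Sigma) (auto intro!: sum.cong)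
  also have "\<dots> = (\<Sum>m\<le>n. \<Sum>l\<le>m. f l (m - l))"
    by (rule sum.triangle_reindex_eq)
  finally show ?thesis .
qed

lemma sum_rev:
  fixes f :: "nat \<Rightarrow> nat \<Rightarrow> 'a::comm_monoid_add"
  shows "(\<Sum>i\<le>n. f i (n - i)) = (\<Sum>i\<le>n. f (n - i) i)"
  by (rule sum.reindex_bij_witness[of _ "\<lambda>i. n - i" "\<lambda>i. n - i"]) auto

lemma sum_triangle_swap:
  fixes f :: "nat \<Rightarrow> nat \<Rightarrow> 'a::comm_monoid_add"
  shows "(\<Sum>l\<le>n. \<Sum>i\<le>n - l. f l i) = (\<Sum>i\<le>n. \<Sum>l\<le>n - i. f l i)"
  unfolding sum_triangle by (simp only: sum_rev)

lemma fps_mult_nth': "fps_nth (f * g) n = (\<Sum>i\<le>n. fps_nth f i * fps_nth g (n - i))"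
  by (simp add: fps_mult_nth atMost_atLeast0)

lemma fps_series_nth: "fps_nth (fps_series c) n = (\<Sum>l\<le>n. fps_nth (c l) (n - l))"
  by (simp add: fps_series_def)

lemma fps_series_cong: "(\<And>l. c l = d l) \<Longrightarrow> fps_series c = fps_series d"
  by (simp add: fps_series_def)

lemma fps_series_add: "fps_series (\<lambda>l. c l + d l) = fps_series c + fps_series d"
  by (rule fps_ext) (simp add: fps_series_nth sum.distrib)

lemma fps_series_minus: "fps_series (\<lambda>l. - c l :: 'a::ab_group_add fps) = - fps_series c"
  by (rule fps_ext) (simp add: fps_series_nth sum_negf)

lemma fps_series_diff: "fps_series (\<lambda>l. c l - d l :: 'a::ab_group_add fps) = fps_series c - fps_series d"
  by (rule fps_ext) (simp add: fps_series_nth sum_subtractf)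

lemma fps_series_zero: "fps_series (\<lambda>l. 0) = 0"
  by (rule fps_ext) (simp add: fps_series_nth)

lemma fps_series_mult_left: "a * fps_series c = fps_series (\<lambda>l. a * c l)"
  for a :: "'a::semiring_0 fps"
proof (rule fps_ext)
  fix n
  have "fps_nth (a * fps_series c) n = (\<Sum>i\<le>n. \<Sum>l\<le>n - i. fps_nth a i * fps_nth (c l) (n - i - l))"
    by (simp add: fps_mult_nth' fps_series_nth sum_distrib_left)
  also have "\<dots> = (\<Sum>l\<le>n. \<Sum>i\<le>n - l. fps_nth a i * fps_nth (c l) (n - i - l))"
    by (rule sum_triangle_swap)
  also have "\<dots> = fps_nth (fps_series (\<lambda>l. a * c l)) n"
    by (simp add: fps_mult_nth' fps_series_nth add.commute diff_diff_eq)
  finally show "fps_nth (a * fps_series c) n = fps_nth (fps_series (\<lambda>l. a * c l)) n" .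
qed

lemma fps_series_mult_right: "fps_series c * a = fps_series (\<lambda>l. c l * a)"
  for a :: "'a::semiring_0 fps"
proof (rule fps_ext)
  fix n
  have "fps_nth (fps_series c * a) n = (\<Sum>m\<le>n. \<Sum>l\<le>m. fps_nth (c l) (m - l) * fps_nth a (n - m))"
    by (simp add: fps_mult_nth' fps_series_nth sum_distrib_right)
  also have "\<dots> = (\<Sum>m\<le>n. \<Sum>l\<le>m. fps_nth (c l) (m - l) * fps_nth a (n - l - (m - l)))"
    by simp
  also have "\<dots> = (\<Sum>l\<le>n. \<Sum>i\<le>n - l. fps_nth (c l) i * fps_nth a (n - l - i))"
    unfolding sum_triangle ..
  finally show "fps_nth (fps_series c * a) n = fps_nth (fps_series (\<lambda>l. c l * a)) n"
    by (simp add: fps_mult_nth' fps_series_nth)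
qed

text \<open>Collects a double series by total degree in t. The inner finite sum is then the place
  where a Vandermonde identity applies.\<close>

lemma fps_series_nested:
  "fps_series (\<lambda>l. fps_series (c l)) = fps_series (\<lambda>n. \<Sum>l\<le>n. c l (n - l))"
proof (rule fps_ext)
  fix n
  have "fps_nth (fps_series (\<lambda>l. fps_series (c l))) n = (\<Sum>l\<le>n. \<Sum>i\<le>n - l. fps_nth (c l i) (n - l - i))"
    by (simp add: fps_series_nth)
  also have "\<dots> = (\<Sum>m\<le>n. \<Sum>l\<le>m. fps_nth (c l (m - l)) (n - l - (m - l)))"
    by (rule sum_triangle)
  also have "\<dots> = (\<Sum>m\<le>n. \<Sum>l\<le>m. fps_nth (c l (m - l)) (n - m))"
    by simp
  finally show "fps_nth (fps_series (\<lambda>l. fps_series (c l))) n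
      = fps_nth (fps_series (\<lambda>n. \<Sum>l\<le>n. c l (n - l))) n"
    by (simp add: fps_series_nth fps_sum_nth)
qed

lemma fps_series_Suc: "fps_series c = c 0 + fps_X * fps_series (\<lambda>l. c (Suc l))"
  for c :: "nat \<Rightarrow> 'a::semiring_1 fps"
proof (rule fps_ext)
  show "fps_nth (fps_series c) n = fps_nth (c 0 + fps_X * fps_series (\<lambda>l. c (Suc l))) n" for n
    by (cases n) (simp_all add: fps_series_nth sum.atMost_Suc_shift del: sum.atMost_Suc)
qed

lemma fps_series_single: "(\<And>l. c (Suc l) = 0) \<Longrightarrow> fps_series c = c 0"
  for c :: "nat \<Rightarrow> 'a::semiring_1 fps"
  by (subst fps_series_Suc) (simp add: fps_series_zero)

lemma fps_series_const: "fps_series (\<lambda>l. fps_const (c l)) = Abs_fps c"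
proof (rule fps_ext)
  fix n
  have "(\<Sum>l\<le>n. fps_nth (fps_const (c l)) (n - l)) = (\<Sum>l\<le>n. if l = n then c l else 0)"
    by (rule sum.cong) auto
  then show "fps_nth (fps_series (\<lambda>l. fps_const (c l))) n = fps_nth (Abs_fps c) n"
    by (simp add: fps_series_nth)
qed

lemma fps_series_nth_0: "fps_nth (fps_series c) 0 = fps_nth (c 0) 0"
  by (simp add: fps_series_nth)

lemma fps_X_commute: "a * fps_X = fps_X * (a :: 'a::semiring_1 fps)"
  by (simp add: fps_mult_fps_X_commute)

lemma hom_fps_const: "hom_ring (fps_const :: 'a::ring_1 \<Rightarrow> 'a fps)"
  by (rule hom_ringI) simp_all

lemma hom_fps_nth_0: "hom_ring (\<lambda>a. fps_nth a 0 :: 'a::ring_1)"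
  by (rule hom_ringI) simp_all

lemma map_fps_nth [simp]: "fps_nth (map_fps f A) n = f (fps_nth A n)"
  by (simp add: map_fps_def)

lemma map_fps_comp: "map_fps f (map_fps g A) = map_fps (\<lambda>x. f (g x)) A"
  by (simp add: map_fps_def)

lemma map_fps_series:
  fixes f :: "'a::ab_group_add \<Rightarrow> 'b::ab_group_add"
  assumes "\<And>x y. f (x + y) = f x + f y"
  shows "map_fps f (fps_series c) = fps_series (\<lambda>l. map_fps f (c l))"
  by (rule fps_ext) (simp add: fps_series_nth additive_sum[of f, OF assms])

lemma map_fps_const: "f 0 = 0 \<Longrightarrow> map_fps f (fps_const a) = fps_const (f a)"
  by (rule fps_ext) simp

lemma map_fps_X: "hom_ring f \<Longrightarrow> map_fps f fps_X = fps_X"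
  by (rule fps_ext) (simp add: fps_X_def hom_zero hom_one)

lemma hom_map_fps:
  assumes f: "hom_ring f"
  shows "hom_ring (map_fps f)"
proof (rule hom_ringI)
  show "map_fps f 1 = 1" by (rule fps_ext) (simp add: hom_one[OF f] hom_zero[OF f])
  show "map_fps f (x + y) = map_fps f x + map_fps f y" for x y
    by (rule fps_ext) (simp add: hom_add[OF f])
  show "map_fps f (x * y) = map_fps f x * map_fps f y" for x y
    by (rule fps_ext) (simp add: fps_mult_nth' hom_sum[OF f] hom_mult[OF f])
qed

section \<open>Continuous extension of maps from constants to power series in t\<close>

definition fps_ext_map :: "('a \<Rightarrow> 'b::comm_monoid_add fps) \<Rightarrow> 'a fps \<Rightarrow> 'b fps" where
  "fps_ext_map f A = fps_series (\<lambda>i. f (fps_nth A i))"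

context
  fixes f :: "'a::ring_1 \<Rightarrow> 'b::ring_1 fps"
  assumes add: "\<And>x y. f (x + y) = f x + f y"
begin

lemma fps_ext_map_add: "fps_ext_map f (A + B) = fps_ext_map f A + fps_ext_map f B"
  by (simp add: fps_ext_map_def add fps_series_add)

lemma fps_ext_map_series: "fps_ext_map f (fps_series c) = fps_series (\<lambda>l. fps_ext_map f (c l))"
  unfolding fps_ext_map_def fps_series_nested
  by (simp add: fps_series_nth additive_sum[of f, OF add])

lemma fps_ext_map_const: "fps_ext_map f (fps_const a) = f a"
  unfolding fps_ext_map_def
  by (subst fps_series_single) (simp_all add: additive_zero[of f, OF add])

lemma t_linear_ext_map: "t_linear (fps_ext_map f)"
  unfolding t_linear_def by (simp add: fps_ext_map_add fps_ext_map_const) (simp add: fps_ext_map_def)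

end

lemma t_linear_ext: "t_linear f \<Longrightarrow> f A = fps_ext_map (\<lambda>a. f (fps_const a)) A"
  unfolding t_linear_def fps_ext_map_def by blast

lemma t_linear_add: "t_linear f \<Longrightarrow> f (A + B) = f A + f B"
  unfolding t_linear_def by blast

text \<open>\<open>t_linear\<close> speaks only of expansions into constants. A series of power
  series is reduced to these by writing f as the extension of its restriction to constants and
  regrouping the double sum.\<close>

lemma t_linear_series:
  assumes f: "t_linear f"
  shows "f (fps_series c) = fps_series (\<lambda>l. f (c l))"
proof -
  define g where "g a = f (fps_const a)" for a
  have g: "g (a + b) = g a + g b" for a b
    using t_linear_add[OF f, of "fps_const a" "fps_const b"] by (simp add: g_def)
  have "f A = fps_ext_map g A" for A
    unfolding g_def by (rule t_linear_ext[OF f])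
  then show ?thesis
    using fps_ext_map_series[of g c] g by simp
qed

lemma t_linear_eqI:
  assumes f: "t_linear f" and g: "t_linear g" and "\<And>a. f (fps_const a) = g (fps_const a)"
  shows "f A = g A"
proof -
  have "f A = fps_ext_map (\<lambda>a. f (fps_const a)) A" by (rule t_linear_ext[OF f])
  also have "\<dots> = fps_ext_map (\<lambda>a. g (fps_const a)) A" by (simp only: assms(3))
  also have "\<dots> = g A" by (rule t_linear_ext[OF g, symmetric])
  finally show ?thesis .
qed

lemma t_linearI:
  "(\<And>A B. f (A + B) = f A + f B) \<Longrightarrow> (\<And>c. f (fps_series c) = fps_series (\<lambda>l. f (c l))) \<Longrightarrow> t_linear f"
proof -
  assume a: "\<And>A B. f (A + B) = f A + f B" and s: "\<And>c. f (fps_series c) = fps_series (\<lambda>l. f (c l))"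
  have "f A = fps_series (\<lambda>i. f (fps_const (fps_nth A i)))" for A
    using s[of "\<lambda>i. fps_const (fps_nth A i)"] by (simp only: fps_series_const fps_nth_inverse)
  with a show "t_linear f" unfolding t_linear_def by blast
qed

lemma t_linear_comp:
  assumes f: "t_linear f" and g: "t_linear g"
  shows "t_linear (\<lambda>A. f (g A))"
  by (rule t_linearI) (simp_all only: t_linear_add[OF f] t_linear_add[OF g] t_linear_series[OF f] t_linear_series[OF g])

lemma t_linear_map_fps:
  fixes f :: "'a::ring_1 \<Rightarrow> 'b::ring_1"
  assumes "\<And>x y. f (x + y) = f x + f y"
  shows "t_linear (map_fps f)"
  by (rule t_linearI) (simp_all only: map_fps_series[of f, OF assms], rule fps_ext, simp add: assms)

lemma t_linear_id: "t_linear (\<lambda>A. A)"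
  by (rule t_linearI) simp_all

lemma hom_ext_map:
  fixes f :: "'a::ring_1 \<Rightarrow> 'b::ring_1 fps"
  assumes f: "hom_ring f"
  shows "hom_ring (fps_ext_map f)"
proof (rule hom_ringI)
  note add = hom_add[OF f]
  show "fps_ext_map f 1 = 1"
    using fps_ext_map_const[of f 1] add hom_one[OF f] by simp
  show "fps_ext_map f (A + B) = fps_ext_map f A + fps_ext_map f B" for A B
    by (rule fps_ext_map_add) (rule add)
  show "fps_ext_map f (A * B) = fps_ext_map f A * fps_ext_map f B" for A B
    unfolding fps_ext_map_def fps_series_mult_right
    unfolding fps_series_mult_left fps_series_nested
    by (simp add: fps_mult_nth' hom_sum[OF f] hom_mult[OF f])
qed

lemma fps_const_commute_series:
  "(\<And>l. a * c l = c l * a) \<Longrightarrow> a * fps_series c = fps_series c * (a :: 'a::ring_1 fps)"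
  by (simp add: fps_series_mult_left fps_series_mult_right)

lemma antihom_ext_map:
  fixes f :: "'a::ring_1 \<Rightarrow> 'b::ring_1 fps"
  assumes add: "\<And>x y. f (x + y) = f x + f y" and mult: "\<And>x y. f (x * y) = f y * f x"
  shows "fps_ext_map f (A * B) = fps_ext_map f B * fps_ext_map f A"
proof -
  have "fps_ext_map f B * fps_ext_map f A = fps_series (\<lambda>n. \<Sum>i\<le>n. f (fps_nth B i) * f (fps_nth A (n - i)))"
    unfolding fps_ext_map_def fps_series_mult_right
    unfolding fps_series_mult_left by (rule fps_series_nested)
  also have "\<dots> = fps_ext_map f (A * B)"
    unfolding fps_ext_map_def
  proof (rule fps_series_cong)
    fix n
    have "(\<Sum>i\<le>n. f (fps_nth B i) * f (fps_nth A (n - i))) = (\<Sum>i\<le>n. f (fps_nth A i * fps_nth B (n - i)))"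
      unfolding mult by (rule sum_rev)
    then show "(\<Sum>i\<le>n. f (fps_nth B i) * f (fps_nth A (n - i))) = f (fps_nth (A * B) n)"
      by (simp add: fps_mult_nth' additive_sum[of f, OF add])
  qed
  finally show ?thesis ..
qed

text \<open>Presents multiplication by t as a convergent series, so that linearity over t becomes a
  case of \<open>t_linear_series\<close>.\<close>

lemma fps_X_series: "fps_X * A = fps_series (\<lambda>l. if l = 1 then A else (0 :: 'a::semiring_1 fps))"
  by (subst fps_series_Suc, subst fps_series_Suc) (simp add: fps_series_zero)

lemma t_linear_X: "t_linear f \<Longrightarrow> f (fps_X * A) = fps_X * f (A :: 'a::ring_1 fps)"
  using t_linear_series[of f "\<lambda>l. if l = 1 then A else 0"] t_linear_add[of f 0 0]
  by (simp add: fps_X_series if_distrib[of f] cong: if_cong)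

lemma t_linear_zero: "t_linear f \<Longrightarrow> f 0 = 0"
  using t_linear_add[of f 0 0] by simp

lemma t_linear_minus: "t_linear f \<Longrightarrow> f (- A) = - f A"
  using additive_minus[of f, OF t_linear_add] .

lemma t_linear_diff: "t_linear f \<Longrightarrow> f (A - B) = f A - f B"
  using additive_diff[of f, OF t_linear_add] .

context
  fixes F :: "'a::ring_1 fps \<Rightarrow> 'b::ring_1 fps"
  assumes F: "t_linear F"
begin

lemma t_linear_mult_right: "t_linear (\<lambda>P. F (P * C))"
  by (rule t_linearI) (simp_all only: distrib_right t_linear_add[OF F] fps_series_mult_right t_linear_series[OF F])

lemma t_linear_mult_left: "t_linear (\<lambda>P. F (C * P))"
  by (rule t_linearI) (simp_all only: distrib_left t_linear_add[OF F] fps_series_mult_left t_linear_series[OF F])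

lemma t_linear_times_left: "t_linear (\<lambda>P. C * F P)"
  by (rule t_linearI) (simp_all only: distrib_left t_linear_add[OF F] fps_series_mult_left t_linear_series[OF F])

lemma t_linear_times_right: "t_linear (\<lambda>P. F P * C)"
  by (rule t_linearI) (simp_all only: distrib_right t_linear_add[OF F] fps_series_mult_right t_linear_series[OF F])

end

lemma hom_of_int_fps: "hom_ring (map_fps of_int :: int fps \<Rightarrow> 'a::ring_1 fps)"
  by (rule hom_map_fps, rule hom_ringI) simp_all

lemma t_linear_of_int_fps: "t_linear (map_fps of_int :: int fps \<Rightarrow> 'a::ring_1 fps)"
  by (rule t_linear_map_fps) simp

lemma of_int_fps_commute: "map_fps of_int c * A = A * map_fps of_int c" for A :: "'a::ring_1 fps"
proof (rule fps_ext)
  fix n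
  have "(\<Sum>i\<le>n. of_int (fps_nth c i) * fps_nth A (n - i)) = (\<Sum>i\<le>n. fps_nth A i * of_int (fps_nth c (n - i)))"
    unfolding mult_of_int_commute by (rule sum_rev[symmetric])
  then show "fps_nth (map_fps of_int c * A) n = fps_nth (A * map_fps of_int c) n"
    by (simp add: fps_mult_nth')
qed

section \<open>Commutation with powers of \<open>1 - et\<close>\<close>

definition tunit :: "'a::ring_1 \<Rightarrow> 'a fps" where
  "tunit e = 1 - fps_const e * fps_X"

abbreviation tpow :: "'a::ring_1 \<Rightarrow> int \<Rightarrow> 'a fps" where
  "tpow e \<equiv> unit_powi (tunit e)"

lemma tunit_mult_nth: "fps_nth (tunit e * a) n = fps_nth a n - (if n = 0 then 0 else e * fps_nth a (n - 1))"
  by (simp add: tunit_def left_diff_distrib mult.assoc)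

lemma mult_tunit_nth: "fps_nth (a * tunit e) n = fps_nth a n - (if n = 0 then 0 else fps_nth a (n - 1) * e)"
proof -
  have "a * tunit e = a - a * fps_const e * fps_X"
    by (simp add: tunit_def right_diff_distrib mult.assoc)
  then show ?thesis by simp
qed

lemma tunit_nth: "fps_nth (tunit e) n = (if n = 0 then 1 else if n = 1 then - e else 0)"
  using tunit_mult_nth[of e 1 n] by simp

lemma is_unit_tunit: "is_unit_elt (tunit e)"
  unfolding is_unit_elt_def
proof (intro exI conjI)
  have "e ^ n - (if n = 0 then 0 else e * e ^ (n - 1)) = fps_nth 1 n"
    "e ^ n - (if n = 0 then 0 else e ^ (n - 1) * e) = fps_nth 1 n" for n
    by (cases n; simp add: power_commutes)+
  then show "tunit e * Abs_fps (\<lambda>n. e ^ n) = 1" "Abs_fps (\<lambda>n. e ^ n) * tunit e = 1"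
    by (intro fps_ext; simp only: tunit_mult_nth mult_tunit_nth fps_nth_Abs_fps)+
qed

lemma tpow_nth_0: "fps_nth (tpow e m) 0 = 1"
  using hom_unit_powi[OF hom_fps_nth_0 is_unit_tunit, of e m] by (simp add: tunit_nth unit_powi_one)

lemma tpow_add: "tpow e (m + n) = tpow e m * tpow e n"
  by (rule unit_powi_add[OF is_unit_tunit])

lemma tpow_commute: "a * tunit e = tunit e * a \<Longrightarrow> a * tpow e m = tpow e m * a"
  by (rule unit_powi_commute[OF is_unit_tunit])

lemma tpow_commute_const:
  assumes "c * e = e * c"
  shows "fps_const c * tpow e m = tpow e m * fps_const c"
proof (rule tpow_commute)
  have "fps_const e * fps_X * fps_const c = fps_const (e * c) * fps_X"
    by (metis fps_X_commute fps_const_mult mult.assoc)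
  then show "fps_const c * tunit e = tunit e * fps_const c"
    by (simp add: tunit_def right_diff_distrib left_diff_distrib assms flip: mult.assoc)
qed

lemma map_fps_tunit: "hom_ring f \<Longrightarrow> map_fps f (tunit e) = tunit (f e)"
  unfolding tunit_def
  by (simp add: hom_diff[OF hom_map_fps] hom_one[OF hom_map_fps] hom_mult[OF hom_map_fps]
      map_fps_X map_fps_const hom_zero)

lemma map_fps_tpow: "hom_ring f \<Longrightarrow> map_fps f (tpow e m) = tpow (f e) m"
  by (simp add: hom_unit_powi[OF hom_map_fps is_unit_tunit] map_fps_tunit)

lemma fps_const_falling: "fps_const (falling x n) = falling (fps_const x) n"
  by (rule hom_falling[OF hom_fps_const])

lemma of_int_falling: "of_int (falling m n) = falling (of_int m) n"
proof -
  have "hom_ring (of_int :: int \<Rightarrow> 'a::ring_1)" by (rule hom_ringI) simp_all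
  from hom_falling[OF this] show ?thesis .
qed

text \<open>As \<open>tpow (- 1) m\<close> is \<open>(1 + t)\<^sup>m\<close>, these are the binomial coefficients of the integer \<open>m\<close>.\<close>

definition tcoeff :: "nat \<Rightarrow> int \<Rightarrow> int" where
  "tcoeff n m = fps_nth (tpow (- 1) m) n"

text \<open>Substituting -et for t is a ring homomorphism on integral power series, since only
  powers of the one element e occur. It carries 1 + t to 1 - et, hence powers to powers.\<close>

lemma tpow_nth: "fps_nth (tpow e m) n = of_int (tcoeff n m) * (- e) ^ n"
proof -
  define f :: "int fps \<Rightarrow> 'a fps" where "f A = Abs_fps (\<lambda>n. of_int (fps_nth A n) * (- e) ^ n)" for A
  have "hom_ring f"
  proof (rule hom_ringI)
    show "f 1 = 1" by (rule fps_ext) (simp add: f_def)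
    show "f (A + B) = f A + f B" for A B by (rule fps_ext) (simp add: f_def distrib_right)
    have "of_int x * (- e) ^ i * (of_int y * (- e) ^ (n - i)) = of_int (x * y) * (- e) ^ n"
      if "i \<le> n" for x y i n
    proof -
      have "(- e) ^ i * (of_int y * (- e) ^ (n - i)) = of_int y * (- e) ^ n"
        using that
        by (simp only: mult_of_int_commute[of y] mult.assoc[symmetric] power_add[symmetric] le_add_diff_inverse)
      then show ?thesis by (simp add: mult.assoc)
    qed
    then show "f (A * B) = f A * f B" for A B
      by (intro fps_ext) (simp add: f_def fps_mult_nth' sum_distrib_right)
  qed
  moreover have "f (tunit (- 1)) = tunit e"
    by (rule fps_ext) (simp add: f_def tunit_def fps_X_def)
  ultimately have "f (tpow (- 1) m) = tpow e m"
    using hom_unit_powi[of f, OF _ is_unit_tunit] by simp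
  then have "fps_nth (tpow e m) n = fps_nth (f (tpow (- 1) m)) n" by simp
  then show ?thesis by (simp add: f_def tcoeff_def)
qed

text \<open>
  \<open>z\<^sub>l\<close> behaves as the divided power \<open>(ad e)\<^sup>l z\<^sub>0 / l!\<close>.
\<close>

definition divided_seq :: "'a::ring_1 \<Rightarrow> (nat \<Rightarrow> 'a) \<Rightarrow> bool" where
  "divided_seq e z \<longleftrightarrow> (\<forall>l. e * z l - z l * e = of_nat (Suc l) * z (Suc l))"

text \<open>The divided powers of \<open>z l\<close> itself: applying D_i after D_l gives binomial
  (l + i, i) times D_(l + i).\<close>

definition seq_shift :: "nat \<Rightarrow> (nat \<Rightarrow> 'a::ring_1) \<Rightarrow> nat \<Rightarrow> 'a" where
  "seq_shift l z i = of_nat (l + i choose i) * z (l + i)"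

text \<open>The Leibniz rule: these are the divided powers of the product of the two initial
  terms.\<close>

definition seq_mult :: "(nat \<Rightarrow> 'a::ring_1) \<Rightarrow> (nat \<Rightarrow> 'a) \<Rightarrow> nat \<Rightarrow> 'a" where
  "seq_mult z z' n = (\<Sum>i\<le>n. z i * z' (n - i))"

lemma divided_seq_hom:
  assumes f: "hom_ring f" and z: "divided_seq e z"
  shows "divided_seq (f e) (\<lambda>l. f (z l))"
  unfolding divided_seq_def
proof
  fix l
  have "f (e * z l - z l * e) = f (of_nat (Suc l) * z (Suc l))"
    using z by (simp only: divided_seq_def)
  then show "f e * f (z l) - f (z l) * f e = of_nat (Suc l) * f (z (Suc l))"
    by (simp only: homs[OF f])
qed

lemma divided_seq_shift:
  assumes "divided_seq e z"
  shows "divided_seq e (seq_shift l z)"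
  unfolding divided_seq_def
proof
  fix i
  have "e * seq_shift l z i - seq_shift l z i * e = of_nat (l + i choose i) * (e * z (l + i) - z (l + i) * e)"
    by (simp only: seq_shift_def right_diff_distrib mult.assoc of_nat_mult_left)
  also have "\<dots> = of_nat ((l + i choose i) * Suc (l + i)) * z (Suc (l + i))"
    using assms unfolding divided_seq_def by (simp only: of_nat_mult mult.assoc)
  also have "(l + i choose i) * Suc (l + i) = Suc i * (l + Suc i choose Suc i)"
    by (metis Suc_times_binomial_eq add_Suc_right mult.commute)
  finally show "e * seq_shift l z i - seq_shift l z i * e = of_nat (Suc i) * seq_shift l z (Suc i)"
    by (simp only: seq_shift_def of_nat_mult mult.assoc add_Suc_right)
qed

lemma divided_seq_tunit:
  assumes "divided_seq e z"
  shows "fps_const (z l) * tunit e = tunit e * fps_const (z l) + fps_X * fps_const (of_nat (Suc l) * z (Suc l))"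
proof -
  have "fps_const (of_nat (Suc l) * z (Suc l)) = fps_const e * fps_const (z l) - fps_const (z l) * fps_const e"
    using assms by (simp add: divided_seq_def)
  moreover have "tunit e * fps_const (z l) = fps_const (z l) - fps_X * (fps_const e * fps_const (z l))"
    by (simp only: tunit_def left_diff_distrib mult_1_left fps_X_commute[of "fps_const e"] mult.assoc)
  moreover have "fps_const (z l) * tunit e = fps_const (z l) - fps_X * (fps_const (z l) * fps_const e)"
    by (simp only: tunit_def right_diff_distrib mult_1_right fps_X_commute[of "_ * fps_const e"] flip: mult.assoc)
  ultimately show ?thesis by (simp only: right_diff_distrib) simp
qed

text \<open>Passing u^m across z_0 is a binomial expansion: the i-fold commutator contributes i!
  z_i, which cancels the denominator of the binomial coefficient and leaves the integer
  \<open>falling m i\<close>. The proof shows that one factor u advances the right-hand side from m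
  to m + 1.\<close>

lemma divided_seq_tpow_0:
  assumes z: "divided_seq e z"
  shows "fps_const (z 0) * tpow e m
       = fps_series (\<lambda>i. of_int (falling m i) * tpow e (m - int i) * fps_const (z i))" (is "_ = ?Y m")
proof -
  have "?Y m * tunit e = ?Y (m + 1)" for m
  proof -
    let ?g = "\<lambda>m i. of_int (falling m i) * tpow e (m - int i) * fps_const (z i)"
    let ?k = "\<lambda>i. of_int (falling m i) * tpow e (m - int i) * fps_const (of_nat (Suc i) * z (Suc i))"
    have g: "of_int (falling m i) * tpow e (m - int i) * (tunit e * fps_const (z i))
        = of_int (falling m i) * tpow e (m + 1 - int i) * fps_const (z i)" for i
    proof -
      have "m + 1 - int i = m - int i + 1" by simp
      then have "tpow e (m - int i) * tunit e = tpow e (m + 1 - int i)"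
        using unit_powi_Suc(2)[OF is_unit_tunit, of e "m - int i"] by (simp only:)
      from this[symmetric] show ?thesis by (simp only: mult.assoc)
    qed
    have "?Y m * tunit e = fps_series (\<lambda>i. of_int (falling m i) * tpow e (m - int i) * (tunit e * fps_const (z i))
         + fps_X * ?k i)"
      unfolding fps_series_mult_right
      by (rule fps_series_cong)
        (simp only: mult.assoc divided_seq_tunit[OF z] distrib_left, simp only: mult.assoc[symmetric] fps_X_commute)
    also have "\<dots> = fps_series (\<lambda>i. of_int (falling m i) * tpow e (m + 1 - int i) * fps_const (z i))
         + fps_X * fps_series ?k"
      unfolding fps_series_add g fps_series_mult_left ..
    also have "\<dots> = tpow e (m + 1) * fps_const (z 0) + fps_X * fps_series (\<lambda>i.
         of_int (falling m (Suc i)) * tpow e (m + 1 - int (Suc i)) * fps_const (z (Suc i)) + ?k i)"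
      by (subst fps_series_Suc) (simp add: fps_series_add distrib_left add.assoc)
    \<comment> \<open>Two contributions meet at z_(i+1): the old term and the commutator of z_i with
      u. Their coefficients add up by \<open>falling_add_one\<close>.\<close>
    also have "(\<lambda>i. of_int (falling m (Suc i)) * tpow e (m + 1 - int (Suc i)) * fps_const (z (Suc i)) + ?k i)
       = (\<lambda>i. ?g (m + 1) (Suc i))"
    proof
      fix i
      have "?k i = of_int (of_nat (Suc i) * falling m i) * tpow e (m - int i) * fps_const (z (Suc i))"
      proof -
        have "fps_const (of_nat (Suc i) * z (Suc i)) = of_nat (Suc i) * fps_const (z (Suc i))"
          by (simp add: hom_mult[OF hom_fps_const, symmetric] flip: fps_of_nat)
        moreover have "a * b * (of_nat (Suc i) * c) = of_nat (Suc i) * a * b * c" for a b c :: "'a fps"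
          by (simp only: mult.assoc mult_of_nat_commute[of "Suc i"])
        ultimately show ?thesis by simp
      qed
      then show "of_int (falling m (Suc i)) * tpow e (m + 1 - int (Suc i)) * fps_const (z (Suc i)) + ?k i
          = ?g (m + 1) (Suc i)"
        unfolding falling_add_one by (simp add: distrib_right)
    qed
    also have "tpow e (m + 1) * fps_const (z 0) + fps_X * fps_series (\<lambda>i. ?g (m + 1) (Suc i)) = ?Y (m + 1)"
      by (subst (2) fps_series_Suc) simp
    finally show ?thesis .
  qed
  \<comment> \<open>At exponent 0 every falling factorial except the first vanishes, so the series
    starts from z_0 alone.\<close>
  from unit_powi_intertwine[OF is_unit_tunit, of ?Y e 0 m, OF this]
  show ?thesis
    by (subst (asm) (2) fps_series_single) (simp_all add: falling_zero unit_powi_0 del: falling.simps(2))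
qed

lemma divided_seq_tpow:
  assumes z: "divided_seq e z"
  shows "fps_const (z l) * tpow e m = fps_series (\<lambda>i. of_nat (l + i choose i) * of_int (falling m i)
           * tpow e (m - int i) * fps_const (z (l + i)))"
proof -
  have "fps_const (z l) * tpow e m
      = fps_series (\<lambda>i. of_int (falling m i) * tpow e (m - int i) * fps_const (seq_shift l z i))"
    using divided_seq_tpow_0[OF divided_seq_shift[OF z, of l], of m] by (simp add: seq_shift_def)
  also have "\<dots> = fps_series (\<lambda>i. of_nat (l + i choose i) * of_int (falling m i)
           * tpow e (m - int i) * fps_const (z (l + i)))"
  proof (rule fps_series_cong)
    fix i
    have "fps_const (seq_shift l z i) = of_nat (l + i choose i) * fps_const (z (l + i))"
      unfolding seq_shift_def by (simp add: hom_mult[OF hom_fps_const, symmetric] flip: fps_of_nat)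
    then show "of_int (falling m i) * tpow e (m - int i) * fps_const (seq_shift l z i)
        = of_nat (l + i choose i) * of_int (falling m i) * tpow e (m - int i) * fps_const (z (l + i))"
      by (simp only: mult.assoc of_nat_mult_left)
  qed
  finally show ?thesis .
qed

text \<open>Integral form of the conjugate of \<open>z\<^sub>0\<close> by \<open>(1 - et)\<^sup>H\<close>.\<close>

definition conj_series :: "'a::ring_1 \<Rightarrow> 'a fps \<Rightarrow> (nat \<Rightarrow> 'a) \<Rightarrow> 'a fps" where
  "conj_series e H z = fps_series (\<lambda>l. falling (- H) l * tpow e (- int l) * fps_const (z l))"

text \<open>Moving u^m through the series produces falling factorials of m. By Vandermonde they
  merge with those of -H, so the net effect is to replace -H by m - H.\<close>

lemma conj_series_tpow:
  assumes z: "divided_seq e z" and H: "H * tunit e = tunit e * H"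
  shows "conj_series e H z * tpow e m
       = fps_series (\<lambda>n. falling (of_int m - H) n * tpow e (m - int n) * fps_const (z n))"
proof -
  let ?c = "\<lambda>l i. falling (- H) l * tpow e (- int l) * (of_nat (l + i choose i) * of_int (falling m i)
           * tpow e (m - int i) * fps_const (z (l + i)))"
  have "conj_series e H z * tpow e m = fps_series (\<lambda>l. fps_series (?c l))"
    unfolding conj_series_def fps_series_mult_right
    by (simp only: mult.assoc divided_seq_tpow[OF z] fps_series_mult_left)
  also have "\<dots> = fps_series (\<lambda>n. \<Sum>l\<le>n. ?c l (n - l))"
    by (rule fps_series_nested)
  also have "\<dots> = fps_series (\<lambda>n. falling (of_int m - H) n * tpow e (m - int n) * fps_const (z n))"
  proof (rule fps_series_cong)
    fix n
    have c: "?c l (n - l) = of_nat (n choose l) * (falling (- H) l * falling (of_int m) (n - l)) * tpow e (m - int n) * fps_const (z n)"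
      if "l \<le> n" for l
    proof -
      have "tpow e (- int l) * tpow e (m - int (n - l)) = tpow e (m - int n)"
        using that by (simp flip: tpow_add add: of_nat_diff)
      moreover have "a * b * (of_nat k * of_int j * c * d) = of_nat k * (a * of_int j) * (b * c) * d"
        for a b c d :: "'a fps" and k j
        by (simp only: mult.assoc of_nat_mult_left mult_swap_assoc[of b "of_int j" "of_int j" b, OF mult_of_int_commute[symmetric]])
      ultimately show ?thesis
        using that by (simp only: le_add_diff_inverse binomial_symmetric[OF that, symmetric] of_int_falling[symmetric])
    qed
    have "(\<Sum>l\<le>n. ?c l (n - l)) = (\<Sum>l\<le>n. of_nat (n choose l) * (falling (- H) l * falling (of_int m) (n - l)))
         * tpow e (m - int n) * fps_const (z n)"
      unfolding sum_distrib_right by (rule sum.cong[OF refl], rule c) simp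
    also have "\<dots> = falling (of_int m - H) n * tpow e (m - int n) * fps_const (z n)"
      by (subst falling_vandermonde[symmetric]) (simp_all add: mult_of_int_commute)
    finally show "(\<Sum>l\<le>n. ?c l (n - l)) = falling (of_int m - H) n * tpow e (m - int n) * fps_const (z n)" .
  qed
  finally show ?thesis .
qed

lemma conj_series_commute:
  assumes H: "a * H = H * a" and e: "a * tunit e = tunit e * a" and z: "\<And>l. a * fps_const (z l) = fps_const (z l) * a"
  shows "a * conj_series e H z = conj_series e H z * a"
  unfolding conj_series_def
proof (rule fps_const_commute_series)
  fix l
  have "a * falling (- H) l = falling (- H) l * a" by (rule falling_commute) (simp add: H)
  with tpow_commute[OF e, of "- int l"] z[of l]
  show "a * (falling (- H) l * tpow e (- int l) * fps_const (z l)) = falling (- H) l * tpow e (- int l) * fps_const (z l) * a"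
    by (simp only: mult.assoc mult_swap_assoc[of a "falling (- H) l" "falling (- H) l" a]
        mult_swap_assoc[of a "tpow e (- int l)" "tpow e (- int l)" a])
qed

text \<open>The factor u^(-m) of a term of the second series shifts -H to -H - m in the first one,
  and these falling factorials continue those of that term. What remains in each degree is the
  Leibniz sum.\<close>

lemma conj_series_mult:
  assumes z: "divided_seq e z" and H: "H * tunit e = tunit e * H"
    and Hz: "\<And>l. H * fps_const (z l) = fps_const (z l) * H"
  shows "conj_series e H z * conj_series e H z' = conj_series e H (seq_mult z z')"
proof -
  let ?c = "\<lambda>m n. falling (- H) (m + n) * tpow e (- int (m + n)) * (fps_const (z n) * fps_const (z' m))"
  have "conj_series e H z * conj_series e H z'
      = fps_series (\<lambda>m. conj_series e H z * (falling (- H) m * tpow e (- int m) * fps_const (z' m)))"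
    by (simp add: conj_series_def[of e H z'] fps_series_mult_left)
  also have "\<dots> = fps_series (\<lambda>m. fps_series (?c m))"
  proof (rule fps_series_cong)
    fix m
    have "conj_series e H z * falling (- H) m = falling (- H) m * conj_series e H z"
      by (rule falling_commute) (simp add: conj_series_commute[OF _ H Hz])
    then have "conj_series e H z * (falling (- H) m * tpow e (- int m) * fps_const (z' m))
        = falling (- H) m * (conj_series e H z * tpow e (- int m)) * fps_const (z' m)"
      by (simp only: mult.assoc[symmetric])
    also have "\<dots> = fps_series (\<lambda>n. falling (- H) m * (falling (of_int (- int m) - H) n
        * tpow e (- int m - int n) * fps_const (z n)) * fps_const (z' m))"
      by (simp only: conj_series_tpow[OF z H] fps_series_mult_left fps_series_mult_right)
    also have "\<dots> = fps_series (?c m)"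
    proof (rule fps_series_cong)
      fix n
      have "of_int (- int m) - H = - H - of_nat m" by (simp add: algebra_simps)
      then have "falling (- H) m * falling (of_int (- int m) - H) n = falling (- H) (m + n)"
        by (simp only: falling_add)
      moreover have "- int m - int n = - int (m + n)" by simp
      ultimately show "falling (- H) m * (falling (of_int (- int m) - H) n * tpow e (- int m - int n) * fps_const (z n))
          * fps_const (z' m) = ?c m n"
        by (simp only: mult.assoc[symmetric])
    qed
    finally show "conj_series e H z * (falling (- H) m * tpow e (- int m) * fps_const (z' m)) = fps_series (?c m)" .
  qed
  also have "\<dots> = fps_series (\<lambda>n. \<Sum>m\<le>n. ?c m (n - m))"
    by (rule fps_series_nested)
  also have "\<dots> = conj_series e H (seq_mult z z')"
    unfolding conj_series_def
  proof (rule fps_series_cong)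
    fix n
    have "(\<Sum>m\<le>n. ?c m (n - m)) = falling (- H) n * tpow e (- int n) * fps_const (\<Sum>m\<le>n. z (n - m) * z' m)"
      by (simp add: hom_sum[OF hom_fps_const] sum_distrib_left)
    also have "(\<Sum>m\<le>n. z (n - m) * z' m) = seq_mult z z' n"
      unfolding seq_mult_def by (rule sum_rev[symmetric])
    finally show "(\<Sum>m\<le>n. ?c m (n - m)) = falling (- H) n * tpow e (- int n) * fps_const (seq_mult z z' n)" .
  qed
  finally show ?thesis .
qed

lemma conj_series_diff: "conj_series e H (\<lambda>l. z l - z' l) = conj_series e H z - conj_series e H z'"
  unfolding conj_series_def by (simp add: right_diff_distrib fps_series_diff flip: fps_const_sub)

lemma conj_series_add: "conj_series e H (\<lambda>l. z l + z' l) = conj_series e H z + conj_series e H z'"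
  unfolding conj_series_def by (simp add: distrib_left fps_series_add flip: fps_const_add)

lemma map_fps_conj_series:
  assumes f: "hom_ring f"
  shows "map_fps f (conj_series e H z) = conj_series (f e) (map_fps f H) (\<lambda>l. f (z l))"
  unfolding conj_series_def
  by (simp add: map_fps_series hom_add[OF f] hom_mult[OF hom_map_fps[OF f]] hom_falling[OF hom_map_fps[OF f]]
      hom_minus[OF hom_map_fps[OF f]] map_fps_tpow[OF f] map_fps_const hom_zero[OF f])

text \<open>The weight of x shifts -H to m - H when x passes from the left, and u^m causes the same
  shift when it passes from the right. Behind this is the fact that x \<otimes> 1 and 1 \<otimes> y
  commute before conjugation.\<close>

lemma conj_series_commute_weight:
  assumes z: "divided_seq e z" and H: "H * tunit e = tunit e * H"
    and x: "x * H = (H - of_int m) * x" and xe: "x * tunit e = tunit e * x"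
    and xz: "\<And>l. x * fps_const (z l) = fps_const (z l) * x"
  shows "(x * tpow e m) * conj_series e H z = conj_series e H z * (x * tpow e m)"
proof -
  have f: "x * falling (- H) n = falling (of_int m - H) n * x" for n
    by (rule falling_intertwine) (use x in \<open>simp add: algebra_simps\<close>)
  have He: "tpow e m * falling (- H) n = falling (- H) n * tpow e m" for n
    by (rule falling_commute) (simp add: tpow_commute[OF H])
  have "(x * tpow e m) * conj_series e H z
      = fps_series (\<lambda>n. falling (of_int m - H) n * tpow e (m - int n) * fps_const (z n)) * x"
    unfolding conj_series_def fps_series_mult_left fps_series_mult_right
  proof (rule fps_series_cong)
    fix n
    have "x * tpow e m * (falling (- H) n * tpow e (- int n) * fps_const (z n))
        = x * falling (- H) n * (tpow e m * tpow e (- int n)) * fps_const (z n)"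
      by (simp only: mult.assoc mult_swap_assoc[OF He])
    also have "\<dots> = falling (of_int m - H) n * (x * tpow e (m - int n)) * fps_const (z n)"
      by (simp add: f mult.assoc flip: tpow_add)
    also have "\<dots> = falling (of_int m - H) n * tpow e (m - int n) * fps_const (z n) * x"
      by (simp only: tpow_commute[OF xe] mult.assoc xz)
    finally show "x * tpow e m * (falling (- H) n * tpow e (- int n) * fps_const (z n))
        = falling (of_int m - H) n * tpow e (m - int n) * fps_const (z n) * x" .
  qed
  also have "\<dots> = conj_series e H z * (tpow e m * x)"
    by (simp add: conj_series_tpow[OF z H] flip: mult.assoc)
  finally show ?thesis by (simp only: tpow_commute[OF xe])
qed

section \<open>The series behind the antipode\<close>

text \<open>
  For \<open>x\<close> of weight \<open>m\<close> and \<open>z\<^sub>l = (ad e)\<^sup>l x / l!\<close> this is \<open>(1 - et)\<^sup>s w x w' (1 - et)\<^bsup>m - s\<^esup>\<close>,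
  where \<open>w = \<Sum> h\<^bsup>[r]\<^esup> (et)\<^sup>r / r!\<close> and \<open>w'\<close> is its inverse.
\<close>

definition weight_series :: "'a::ring_1 fps \<Rightarrow> int \<Rightarrow> (nat \<Rightarrow> 'a) \<Rightarrow> 'a fps" where
  "weight_series h s z = fps_series (\<lambda>n. falling (h - of_int s) n * fps_const (z n))"

text \<open>The relation [h, e] = e with et eliminated as 1 - u. In this form h may be any power
  series, integer shifts of h are allowed, and the relation transfers along ring
  homomorphisms.\<close>

definition borel_rel :: "'a::ring_1 \<Rightarrow> 'a fps \<Rightarrow> bool" where
  "borel_rel e h \<longleftrightarrow> tunit e * h = (h - 1) * tunit e + 1"

lemma borel_rel_const:
  assumes "h * e - e * h = e"
  shows "borel_rel e (fps_const h)"
  unfolding borel_rel_def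
proof (rule fps_ext)
  fix n
  have "e * h = h * e - e" using assms by (simp add: algebra_simps)
  then show "fps_nth (tunit e * fps_const h) n = fps_nth ((fps_const h - 1) * tunit e + 1) n"
    by (cases n; cases "n - 1") (simp_all add: tunit_mult_nth mult_tunit_nth tunit_nth algebra_simps)
qed

lemma borel_rel_diff: "borel_rel e h \<Longrightarrow> borel_rel e (h - of_int s)"
  unfolding borel_rel_def by (simp add: right_diff_distrib left_diff_distrib mult_of_int_commute)

text \<open>Passing u lowers h by one up to a term of lower order. That term has the same shape as
  the one produced when u passes a divided power.\<close>

lemma borel_rel_falling:
  assumes "borel_rel e h"
  shows "tunit e * falling h (Suc n) = falling (h - 1) (Suc n) * tunit e + of_nat (Suc n) * falling (h - 1) n"
proof (induction n)
  case 0
  then show ?case using assms by (simp add: borel_rel_def)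
next
  case (Suc n)
  have "tunit e * (h - of_nat (Suc n)) = (h - 1 - of_nat (Suc n)) * tunit e + 1"
    using borel_rel_diff[OF assms, of "int (Suc n)"] by (simp add: borel_rel_def algebra_simps)
  then have 1: "falling (h - 1) (Suc n) * tunit e * (h - of_nat (Suc n))
      = falling (h - 1) (Suc (Suc n)) * tunit e + falling (h - 1) (Suc n)"
    by (simp only: mult.assoc distrib_left falling.simps mult_1_right)
  have 2: "falling (h - 1) n * (h - of_nat (Suc n)) = falling (h - 1) (Suc n)"
    by (simp add: algebra_simps)
  have "tunit e * falling h (Suc (Suc n))
      = (falling (h - 1) (Suc n) * tunit e + of_nat (Suc n) * falling (h - 1) n) * (h - of_nat (Suc n))"
    by (subst falling.simps) (simp only: mult.assoc[symmetric] Suc)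
  also have "\<dots> = falling (h - 1) (Suc (Suc n)) * tunit e + falling (h - 1) (Suc n) + of_nat (Suc n) * falling (h - 1) (Suc n)"
    by (simp only: distrib_right 1 mult.assoc[of "of_nat _"] 2)
  also have "\<dots> = falling (h - 1) (Suc (Suc n)) * tunit e + of_nat (Suc (Suc n)) * falling (h - 1) (Suc n)"
    by (simp only: of_nat_Suc[of "Suc n"] distrib_right mult_1_left add.assoc)
  finally show ?case .
qed

text \<open>The lower-order terms from moving u past the falling factorials and past the z_n
  coincide after an index shift. Only the shift of s is left.\<close>

lemma weight_series_tunit:
  assumes z: "divided_seq e z" and h: "borel_rel e h"
  shows "tunit e * weight_series h s z = weight_series h (s + 1) z * tunit e"
proof -
  let ?h = "h - of_int (s + 1)"
  have h1: "h - of_int s - 1 = ?h" by simp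
  note f = borel_rel_falling[OF borel_rel_diff[OF h, of s], unfolded h1]
  have c: "fps_const (of_nat (Suc n) * z (Suc n)) = of_nat (Suc n) * fps_const (z (Suc n))" for n
    by (simp add: hom_mult[OF hom_fps_const, symmetric] flip: fps_of_nat)
  have "weight_series h (s + 1) z * tunit e
      = fps_series (\<lambda>n. falling ?h n * tunit e * fps_const (z n)
          + fps_X * (falling ?h n * fps_const (of_nat (Suc n) * z (Suc n))))"
    unfolding weight_series_def fps_series_mult_right
    by (rule fps_series_cong)
      (simp only: mult.assoc divided_seq_tunit[OF z] distrib_left mult_swap_assoc[OF fps_X_commute])
  also have "\<dots> = tunit e * fps_const (z 0) + fps_X * fps_series (\<lambda>n.
       falling ?h (Suc n) * tunit e * fps_const (z (Suc n)) + falling ?h n * fps_const (of_nat (Suc n) * z (Suc n)))"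
    unfolding fps_series_add fps_series_mult_left[symmetric]
    by (subst fps_series_Suc) (simp add: distrib_left add.assoc)
  also have "\<dots> = tunit e * fps_const (z 0) + fps_X * fps_series (\<lambda>n.
       tunit e * (falling (h - of_int s) (Suc n) * fps_const (z (Suc n))))"
    by (simp only: mult.assoc[symmetric] f distrib_right c mult_of_nat_commute[of "Suc _" "falling ?h _", symmetric])
  also have "\<dots> = tunit e * weight_series h s z"
    unfolding weight_series_def by (subst (2) fps_series_Suc) (simp add: distrib_left fps_series_mult_left
      mult.assoc mult_swap_assoc[OF fps_X_commute] del: falling.simps(2))
  finally show ?thesis ..
qed

lemma weight_series_tpow:
  assumes z: "divided_seq e z" and h: "borel_rel e h"
  shows "tpow e j * weight_series h s z = weight_series h (s + j) z * tpow e j"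
  using unit_powi_intertwine_left[OF is_unit_tunit, of e "\<lambda>m. weight_series h (s + m) z * tpow e m" j 0]
  by (simp add: unit_powi_0 weight_series_tunit[OF z h] unit_powi_Suc(1)[OF is_unit_tunit] add.assoc flip: mult.assoc)

text \<open>As z_l has weight m + l, moving it across falling factorials of h - s lowers their
  argument by m + l. They then continue the l factors starting at h - s - m.\<close>

lemma weight_series_mult:
  assumes zh: "\<And>l. fps_const (z l) * h = (h - of_int (m + int l)) * fps_const (z l)"
  shows "weight_series h (s + m) z * weight_series h s z' = weight_series h (s + m) (seq_mult z z')"
proof -
  let ?c = "\<lambda>l j. falling (h - of_int (s + m)) (l + j) * (fps_const (z l) * fps_const (z' j))"
  have "weight_series h (s + m) z * weight_series h s z' = fps_series (\<lambda>l. fps_series (?c l))"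
    unfolding weight_series_def fps_series_mult_right
    unfolding fps_series_mult_left
  proof (intro fps_series_cong)
    fix l j
    have "fps_const (z l) * falling (h - of_int s) j = falling (h - of_int (s + m) - of_nat l) j * fps_const (z l)"
      by (rule falling_intertwine) (simp add: right_diff_distrib left_diff_distrib zh mult_of_int_commute algebra_simps)
    note s = this
    show "falling (h - of_int (s + m)) l * fps_const (z l) * (falling (h - of_int s) j * fps_const (z' j)) = ?c l j"
      by (simp only: mult.assoc mult_swap_assoc[OF s] falling_add)
  qed
  also have "\<dots> = weight_series h (s + m) (seq_mult z z')"
    unfolding fps_series_nested weight_series_def seq_mult_def
    by (rule fps_series_cong) (simp add: hom_sum[OF hom_fps_const] sum_distrib_left)
  finally show ?thesis .
qed

lemma weight_series_diff: "weight_series h s (\<lambda>l. z l - z' l) = weight_series h s z - weight_series h s z'"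
  unfolding weight_series_def by (simp add: right_diff_distrib fps_series_diff flip: fps_const_sub)

text \<open>Vandermonde for -h + h = 0. This inversion makes the convolution of the identity with
  the antipode collapse.\<close>

lemma weight_series_conj_falling:
  "fps_series (\<lambda>l. falling (- h) l * weight_series h 0 (seq_shift l z)) = fps_const (z 0)"
proof -
  have "fps_series (\<lambda>l. falling (- h) l * weight_series h 0 (seq_shift l z))
      = fps_series (\<lambda>n. \<Sum>l\<le>n. falling (- h) l * (falling (h - of_int 0) (n - l) * fps_const (seq_shift l z (n - l))))"
    unfolding weight_series_def fps_series_mult_left by (rule fps_series_nested)
  also have "\<dots> = fps_series (\<lambda>n. falling (- h + h) n * fps_const (z n))"
  proof (rule fps_series_cong)
    fix n
    have "falling (- h) l * (falling (h - of_int 0) (n - l) * fps_const (seq_shift l z (n - l)))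
        = of_nat (n choose l) * (falling (- h) l * falling h (n - l)) * fps_const (z n)" if "l \<in> {..n}" for l
    proof -
      have "n choose (n - l) = n choose l" using that binomial_symmetric[of l n] by simp
      moreover have "fps_const (of_nat k * z n) = of_nat k * fps_const (z n)" for k
        by (simp add: hom_mult[OF hom_fps_const, symmetric] flip: fps_of_nat)
      ultimately show ?thesis
        using that by (simp add: seq_shift_def mult.assoc of_nat_mult_left)
    qed
    then have "(\<Sum>l\<le>n. falling (- h) l * (falling (h - of_int 0) (n - l) * fps_const (seq_shift l z (n - l))))
        = (\<Sum>l\<le>n. of_nat (n choose l) * (falling (- h) l * falling h (n - l)) * fps_const (z n))"
      by (rule sum.cong[OF refl])
    then show "(\<Sum>l\<le>n. falling (- h) l * (falling (h - of_int 0) (n - l) * fps_const (seq_shift l z (n - l))))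
        = falling (- h + h) n * fps_const (z n)"
      by (subst falling_vandermonde) (simp_all add: sum_distrib_right)
  qed
  also have "\<dots> = fps_const (z 0)"
    by (subst fps_series_single) (simp_all add: falling_zero del: falling.simps(2))
  finally show ?thesis .
qed

text \<open>Commutation with h is a derivation taking u to u - 1, so it takes u^j to j u^(j-1) (u -
  1). The induction covers negative j by cancelling u.\<close>

lemma borel_rel_tpow:
  assumes h: "borel_rel e h"
  shows "h * tpow e j = tpow e j * (h + of_int j) - of_int j * tpow e (j - 1)"
proof -
  let ?u = "tunit e"
  have hu: "h * ?u = ?u * (h + 1) - 1" using h by (simp add: borel_rel_def algebra_simps)
  have s: "tpow e (j + 1) = tpow e j * ?u" "tpow e j = tpow e (j - 1) * ?u" for j
    using unit_powi_Suc(2)[OF is_unit_tunit, of e j] unit_powi_Suc(2)[OF is_unit_tunit, of e "j - 1"] by simp_all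
  have step: "(tpow e j * (h + of_int j) - of_int j * tpow e (j - 1)) * ?u
      = tpow e (j + 1) * (h + of_int (j + 1)) - of_int (j + 1) * tpow e (j + 1 - 1)" for j
  proof -
    have "(tpow e j * (h + of_int j) - of_int j * tpow e (j - 1)) * ?u
        = tpow e j * (h * ?u) + tpow e j * ?u * of_int j - of_int j * (tpow e (j - 1) * ?u)"
      by (simp add: algebra_simps mult_of_int_commute[of j ?u])
    also have "\<dots> = tpow e j * ?u * (h + 1) - tpow e j + tpow e j * ?u * of_int j - of_int j * tpow e j"
      by (simp add: hu right_diff_distrib mult.assoc flip: s(2))
    finally show ?thesis by (simp add: s(1) distrib_left distrib_right)
  qed
  show ?thesis
  proof (induction j rule: int_shift_induct)
    case (up j)
    have "h * tpow e (j + 1) = h * tpow e j * ?u" by (simp add: s(1) mult.assoc)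
    then show ?case by (simp only: up step)
  next
    case (down j)
    have "h * tpow e j * ?u = (tpow e j * (h + of_int j) - of_int j * tpow e (j - 1)) * ?u"
      unfolding step using down by (simp add: s(1) mult.assoc)
    then show ?case by (rule unit_powi_cancel[OF is_unit_tunit])
  qed (simp add: unit_powi_0)
qed

text \<open>The element h u is the negative of the quantized antipode of h, so this evaluates that
  antipode on falling factorials. The induction step is u^n (h u - n) = (h - n) u^(n+1).\<close>

lemma falling_mult_tunit:
  assumes h: "borel_rel e h"
  shows "falling (h * tunit e) n = falling h n * tpow e (int n)"
proof (induction n)
  case (Suc n)
  have s: "tpow e (int (Suc n)) = tpow e (int n) * tunit e" "tpow e (int n) = tpow e (int n - 1) * tunit e"
    using unit_powi_Suc(2)[OF is_unit_tunit, of e "int n"] unit_powi_Suc(2)[OF is_unit_tunit, of e "int n - 1"]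
    by (simp_all add: add.commute)
  have "tpow e (int n) * h = h * tpow e (int n) - tpow e (int n) * of_nat n + of_nat n * tpow e (int n - 1)"
    using borel_rel_tpow[OF h, of "int n"] by (simp add: algebra_simps)
  then have "tpow e (int n) * (h * tunit e - of_nat n)
      = (h * tpow e (int n) - tpow e (int n) * of_nat n + of_nat n * tpow e (int n - 1)) * tunit e - tpow e (int n) * of_nat n"
    by (simp only: right_diff_distrib mult.assoc[symmetric])
  also have "\<dots> = (h - of_nat n) * tpow e (int (Suc n))"
  proof -
    have "of_nat n * tpow e (int n - 1) * tunit e = of_nat n * tpow e (int n)"
      by (simp only: mult.assoc s(2)[symmetric])
    then show ?thesis
      by (simp add: s(1)[symmetric] left_diff_distrib distrib_right mult_of_nat_commute[of n "tpow e (int n)", symmetric] mult.assoc del: of_nat_Suc)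
  qed
  finally show ?case by (simp only: falling.simps Suc mult.assoc)
qed (simp add: unit_powi_0)

text \<open>With h' in the first and h in the second tensor factor, h' u^(-1) + h is the coproduct
  of h: a Vandermonde identity for two summands that do not commute. Moving h past u^(-l) costs a
  term l u^(-l-1), which is exactly what turns -h' into the next factor -h' - l.\<close>

lemma falling_coproduct:
  fixes h' :: "'a::ring_1 fps"
  assumes h: "borel_rel e h" and h'h: "h' * h = h * h'" and h'e: "h' * tunit e = tunit e * h'"
  shows "falling (- (h' * tpow e (- 1) + h)) n
       = (\<Sum>l\<le>n. of_nat (n choose l) * (falling (- h') l * tpow e (- int l) * falling (- h) (n - l)))"
proof (rule Pascal_sum[where \<Phi> = "\<lambda>n z. (- (h' * tpow e (- 1) + h) - of_nat n) * z"])
  let ?x = "- (h' * tpow e (- 1) + h)"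
  let ?T = "\<lambda>l k. falling (- h') l * tpow e (- int l) * falling (- h) k"
  show "falling ?x (Suc n) = (?x - of_nat n) * falling ?x n" for n
    by (rule falling_Suc_right)
  show "(?x - of_nat (l + k)) * ?T l k = ?T (Suc l) k + ?T l (Suc k)" for l k
  proof -
    have c1: "tpow e (- 1) * falling (- h') l = falling (- h') l * tpow e (- 1)"
      by (rule falling_commute) (simp add: tpow_commute[OF h'e])
    have c2: "h * falling (- h') l = falling (- h') l * h"
      by (rule falling_commute) (simp add: h'h)
    have c3: "h' * falling (- h') l = falling (- h') l * h'"
      by (rule falling_commute) simp
    have t: "tpow e (- 1) * tpow e (- int l) = tpow e (- int (Suc l))"
      by (simp flip: tpow_add)
    have 1: "h' * tpow e (- 1) * ?T l k = falling (- h') l * h' * tpow e (- int (Suc l)) * falling (- h) k"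
      by (simp only: mult.assoc mult_swap_assoc[OF c1] mult_swap_assoc[OF c3] t[symmetric])
    have bt: "h * tpow e (- int l) = tpow e (- int l) * (h - of_nat l) + of_nat l * tpow e (- int (Suc l))"
    proof -
      have "- int l - 1 = - int (Suc l)" by simp
      with borel_rel_tpow[OF h, of "- int l"] show ?thesis by (simp del: of_nat_Suc)
    qed
    have 2: "h * ?T l k = falling (- h') l * (tpow e (- int l) * (h - of_nat l) + of_nat l * tpow e (- int (Suc l))) * falling (- h) k"
      by (simp only: bt[symmetric] mult.assoc mult_swap_assoc[OF c2])
    have 3: "of_nat (l + k) * ?T l k = of_nat l * ?T l k + of_nat k * ?T l k"
      by (simp only: of_nat_add distrib_right)
    have 4: "(- h - of_nat k) * falling (- h) k = falling (- h) (Suc k)"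
      by (rule falling_Suc_right[symmetric])
    have 5: "falling (- h') (Suc l) = falling (- h') l * (- h' - of_nat l)" by simp
    have "(?x - of_nat (l + k)) * ?T l k
        = - (h' * tpow e (- 1) * ?T l k) - h * ?T l k - of_nat (l + k) * ?T l k"
      by (simp add: distrib_right left_diff_distrib)
    also have "\<dots> = falling (- h') l * (- h' - of_nat l) * tpow e (- int (Suc l)) * falling (- h) k
        + falling (- h') l * tpow e (- int l) * ((- h - of_nat k) * falling (- h) k)"
      unfolding 1 2 3
      by (simp only: left_diff_distrib right_diff_distrib distrib_left distrib_right mult.assoc of_nat_mult_left
          mult_minus_left mult_minus_right mult_of_nat_commute) (simp add: algebra_simps)
    finally show ?thesis unfolding 4 5[symmetric] by simp
  qed
qed (simp_all add: unit_powi_0 distrib_left)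

section \<open>The twist over the rationals\<close>

text \<open>Left multiplication by e is ad e plus right multiplication by e, and these two operators
  commute. The factor i! converts the i-th power of ad e into the divided power.\<close>

lemma divided_seq_power:
  assumes z: "divided_seq e z"
  shows "e ^ n * z 0 = (\<Sum>i\<le>n. of_nat (n choose i) * (of_nat (fact i) * (z i * e ^ (n - i))))"
    and "z 0 * (- e) ^ n = (\<Sum>i\<le>n. of_nat (n choose i) * (of_nat (fact i) * ((- e) ^ (n - i) * z i)))"
proof -
  have f: "of_nat (fact i) * (of_nat (Suc i) * a) = of_nat (fact (Suc i)) * (a :: 'a)" for i a
  proof -
    have "fact (Suc i) = fact i * Suc i" by simp
    then show ?thesis by (simp only: of_nat_mult mult.assoc)
  qed
  show "e ^ n * z 0 = (\<Sum>i\<le>n. of_nat (n choose i) * (of_nat (fact i) * (z i * e ^ (n - i))))"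
  proof (rule Pascal_sum[where \<Phi> = "\<lambda>_ x. e * x"])
    fix i k
    have s: "e * z i = z i * e + of_nat (Suc i) * z (Suc i)"
      using z by (simp add: divided_seq_def algebra_simps)
    have "e * (of_nat (fact i) * (z i * e ^ k)) = of_nat (fact i) * (e * z i * e ^ k)"
      by (simp only: of_nat_mult_left mult.assoc)
    also have "\<dots> = of_nat (fact i) * (z i * e ^ Suc k) + of_nat (fact i) * (of_nat (Suc i) * (z (Suc i) * e ^ k))"
      by (simp only: s distrib_right distrib_left mult.assoc power_Suc)
    finally show "e * (of_nat (fact i) * (z i * e ^ k))
        = of_nat (fact (Suc i)) * (z (Suc i) * e ^ k) + of_nat (fact i) * (z i * e ^ Suc k)"
      by (simp only: f add.commute)
  qed (simp_all add: distrib_left mult.assoc)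
  show "z 0 * (- e) ^ n = (\<Sum>i\<le>n. of_nat (n choose i) * (of_nat (fact i) * ((- e) ^ (n - i) * z i)))"
  proof (rule Pascal_sum[where \<Phi> = "\<lambda>_ x. x * (- e)"])
    fix i k
    have s: "z i * (- e) = (- e) * z i + of_nat (Suc i) * z (Suc i)"
      using z by (simp add: divided_seq_def algebra_simps)
    have "of_nat (fact i) * ((- e) ^ k * z i) * (- e)
        = of_nat (fact i) * ((- e) ^ Suc k * z i) + of_nat (fact i) * ((- e) ^ k * (of_nat (Suc i) * z (Suc i)))"
      by (simp only: mult.assoc s distrib_left power_Suc2)
    then show "of_nat (fact i) * ((- e) ^ k * z i) * (- e)
        = of_nat (fact (Suc i)) * ((- e) ^ k * z (Suc i)) + of_nat (fact i) * ((- e) ^ Suc k * z i)"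
      by (simp only: of_nat_mult_left[of "(- e) ^ k"] f add.commute)
  qed (simp_all only: distrib_right power_Suc2 mult.assoc, simp_all)
qed

lemma commuting_binomial:
  fixes a b :: "'a::ring_1"
  assumes "a * b = b * a"
  shows "(a + b) ^ n = (\<Sum>i\<le>n. of_nat (n choose i) * (a ^ i * b ^ (n - i)))"
proof (rule Pascal_sum[where \<Phi> = "\<lambda>_ x. (a + b) * x"])
  show "(a + b) * (a ^ i * b ^ k) = a ^ Suc i * b ^ k + a ^ i * b ^ Suc k" for i k
    using power_commuting_commutes[OF assms, of i, symmetric]
    by (simp add: distrib_right mult_swap_assoc[of b "a ^ i" "a ^ i" b] mult.assoc)
qed (simp_all add: distrib_left)

text \<open>Rational scalars enter as a central homomorphism \<open>q\<close>, so that one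
  computation serves U(L), its tensor square and its tensor cube after extension to the
  rationals.\<close>

locale rat_scalars =
  fixes q :: "rat \<Rightarrow> 'a::ring_1"
  assumes hom_q: "hom_ring q" and q_central: "q c * x = x * q c"
begin

text \<open>The binomial series of the formal power (1 - et)^(H + s). The integer s records how many
  factors u have been absorbed.\<close>

definition twist_series :: "'a \<Rightarrow> 'a \<Rightarrow> int \<Rightarrow> 'a fps" where
  "twist_series H e s = Abs_fps (\<lambda>r. q (1 / fact r) * (falling (H + of_int s) r * (- e) ^ r))"

text \<open>At s = 0 this is the element w. Its shifts by s absorb powers of u, although h and e do
  not commute.\<close>

definition antipode_series :: "'a \<Rightarrow> 'a \<Rightarrow> int \<Rightarrow> 'a fps" where
  "antipode_series h e s = Abs_fps (\<lambda>r. q (1 / fact r) * (falling (h + of_int s) r * e ^ r))"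

lemma q_left: "a * (q c * b) = q c * (a * b)"
  by (rule mult_swap_assoc) (simp add: q_central)

lemma q_fact_Suc: "q (1 / fact (Suc n)) * of_nat (Suc n) = q (1 / fact n)"
proof -
  have "q (1 / fact (Suc n)) * of_nat (Suc n) = q (1 / fact (Suc n) * of_nat (Suc n))"
    by (simp only: hom_mult[OF hom_q] hom_of_nat[OF hom_q])
  also have "1 / fact (Suc n) * of_nat (Suc n) = (1 / fact n :: rat)"
    by (simp add: field_simps del: of_nat_Suc)
  finally show ?thesis .
qed

lemma q_binomial:
  assumes "i \<le> n"
  shows "q (1 / fact n) * (of_nat (n choose i) * (of_nat (fact i) * a)) = q (1 / fact (n - i)) * a"
proof -
  have "q (1 / fact n) * (of_nat (n choose i) * (of_nat (fact i) * a)) = q (1 / fact n * (of_nat (n choose i) * of_nat (fact i))) * a"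
    by (simp only: hom_mult[OF hom_q] hom_of_nat[OF hom_q] mult.assoc)
  also have "1 / fact n * (of_nat (n choose i) * of_nat (fact i)) = (1 / fact (n - i) :: rat)"
    using assms by (simp add: binomial_fact field_simps)
  finally show ?thesis .
qed

lemma tunit_twist_series:
  assumes He: "H * e = e * H"
  shows "tunit e * twist_series H e s = twist_series H e (s + 1)"
proof (rule fps_ext)
  fix n
  show "fps_nth (tunit e * twist_series H e s) n = fps_nth (twist_series H e (s + 1)) n"
  proof (cases n)
    case (Suc k)
    let ?f = "falling (H + of_int s)"
    have c: "e * ?f k = ?f k * e"
      by (rule falling_commute) (simp add: distrib_left distrib_right He mult_of_int_commute)
    have "fps_nth (twist_series H e (s + 1)) n = q (1 / fact n) * (?f n * (- e) ^ n) + q (1 / fact n) * (of_nat n * (?f k * (- e) ^ n))"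
      using falling_add_one[of "H + of_int s" k]
      by (simp add: twist_series_def Suc distrib_left distrib_right add.assoc mult.assoc del: falling.simps of_nat_Suc fact_Suc power_Suc)
    also have "q (1 / fact n) * (of_nat n * (?f k * (- e) ^ n)) = q (1 / fact k) * (?f k * (- e) ^ n)"
      by (simp only: Suc q_fact_Suc mult.assoc[symmetric])
    also have "q (1 / fact k) * (?f k * (- e) ^ n) = - (e * (q (1 / fact k) * (?f k * (- e) ^ k)))"
      by (simp add: Suc q_left mult_swap_assoc[OF c])
    finally show ?thesis
      by (simp add: tunit_mult_nth Suc twist_series_def del: falling.simps fact_Suc power_Suc)
  qed (simp add: tunit_mult_nth tunit_nth twist_series_def)
qed

lemma tpow_twist_series:
  assumes "H * e = e * H"
  shows "tpow e j * twist_series H e s = twist_series H e (s + j)"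
  by (rule unit_powi_intertwine_left[where a = "twist_series H e", OF is_unit_tunit tunit_twist_series[OF assms]])

text \<open>The counterpart of \<open>divided_seq_tpow_0\<close> with the element H in place of the
  integer exponent m. Induction on the exponent has no meaning here, so coefficients are compared,
  using division by factorials.\<close>

lemma divided_seq_twist_series:
  assumes z: "divided_seq e z" and Hz: "\<And>l. z l * H = H * z l"
  shows "fps_const (z 0) * twist_series H e 0
       = fps_series (\<lambda>i. falling (fps_const H) i * twist_series H e (- int i) * fps_const (z i))"
proof (rule fps_ext)
  fix n
  have Hf: "z i * falling H n = falling H n * z i" for i
    by (rule falling_commute) (rule Hz)
  have "fps_nth (fps_const (z 0) * twist_series H e 0) n = z 0 * (q (1 / fact n) * (falling H n * (- e) ^ n))"
    by (simp add: twist_series_def)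
  also have "\<dots> = q (1 / fact n) * (falling H n * (z 0 * (- e) ^ n))"
    by (simp only: q_left mult_swap_assoc[OF Hf])
  also have "\<dots> = (\<Sum>i\<le>n. q (1 / fact (n - i)) * (falling H n * ((- e) ^ (n - i) * z i)))"
    unfolding divided_seq_power(2)[OF z] sum_distrib_left
    by (rule sum.cong[OF refl]) (simp only: of_nat_mult_left[of "falling H n"] q_binomial atMost_iff)
  also have "\<dots> = fps_nth (fps_series (\<lambda>i. falling (fps_const H) i * twist_series H e (- int i) * fps_const (z i))) n"
    unfolding fps_series_nth
  proof (rule sum.cong[OF refl])
    fix i assume "i \<in> {..n}"
    then have "falling H n = falling H i * falling (H + of_int (- int i)) (n - i)"
      using falling_add[of H i "n - i"] by simp
    then show "q (1 / fact (n - i)) * (falling H n * ((- e) ^ (n - i) * z i))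
        = fps_nth (falling (fps_const H) i * twist_series H e (- int i) * fps_const (z i)) (n - i)"
      by (simp add: twist_series_def q_left mult.assoc flip: fps_const_falling)
  qed
  finally show "fps_nth (fps_const (z 0) * twist_series H e 0) n
      = fps_nth (fps_series (\<lambda>i. falling (fps_const H) i * twist_series H e (- int i) * fps_const (z i))) n" .
qed

text \<open>Moving z_0 across the twist creates falling factorials of H. Those of -H in the
  conjugated series undo them, by Vandermonde for -H + H = 0.\<close>

lemma conj_series_twist:
  assumes z: "divided_seq e z" and Hz: "\<And>l. z l * H = H * z l" and He: "H * e = e * H"
  shows "conj_series e (fps_const H) z * twist_series H e 0 = twist_series H e 0 * fps_const (z 0)"
proof -
  let ?F = "twist_series H e 0" and ?H = "fps_const H"
  let ?c = "\<lambda>l i. falling (- ?H) l * (tpow e (- int l) * (falling ?H i * (tpow e (- int i) * (?F * fps_const (seq_shift l z i)))))"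
  have "conj_series e ?H z * ?F = fps_series (\<lambda>l. falling (- ?H) l * tpow e (- int l) * (fps_const (seq_shift l z 0) * ?F))"
    by (simp add: conj_series_def fps_series_mult_right mult.assoc seq_shift_def)
  also have "\<dots> = fps_series (\<lambda>l. fps_series (?c l))"
  proof (rule fps_series_cong)
    fix l
    have "seq_shift l z i * H = H * seq_shift l z i" for i
      by (simp add: seq_shift_def Hz mult.assoc of_nat_mult_left)
    from divided_seq_twist_series[OF divided_seq_shift[OF z] this]
    show "falling (- ?H) l * tpow e (- int l) * (fps_const (seq_shift l z 0) * ?F) = fps_series (?c l)"
      by (simp add: fps_series_mult_left mult.assoc tpow_twist_series[OF He, of "- int _" 0, simplified, symmetric])
  qed
  also have "\<dots> = fps_series (\<lambda>n. \<Sum>l\<le>n. ?c l (n - l))"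
    by (rule fps_series_nested)
  also have "\<dots> = fps_series (\<lambda>n. falling (- ?H + ?H) n * (tpow e (- int n) * (?F * fps_const (z n))))"
  proof (rule fps_series_cong)
    fix n
    have "?c l (n - l) = of_nat (n choose l) * (falling (- ?H) l * falling ?H (n - l)) * (tpow e (- int n) * (?F * fps_const (z n)))"
      if "l \<in> {..n}" for l
    proof -
      have H: "tpow e (- int l) * falling ?H (n - l) = falling ?H (n - l) * tpow e (- int l)"
        by (rule falling_commute) (rule tpow_commute_const[symmetric, OF He])
      have t: "tpow e (- int l) * (tpow e (- int (n - l)) * a) = tpow e (- int n) * a" for a
        using that by (simp add: of_nat_diff flip: mult.assoc tpow_add)
      have s: "fps_const (seq_shift l z (n - l)) = of_nat (n choose l) * fps_const (z n)"
        using that binomial_symmetric[of l n]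
        by (simp add: seq_shift_def hom_mult[OF hom_fps_const, symmetric] flip: fps_of_nat)
      show ?thesis
        by (simp only: mult_swap_assoc[OF H] t s of_nat_mult_left mult.assoc)
    qed
    then have "(\<Sum>l\<le>n. ?c l (n - l)) = (\<Sum>l\<le>n. of_nat (n choose l) * (falling (- ?H) l * falling ?H (n - l)) * (tpow e (- int n) * (?F * fps_const (z n))))"
      by (rule sum.cong[OF refl])
    then show "(\<Sum>l\<le>n. ?c l (n - l)) = falling (- ?H + ?H) n * (tpow e (- int n) * (?F * fps_const (z n)))"
      by (subst falling_vandermonde) (simp_all add: sum_distrib_right)
  qed
  also have "\<dots> = ?F * fps_const (z 0)"
    by (subst fps_series_single) (simp_all add: falling_zero unit_powi_0 del: falling.simps(2))
  finally show ?thesis .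
qed

text \<open>Passing x raises the exponent H to H + m, and the surplus is the factor u^m.\<close>

lemma twist_series_weight:
  assumes x: "H * x = x * (H + of_int m)" and xe: "e * x = x * e" and He: "H * e = e * H"
  shows "twist_series H e 0 * fps_const x = fps_const x * tpow e m * twist_series H e 0"
proof -
  have "twist_series H e 0 * fps_const x = fps_const x * twist_series H e m"
  proof (rule fps_ext)
    fix n
    have "x * falling (H + of_int m) n = falling H n * x"
      by (rule falling_intertwine) (simp add: x)
    note f = this[symmetric]
    have p: "(- e) ^ n * x = x * (- e) ^ n"
      by (rule power_commuting_commutes) (simp add: xe)
    show "fps_nth (twist_series H e 0 * fps_const x) n = fps_nth (fps_const x * twist_series H e m) n"
      by (simp add: twist_series_def q_left mult.assoc p mult_swap_assoc[OF f])
  qed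
  also have "twist_series H e m = tpow e m * twist_series H e 0"
    by (simp add: tpow_twist_series[OF He])
  finally show ?thesis by (simp add: mult.assoc)
qed

text \<open>Moving e to the right lowers the argument of the falling factorial by one. The term et
  of u therefore cancels the second summand of \<open>falling_add_one\<close>.\<close>

lemma tunit_antipode_series:
  assumes he: "h * e - e * h = e"
  shows "tunit e * antipode_series h e (s + 1) = antipode_series h e s"
proof (rule fps_ext)
  fix n
  show "fps_nth (tunit e * antipode_series h e (s + 1)) n = fps_nth (antipode_series h e s) n"
  proof (cases n)
    case (Suc k)
    let ?f = "falling (h + of_int s)"
    have c: "e * falling (h + of_int s + 1) k = ?f k * e"
      by (rule falling_intertwine) (use he in \<open>simp add: distrib_left distrib_right mult_of_int_commute algebra_simps\<close>)
    have "fps_nth (antipode_series h e (s + 1)) n = q (1 / fact n) * (?f n * e ^ n) + q (1 / fact n) * (of_nat n * (?f k * e ^ n))"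
      using falling_add_one[of "h + of_int s" k]
      by (simp add: antipode_series_def Suc distrib_left distrib_right add.assoc mult.assoc del: falling.simps of_nat_Suc fact_Suc power_Suc)
    also have "q (1 / fact n) * (of_nat n * (?f k * e ^ n)) = q (1 / fact k) * (?f k * e ^ n)"
      by (simp only: Suc q_fact_Suc mult.assoc[symmetric])
    also have "q (1 / fact k) * (?f k * e ^ n) = e * fps_nth (antipode_series h e (s + 1)) k"
      by (simp add: Suc antipode_series_def q_left mult_swap_assoc[OF c] add.assoc[symmetric])
    finally show ?thesis
      by (simp add: tunit_mult_nth Suc antipode_series_def del: falling.simps fact_Suc power_Suc)
  qed (simp add: tunit_mult_nth tunit_nth antipode_series_def)
qed

lemma tpow_antipode_series:
  assumes "h * e - e * h = e"
  shows "tpow e j * antipode_series h e (s + j) = antipode_series h e s"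
  using unit_powi_intertwine_left[OF is_unit_tunit, of e "\<lambda>m. antipode_series h e (- m)" j "- (s + j)"]
    tunit_antipode_series[OF assms, of "- _ - 1"] by (simp add: add.commute)

text \<open>After e^n has been moved past z_0, the first i factors of \<open>falling h n\<close>
  stay with z_i. The others pass z_i, of weight m + i, and become factors of h + m; summed up they
  form w shifted by m, which is u^(-m) w.\<close>

lemma antipode_series_weight:
  assumes z: "divided_seq e z" and zh: "\<And>l. z l * h = (h - of_int (m + int l)) * z l"
    and he: "h * e - e * h = e"
  shows "antipode_series h e 0 * fps_const (z 0)
       = weight_series (fps_const h) 0 z * tpow e (- m) * antipode_series h e 0"
proof -
  have "antipode_series h e 0 * fps_const (z 0)
      = fps_series (\<lambda>i. falling (fps_const h) i * fps_const (z i) * antipode_series h e m)"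
  proof (rule fps_ext)
    fix n
    have "fps_nth (antipode_series h e 0 * fps_const (z 0)) n = q (1 / fact n) * (falling h n * (e ^ n * z 0))"
      by (simp add: antipode_series_def mult.assoc)
    also have "\<dots> = (\<Sum>i\<le>n. q (1 / fact (n - i)) * (falling h n * (z i * e ^ (n - i))))"
      unfolding divided_seq_power(1)[OF z] sum_distrib_left
      by (rule sum.cong[OF refl]) (simp only: of_nat_mult_left[of "falling h n"] q_binomial atMost_iff)
    also have "\<dots> = fps_nth (fps_series (\<lambda>i. falling (fps_const h) i * fps_const (z i) * antipode_series h e m)) n"
      unfolding fps_series_nth
    proof (rule sum.cong[OF refl])
      fix i assume i: "i \<in> {..n}"
      have "z i * falling (h + of_int m) (n - i) = falling (h - of_nat i) (n - i) * z i"
        by (rule falling_intertwine) (simp add: distrib_left zh left_diff_distrib mult_of_int_commute distrib_right)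
      note f = this
      have "falling h n = falling h i * falling (h - of_nat i) (n - i)"
        using falling_add[of h i "n - i"] i by simp
      then show "q (1 / fact (n - i)) * (falling h n * (z i * e ^ (n - i)))
          = fps_nth (falling (fps_const h) i * fps_const (z i) * antipode_series h e m) (n - i)"
        by (simp add: antipode_series_def q_left mult.assoc mult_swap_assoc[OF f] flip: fps_const_falling)
    qed
    finally show "fps_nth (antipode_series h e 0 * fps_const (z 0)) n
      = fps_nth (fps_series (\<lambda>i. falling (fps_const h) i * fps_const (z i) * antipode_series h e m)) n" .
  qed
  also have "\<dots> = weight_series (fps_const h) 0 z * antipode_series h e m"
    by (simp add: weight_series_def fps_series_mult_right)
  also have "antipode_series h e m = tpow e (- m) * antipode_series h e 0"
    using tpow_antipode_series[OF he, of "- m" m] by simp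
  finally show ?thesis by (simp add: mult.assoc)
qed

text \<open>The cocycle equation, with subscripts naming tensor positions. Both sides are expanded
  into the monomials \<open>?t r j p\<close>: the left side by Vandermonde for h1 and h2, the right
  side by the binomial theorem for e2 and e3.\<close>

lemma twist_equation:
  assumes h1: "h1 * h2 = h2 * h1" "h1 * e2 = e2 * h1" "h1 * e3 = e3 * h1"
    and e3: "h2 * e3 = e3 * h2" "e2 * e3 = e3 * e2" and he: "h2 * e2 - e2 * h2 = e2"
  shows "twist_series h1 e2 0 * twist_series (h1 + h2) e3 0 = twist_series h2 e3 0 * twist_series h1 (e2 + e3) 0"
proof (rule fps_ext)
  fix n
  let ?t = "\<lambda>r j p. q (1 / (fact r * fact j * fact p)) * (falling h1 (r + j) * (falling h2 p * ((- e2) ^ r * (- e3) ^ (j + p))))"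
  have l: "q (1 / fact r) * (falling h1 r * (- e2) ^ r) * (q (1 / fact s) * (falling (h1 + h2) s * (- e3) ^ s))
      = (\<Sum>j\<le>s. ?t r j (s - j))" for r s
  proof -
    have "e2 * (h1 + h2) = (h1 + h2 - 1) * e2"
      using he h1 by (simp add: algebra_simps)
    \<comment> \<open>Passing e2^r lowers h2 by r. The shift is charged to h1 so that Vandermonde
      yields falling factorials of h1 - r, which continue \<open>falling h1 r\<close>.\<close>
    have c: "(- e2) ^ r * falling (h1 + h2) s = falling (h1 - of_nat r + h2) s * (- e2) ^ r"
    proof (rule falling_intertwine, induction r)
      case (Suc r)
      have "(- e2) ^ Suc r * (h1 + h2) = - (e2 * ((h1 - of_nat r + h2) * (- e2) ^ r))"
        by (simp only: power_Suc mult.assoc Suc mult_minus_left)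
      also have "\<dots> = (h1 - of_nat (Suc r) + h2) * (- e2) ^ Suc r"
      proof -
        have "e2 * (h1 - of_nat r + h2) = (h1 - of_nat (Suc r) + h2) * e2"
          using he h1 by (simp add: algebra_simps mult_of_nat_commute)
        then show ?thesis by (simp only: mult.assoc[symmetric]) (simp add: mult.assoc)
      qed
      finally show ?case .
    qed simp
    have h: "(h1 - of_nat r) * h2 = h2 * (h1 - of_nat r)"
      using h1 by (simp add: algebra_simps mult_of_nat_commute)
    have "q (1 / fact r) * (falling h1 r * (- e2) ^ r) * (q (1 / fact s) * (falling (h1 + h2) s * (- e3) ^ s))
        = q (1 / fact r) * (q (1 / fact s) * (falling h1 r * (falling (h1 - of_nat r + h2) s * ((- e2) ^ r * (- e3) ^ s))))"
      by (simp only: mult.assoc q_left[of "falling h1 r"] q_left[of "(- e2) ^ r"] mult_swap_assoc[OF c])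
    also have "\<dots> = (\<Sum>j\<le>s. q (1 / fact r) * (q (1 / fact s) * (of_nat (s choose j) *
        (falling h1 (r + j) * (falling h2 (s - j) * ((- e2) ^ r * (- e3) ^ s))))))"
      unfolding falling_vandermonde[OF h] sum_distrib_left sum_distrib_right
      by (simp only: falling_add mult.assoc of_nat_mult_left)
    also have "\<dots> = (\<Sum>j\<le>s. ?t r j (s - j))"
    proof (rule sum.cong[OF refl])
      fix j assume j: "j \<in> {..s}"
      have "1 / fact r * (1 / fact s * of_nat (s choose j)) = (1 / (fact r * fact j * fact (s - j)) :: rat)"
        using j by (simp add: binomial_fact)
      then have "q (1 / fact r) * (q (1 / fact s) * of_nat (s choose j)) = q (1 / (fact r * fact j * fact (s - j)))"
        by (simp only: hom_mult[OF hom_q, symmetric] hom_of_nat[OF hom_q, symmetric])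
      then show "q (1 / fact r) * (q (1 / fact s) * (of_nat (s choose j) *
          (falling h1 (r + j) * (falling h2 (s - j) * ((- e2) ^ r * (- e3) ^ s))))) = ?t r j (s - j)"
        using j by (simp flip: mult.assoc)
    qed
    finally show ?thesis .
  qed
  have r: "q (1 / fact p) * (falling h2 p * (- e3) ^ p) * (q (1 / fact s) * (falling h1 s * (- (e2 + e3)) ^ s))
      = (\<Sum>r\<le>s. ?t r (s - r) p)" for p s
  proof -
    have c1: "(- e3) ^ p * falling h1 s = falling h1 s * (- e3) ^ p"
      by (rule falling_commute, rule power_commuting_commutes) (simp add: h1)
    have c2: "falling h2 p * falling h1 s = falling h1 s * falling h2 p"
      by (intro falling_commute falling_commute[symmetric]) (simp add: h1)
    have c3: "(- e3) ^ p * (- e2) ^ r = (- e2) ^ r * (- e3) ^ p" for r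
      by (rule power_commuting_commutes, rule power_commuting_commutes[symmetric]) (simp add: e3)
    have b: "(- (e2 + e3)) ^ s = (\<Sum>r\<le>s. of_nat (s choose r) * ((- e2) ^ r * (- e3) ^ (s - r)))"
      using commuting_binomial[of "- e2" "- e3" s] e3 by simp
    have "q (1 / fact p) * (falling h2 p * (- e3) ^ p) * (q (1 / fact s) * (falling h1 s * (- (e2 + e3)) ^ s))
        = q (1 / fact p) * (q (1 / fact s) * (falling h1 s * (falling h2 p * ((- e3) ^ p * (- (e2 + e3)) ^ s))))"
      by (simp only: mult.assoc q_left[of "falling h2 p"] q_left[of "(- e3) ^ p"] mult_swap_assoc[OF c1] mult_swap_assoc[OF c2])
    also have "\<dots> = (\<Sum>r\<le>s. q (1 / fact p) * (q (1 / fact s) * (of_nat (s choose r) *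
        (falling h1 s * (falling h2 p * ((- e2) ^ r * ((- e3) ^ p * (- e3) ^ (s - r))))))))"
      unfolding b sum_distrib_left by (simp only: mult_swap_assoc[OF c3] of_nat_mult_left)
    also have "\<dots> = (\<Sum>r\<le>s. ?t r (s - r) p)"
    proof (rule sum.cong[OF refl])
      fix r assume r: "r \<in> {..s}"
      have "1 / fact p * (1 / fact s * of_nat (s choose r)) = (1 / (fact r * fact (s - r) * fact p) :: rat)"
        using r by (simp add: binomial_fact)
      then have "q (1 / fact p) * (q (1 / fact s) * of_nat (s choose r)) = q (1 / (fact r * fact (s - r) * fact p))"
        by (simp only: hom_mult[OF hom_q, symmetric] hom_of_nat[OF hom_q, symmetric])
      moreover have "(- e3) ^ p * (- e3) ^ (s - r) = (- e3) ^ (s - r + p)"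
        by (simp only: power_add[symmetric] add.commute)
      ultimately show "q (1 / fact p) * (q (1 / fact s) * (of_nat (s choose r) *
          (falling h1 s * (falling h2 p * ((- e2) ^ r * ((- e3) ^ p * (- e3) ^ (s - r))))))) = ?t r (s - r) p"
        using r by (simp flip: mult.assoc)
    qed
    finally show ?thesis .
  qed
  have "fps_nth (twist_series h1 e2 0 * twist_series (h1 + h2) e3 0) n = (\<Sum>r\<le>n. \<Sum>j\<le>n - r. ?t r j (n - r - j))"
    by (simp add: fps_mult_nth' twist_series_def l)
  also have "\<dots> = (\<Sum>r\<le>n. \<Sum>p\<le>n - r. ?t r (n - r - p) p)"
    by (rule sum.cong[OF refl]) (rule sum_rev)
  also have "\<dots> = (\<Sum>p\<le>n. \<Sum>r\<le>n - p. ?t r (n - r - p) p)"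
    by (rule sum_triangle_swap)
  also have "\<dots> = fps_nth (twist_series h2 e3 0 * twist_series h1 (e2 + e3) 0) n"
    by (simp add: fps_mult_nth' twist_series_def r add.commute del: minus_add_distrib)
  finally show "fps_nth (twist_series h1 e2 0 * twist_series (h1 + h2) e3 0) n
      = fps_nth (twist_series h2 e3 0 * twist_series h1 (e2 + e3) 0) n" .
qed

end

lemma is_unit_fps:
  fixes f :: "'a::ring_1 fps"
  assumes "fps_nth f 0 = 1"
  shows "is_unit_elt f"
proof -
  have r: "f * fps_right_inverse f 1 = 1" and l: "fps_left_inverse f 1 * f = 1"
    using fps_right_inverse[of f 1] fps_left_inverse[of 1 f] assms by simp_all
  have "fps_left_inverse f 1 = fps_left_inverse f 1 * (f * fps_right_inverse f 1)"
    by (simp add: r)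
  also have "\<dots> = fps_right_inverse f 1"
    by (simp add: l flip: mult.assoc)
  finally show ?thesis using l r unfolding is_unit_elt_def by auto
qed

context rat_scalars
begin

lemma twist_series_0: "twist_series 0 e 0 = 1" "twist_series H 0 0 = 1"
proof -
  have q: "q 1 = 1" by (rule hom_one[OF hom_q])
  show "twist_series 0 e 0 = 1"
  proof (rule fps_ext)
    show "fps_nth (twist_series 0 e 0) n = fps_nth 1 n" for n
      by (cases n) (simp_all add: twist_series_def falling_zero q del: falling.simps(2))
  qed
  show "twist_series H 0 0 = 1"
  proof (rule fps_ext)
    show "fps_nth (twist_series H 0 0) n = fps_nth 1 n" for n
      by (cases n) (simp_all add: twist_series_def q)
  qed
qed

lemma is_unit_twist_series: "is_unit_elt (twist_series H e 0)"
  by (rule is_unit_fps) (simp add: twist_series_def hom_one[OF hom_q])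

lemma is_unit_antipode_series: "is_unit_elt (antipode_series h e 0)"
  by (rule is_unit_fps) (simp add: antipode_series_def hom_one[OF hom_q])

end

section \<open>Homomorphisms out of enveloping rings and tensor products\<close>

primrec uterm_eval :: "('l \<Rightarrow> 'b::ring_1) \<Rightarrow> 'l uterm \<Rightarrow> 'b" where
  "uterm_eval f UZero = 0"
| "uterm_eval f UOne = 1"
| "uterm_eval f (UGen x) = f x"
| "uterm_eval f (UAdd a b) = uterm_eval f a + uterm_eval f b"
| "uterm_eval f (UNeg a) = - uterm_eval f a"
| "uterm_eval f (UMul a b) = uterm_eval f a * uterm_eval f b"

definition lie_map :: "('l::lie_ring \<Rightarrow> 'b::ring_1) \<Rightarrow> bool" where
  "lie_map f \<longleftrightarrow> (\<forall>x y. f (x + y) = f x + f y) \<and> (\<forall>x y. f (lie x y) = f x * f y - f y * f x)"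

text \<open>Evaluation at a chosen representative. For a \<open>lie_map\<close> the value depends
  only on the class, by \<open>uterm_eval_urel\<close>, which gives the universal property of
  U(L).\<close>

definition uea_lift :: "('l::lie_ring \<Rightarrow> 'b::ring_1) \<Rightarrow> 'l uea \<Rightarrow> 'b" where
  "uea_lift f u = uterm_eval f (rep_uea u)"

lemma uterm_eval_urel:
  assumes f: "lie_map f"
  shows "urel a b \<Longrightarrow> uterm_eval f a = uterm_eval f b"
  by (induction rule: urel.induct) (use f in \<open>simp_all add: lie_map_def algebra_simps\<close>)

lemma uea_lift_abs: "lie_map f \<Longrightarrow> uea_lift f (abs_uea t) = uterm_eval f t"
  unfolding uea_lift_def
  by (rule uterm_eval_urel) (simp_all add: Quotient3_rep_abs[OF Quotient3_uea] urel.u_refl)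

lemma uea_abs_cases: obtains t where "u = abs_uea t"
  by (metis Quotient3_abs_rep[OF Quotient3_uea])

lemma hom_uea_lift:
  assumes f: "lie_map f"
  shows "hom_ring (uea_lift f)"
proof (rule hom_ringI)
  show "uea_lift f 1 = 1" by (simp add: one_uea.abs_eq uea_lift_abs[OF f])
  show "uea_lift f (x + y) = uea_lift f x + uea_lift f y" for x y
    by (cases x rule: uea_abs_cases; cases y rule: uea_abs_cases) (simp add: plus_uea.abs_eq uea_lift_abs[OF f])
  show "uea_lift f (x * y) = uea_lift f x * uea_lift f y" for x y
    by (cases x rule: uea_abs_cases; cases y rule: uea_abs_cases) (simp add: times_uea.abs_eq uea_lift_abs[OF f])
qed

lemma uea_lift_ugen: "lie_map f \<Longrightarrow> uea_lift f (ugen x) = f x"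
  by (simp add: ugen.abs_eq uea_lift_abs)

lemma uea_induct [case_names zero one gen add neg mult]:
  assumes "P 0" "P 1" "\<And>x. P (ugen x)" "\<And>a b. P a \<Longrightarrow> P b \<Longrightarrow> P (a + b)"
    "\<And>a. P a \<Longrightarrow> P (- a)" "\<And>a b. P a \<Longrightarrow> P b \<Longrightarrow> P (a * b)"
  shows "P (u :: 'l::lie_ring uea)"
proof -
  have "P (abs_uea t)" for t
  proof (induction t)
    case UZero then show ?case using assms(1) by (simp add: zero_uea.abs_eq)
  next
    case UOne then show ?case using assms(2) by (simp add: one_uea.abs_eq)
  next
    case (UGen x) then show ?case using assms(3)[of x] by (simp add: ugen.abs_eq)
  next
    case (UAdd a b) then show ?case using assms(4) by (simp flip: plus_uea.abs_eq)
  next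
    case (UNeg a) then show ?case using assms(5) by (simp flip: uminus_uea.abs_eq)
  next
    case (UMul a b) then show ?case using assms(6) by (simp flip: times_uea.abs_eq)
  qed
  then show ?thesis by (cases u rule: uea_abs_cases) simp
qed

lemma hom_uea_eqI:
  assumes "hom_ring f" "hom_ring g" "\<And>x. f (ugen x) = g (ugen x)"
  shows "f a = g a"
  by (induction a rule: uea_induct) (simp_all add: homs[OF assms(1)] homs[OF assms(2)] assms(3))

lemma ugen_zero [simp]: "ugen 0 = 0"
  by (rule additive_zero) (rule ugen_add)

lemma ugen_minus: "ugen (- x) = - ugen x"
  by (rule additive_minus) (rule ugen_add)

lemma ugen_sum: "ugen (\<Sum>i\<in>I. f i) = (\<Sum>i\<in>I. ugen (f i))"
  by (rule additive_sum) (rule ugen_add)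

lemma hom_comult0: "hom_ring comult0"
proof (rule hom_ringI)
  show "comult0 1 = 1" by transfer simp
  show "comult0 (x + y) = comult0 x + comult0 y" for x y by transfer simp
  show "comult0 (x * y) = comult0 x * comult0 y" for x y by transfer simp
qed

lemma comult0_ugen: "comult0 (ugen x) = ugen x \<otimes> 1 + 1 \<otimes> ugen x"
  by transfer simp

lemma hom_counit0: "hom_ring counit0"
  by (rule hom_ringI) simp_all

lemma antipode0_simps:
  "antipode0 0 = 0" "antipode0 1 = 1" "antipode0 (ugen x) = - ugen x" "antipode0 (- a) = - antipode0 a"
  by (simp add: zero_uea.abs_eq antipode0.abs_eq, simp add: one_uea.abs_eq antipode0.abs_eq,
    simp add: ugen.abs_eq antipode0.abs_eq uminus_uea.abs_eq,
    cases a rule: uea_abs_cases, simp add: antipode0.abs_eq uminus_uea.abs_eq)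

lemma antipode0_add: "antipode0 (a + b) = antipode0 a + antipode0 b"
  and antipode0_mult: "antipode0 (a * b) = antipode0 b * antipode0 a"
  by (cases a rule: uea_abs_cases; cases b rule: uea_abs_cases;
    simp add: antipode0.abs_eq plus_uea.abs_eq times_uea.abs_eq)+

section \<open>Maps out of tensor products\<close>

lemma tensor_induct [case_names tens add]:
  assumes "\<And>a b. P (a \<otimes> b)" "\<And>y z. P y \<Longrightarrow> P z \<Longrightarrow> P (y + z)"
  shows "P (z :: ('a::ab_group_add, 'b::ab_group_add) tensor)"
proof -
  have "P (abs_tensor M)" for M :: "('a \<times> 'b) multiset"
  proof (induction M)
    case empty
    show ?case using assms(1)[of 0 0] by (simp add: zero_tensor.abs_eq)
  next
    case (add p M)
    have "abs_tensor (add_mset p M) = (fst p \<otimes> snd p) + abs_tensor M"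
      by (simp add: tens.abs_eq plus_tensor.abs_eq)
    then show ?case using assms(2)[OF assms(1) add] by simp
  qed
  then show ?thesis by (cases z rule: abs_tensor_cases) simp
qed

definition biadditive :: "('a::ab_group_add \<Rightarrow> 'b::ab_group_add \<Rightarrow> 'c::ab_group_add) \<Rightarrow> bool" where
  "biadditive f \<longleftrightarrow> (\<forall>a a' b. f (a + a') b = f a b + f a' b) \<and> (\<forall>a b b'. f a (b + b') = f a b + f a b')"

lemma tensor_lift_biadditive:
  assumes "biadditive f"
  shows "tensor_lift f (a \<otimes> b) = f a b" "tensor_lift f (y + z) = tensor_lift f y + tensor_lift f z"
  using assms by (auto simp: biadditive_def intro: tensor_lift_tens tensor_lift_add)

context
  fixes f :: "'a::augmented_ring \<Rightarrow> 'c::ring_1" and g :: "'b::augmented_ring \<Rightarrow> 'c"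
  assumes f: "hom_ring f" and g: "hom_ring g"
begin

lemma biadditive_mult: "biadditive (\<lambda>a b. f a * g b)"
  by (simp add: biadditive_def hom_add[OF f] hom_add[OF g] algebra_simps)

lemma tensor_lift_mult_tens: "tensor_lift (\<lambda>a b. f a * g b) (a \<otimes> b) = f a * g b"
  by (rule tensor_lift_biadditive[OF biadditive_mult])

text \<open>Commuting images are what allows b and a' to be exchanged in f a g b f a' g b'.\<close>

lemma hom_tensor_lift:
  assumes c: "\<And>a b. f a * g b = g b * f a"
  shows "hom_ring (tensor_lift (\<lambda>a b. f a * g b))" (is "hom_ring ?h")
proof (rule hom_ringI)
  note add = tensor_lift_biadditive(2)[OF biadditive_mult]
  show "?h 1 = 1"
    using tensor_lift_mult_tens[of 1 1] by (simp add: tens_one hom_one[OF f] hom_one[OF g])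
  show "?h (x + y) = ?h x + ?h y" for x y by (rule add)
  have m: "?h ((a \<otimes> b) * (a' \<otimes> b')) = ?h (a \<otimes> b) * ?h (a' \<otimes> b')" for a b a' b'
    by (simp add: tens_mult tensor_lift_mult_tens hom_mult[OF f] hom_mult[OF g])
      (simp only: mult.assoc mult_swap_assoc[OF c[of a' b]])
  show "?h (x * y) = ?h x * ?h y" for x y
  proof (induction x rule: tensor_induct)
    case (tens a b)
    show ?case by (induction y rule: tensor_induct) (simp_all add: m add distrib_left)
  qed (simp add: add distrib_right)
qed

end

lemma hom_tens_left: "hom_ring (\<lambda>a. (a :: 'a::augmented_ring) \<otimes> (1 :: 'b::augmented_ring))"
  by (rule hom_ringI) (simp_all add: tens_one tens_add_left tens_mult)

lemma hom_tens_right: "hom_ring (\<lambda>b. (1 :: 'a::augmented_ring) \<otimes> (b :: 'b::augmented_ring))"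
  by (rule hom_ringI) (simp_all add: tens_one tens_add_right tens_mult)

lemma tens_split: "a \<otimes> b = (a \<otimes> 1) * (1 \<otimes> b)" "a \<otimes> b = (1 \<otimes> b) * (a \<otimes> 1)"
  for a :: "'a::augmented_ring" and b :: "'b::augmented_ring"
  by (simp_all add: tens_mult)

lemma tensor_map_add:
  assumes "\<And>x y. f (x + y) = f x + f y" "\<And>x y. g (x + y) = g x + g y"
  shows "tensor_map f g (y + z) = tensor_map f g y + tensor_map f g z" "tensor_map f g (a \<otimes> b) = f a \<otimes> g b"
proof -
  have "biadditive (\<lambda>a b. f a \<otimes> g b)"
    by (simp add: biadditive_def assms tens_add_left tens_add_right)
  from tensor_lift_biadditive[OF this]
  show "tensor_map f g (y + z) = tensor_map f g y + tensor_map f g z" "tensor_map f g (a \<otimes> b) = f a \<otimes> g b"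
    by (simp_all add: tensor_map_def)
qed

lemma hom_tensor_map:
  fixes f :: "'a::augmented_ring \<Rightarrow> 'c::augmented_ring" and g :: "'b::augmented_ring \<Rightarrow> 'd::augmented_ring"
  assumes f: "hom_ring f" and g: "hom_ring g"
  shows "hom_ring (tensor_map f g)"
proof -
  have "hom_ring (tensor_lift (\<lambda>a b. (f a \<otimes> 1) * (1 \<otimes> g b)))"
    by (intro hom_tensor_lift hom_ring_comp[OF hom_tens_left f] hom_ring_comp[OF hom_tens_right g])
      (simp add: tens_mult)
  then show ?thesis by (simp add: tensor_map_def tens_mult)
qed

lemma biadditive_tensor_assoc_inner: "biadditive (\<lambda>b c. (a \<otimes> b) \<otimes> c)"
  by (simp add: biadditive_def tens_add_left tens_add_right)

lemma biadditive_tensor_assoc: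
  "biadditive (\<lambda>a :: 'a::ab_group_add. tensor_lift (\<lambda>(b :: 'b::ab_group_add) (c :: 'c::ab_group_add). (a \<otimes> b) \<otimes> c))"
proof -
  note b = biadditive_tensor_assoc_inner
  have "tensor_lift (\<lambda>b c. ((a + a') \<otimes> b) \<otimes> c) z
      = tensor_lift (\<lambda>b c. (a \<otimes> b) \<otimes> c) z + tensor_lift (\<lambda>b c. (a' \<otimes> b) \<otimes> c) z"
    for a a' :: 'a and z :: "('b, 'c) tensor"
  proof (induction z rule: tensor_induct)
    case (tens c d)
    show ?case by (simp only: tensor_lift_biadditive(1)[OF b]) (simp only: tens_add_left)
  next
    case (add y z)
    show ?case by (simp only: tensor_lift_biadditive(2)[OF b] add) (simp only: ac_simps)
  qed
  then show ?thesis
    unfolding biadditive_def by (intro conjI allI tensor_lift_biadditive(2)[OF b]) (simp only:)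
qed

lemma tensor_assoc_tens: "tensor_assoc (a \<otimes> (b \<otimes> c)) = (a \<otimes> b) \<otimes> c"
  by (simp add: tensor_assoc_def tensor_lift_biadditive[OF biadditive_tensor_assoc]
      tensor_lift_biadditive[OF biadditive_tensor_assoc_inner])

lemma tensor_assoc_add: "tensor_assoc (y + z) = tensor_assoc y + tensor_assoc z"
  by (simp add: tensor_assoc_def tensor_lift_biadditive[OF biadditive_tensor_assoc])

lemma hom_tensor_assoc:
  "hom_ring (tensor_assoc :: ('a::augmented_ring, ('b::augmented_ring, 'c::augmented_ring) tensor) tensor \<Rightarrow> _)"
proof (rule hom_ringI)
  let ?h = "tensor_assoc :: ('a, ('b, 'c) tensor) tensor \<Rightarrow> _"
  show "?h 1 = 1" using tensor_assoc_tens[of "1::'a" "1::'b" "1::'c"] by (simp add: tens_one)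
  show "?h (x + y) = ?h x + ?h y" for x y by (rule tensor_assoc_add)
  have 1: "?h ((a \<otimes> (b \<otimes> c)) * (a' \<otimes> z)) = ?h (a \<otimes> (b \<otimes> c)) * ?h (a' \<otimes> z)" for a b c a' z
    by (induction z rule: tensor_induct)
      (simp_all add: tens_mult tensor_assoc_tens tensor_assoc_add tens_add_right distrib_left)
  have 2: "?h ((a \<otimes> z') * (a' \<otimes> z)) = ?h (a \<otimes> z') * ?h (a' \<otimes> z)" for a z' a' z
    by (induction z' rule: tensor_induct)
      (simp_all add: 1 tensor_assoc_add tens_add_right distrib_right)
  show "?h (x * y) = ?h x * ?h y" for x y
  proof (induction x rule: tensor_induct)
    case (tens a b)
    show ?case by (induction y rule: tensor_induct) (simp_all add: 2 tensor_assoc_add distrib_left)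
  qed (simp add: tensor_assoc_add distrib_right)
qed

lemma biadditive_times: "biadditive ((*) :: 'a::ring_1 \<Rightarrow> _)"
  by (simp add: biadditive_def algebra_simps)

lemma tensor_mult_tens: "tensor_mult (a \<otimes> b) = a * b"
    and tensor_mult_add: "tensor_mult (y + z) = tensor_mult y + tensor_mult z"
  by (simp_all add: tensor_mult_def tensor_lift_biadditive[OF biadditive_times])

subsection \<open>Completed tensor products\<close>

abbreviation inj1 :: "'a::augmented_ring fps \<Rightarrow> ('a, 'b::augmented_ring) tensor fps" where
  "inj1 \<equiv> map_fps (\<lambda>a. a \<otimes> 1)"

abbreviation inj2 :: "'b::augmented_ring fps \<Rightarrow> ('a::augmented_ring, 'b) tensor fps" where
  "inj2 \<equiv> map_fps (\<lambda>b. 1 \<otimes> b)"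

lemmas hom_inj1 = hom_map_fps[OF hom_tens_left]
lemmas hom_inj2 = hom_map_fps[OF hom_tens_right]

text \<open>Replaces the completed tensor of two series by an ordinary product of two commuting
  embeddings, so that ring rewriting applies to it.\<close>

lemma fps_tens_inj: "A \<otimes>\<^sub>t B = inj1 A * inj2 B" "A \<otimes>\<^sub>t B = inj2 B * inj1 A"
proof -
  show "A \<otimes>\<^sub>t B = inj1 A * inj2 B"
    by (rule fps_ext) (simp add: fps_tens_def fps_mult_nth' tens_mult)
  show "A \<otimes>\<^sub>t B = inj2 B * inj1 A"
  proof (rule fps_ext)
    fix n
    have "(\<Sum>i\<le>n. fps_nth A i \<otimes> fps_nth B (n - i)) = (\<Sum>i\<le>n. fps_nth A (n - i) \<otimes> fps_nth B i)"
      by (rule sum_rev)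
    then show "fps_nth (A \<otimes>\<^sub>t B) n = fps_nth (inj2 B * inj1 A) n"
      by (simp add: fps_tens_def fps_mult_nth' tens_mult)
  qed
qed

lemma inj_commute: "inj1 A * inj2 B = inj2 B * inj1 A"
  using fps_tens_inj[of A B] by simp

lemma fps_tens_add: "(A + A') \<otimes>\<^sub>t B = A \<otimes>\<^sub>t B + A' \<otimes>\<^sub>t B" "A \<otimes>\<^sub>t (B + B') = A \<otimes>\<^sub>t B + A \<otimes>\<^sub>t B'"
  for A A' :: "'a::augmented_ring fps" and B B' :: "'b::augmented_ring fps"
  by (simp_all add: fps_tens_inj(1) hom_add[OF hom_inj1] hom_add[OF hom_inj2] algebra_simps)

lemma fps_tens_const: "fps_const a \<otimes>\<^sub>t fps_const b = fps_const (a \<otimes> b)"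
  for a :: "'a::augmented_ring" and b :: "'b::augmented_ring"
  by (simp add: fps_tens_inj(1) map_fps_const tens_mult)

lemma inj1_series: "inj1 (fps_series c) = fps_series (\<lambda>l. inj1 (c l))"
  by (rule map_fps_series) (rule tens_add_left)

lemma inj2_series: "inj2 (fps_series c) = fps_series (\<lambda>l. inj2 (c l))"
  by (rule map_fps_series) (rule tens_add_right)

lemma t_linear_inj2: "t_linear inj2"
  by (rule t_linear_map_fps) (rule tens_add_right)

context
  fixes f :: "'a::augmented_ring fps \<Rightarrow> 'c::augmented_ring fps"
    and g :: "'b::augmented_ring fps \<Rightarrow> 'd::augmented_ring fps"
  assumes f: "t_linear f" and g: "t_linear g"
begin

lemma biadditive_fps_tens: "biadditive (\<lambda>a b. f (fps_const a) \<otimes>\<^sub>t g (fps_const b))"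
  unfolding biadditive_def
  by (simp add: t_linear_add[OF f] t_linear_add[OF g] fps_tens_add flip: fps_const_add)

lemma fps_tensor_map_ext:
  "fps_tensor_map f g = fps_ext_map (tensor_lift (\<lambda>a b. f (fps_const a) \<otimes>\<^sub>t g (fps_const b)))"
  by (rule ext) (simp add: fps_tensor_map_def fps_ext_map_def)

lemma t_linear_fps_tensor_map: "t_linear (fps_tensor_map f g)"
  unfolding fps_tensor_map_ext by (rule t_linear_ext_map) (rule tensor_lift_biadditive[OF biadditive_fps_tens])

lemma fps_tensor_map_const: "fps_tensor_map f g (fps_const (a \<otimes> b)) = f (fps_const a) \<otimes>\<^sub>t g (fps_const b)"
  unfolding fps_tensor_map_ext
  by (subst fps_ext_map_const) (simp_all add: tensor_lift_biadditive[OF biadditive_fps_tens])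

text \<open>Known for constants in both slots; continuity and linearity in t extend it to the second
  slot and then to the first.\<close>

lemma fps_tensor_map_tens: "fps_tensor_map f g (A \<otimes>\<^sub>t B) = f A \<otimes>\<^sub>t g B"
proof -
  have c: "fps_tensor_map f g (fps_const a \<otimes>\<^sub>t B) = f (fps_const a) \<otimes>\<^sub>t g B" for a
  proof (rule t_linear_eqI[where f = "\<lambda>B. fps_tensor_map f g (fps_const a \<otimes>\<^sub>t B)"])
    show "t_linear (\<lambda>B. fps_tensor_map f g (fps_const a \<otimes>\<^sub>t B))"
      by (rule t_linearI) (simp_all add: t_linear_add[OF t_linear_fps_tensor_map]
          fps_tens_inj(1) hom_add[OF hom_inj2] distrib_left inj2_series fps_series_mult_left t_linear_series[OF t_linear_fps_tensor_map])
    show "t_linear (\<lambda>B. f (fps_const a) \<otimes>\<^sub>t g B)"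
      by (rule t_linearI) (simp_all add: t_linear_add[OF g]
          fps_tens_inj(1) hom_add[OF hom_inj2] distrib_left inj2_series fps_series_mult_left t_linear_series[OF g])
    show "fps_tensor_map f g (fps_const a \<otimes>\<^sub>t fps_const b) = f (fps_const a) \<otimes>\<^sub>t g (fps_const b)" for b
      by (simp add: fps_tens_const fps_tensor_map_const)
  qed
  show ?thesis
  proof (rule t_linear_eqI[where f = "\<lambda>A. fps_tensor_map f g (A \<otimes>\<^sub>t B)"])
    show "t_linear (\<lambda>A. fps_tensor_map f g (A \<otimes>\<^sub>t B))"
      by (rule t_linearI) (simp_all add: t_linear_add[OF t_linear_fps_tensor_map]
          fps_tens_inj(1) hom_add[OF hom_inj1] distrib_right inj1_series fps_series_mult_right t_linear_series[OF t_linear_fps_tensor_map])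
    show "t_linear (\<lambda>A. f A \<otimes>\<^sub>t g B)"
      by (rule t_linearI) (simp_all add: t_linear_add[OF f]
          fps_tens_inj(1) hom_add[OF hom_inj1] distrib_right inj1_series fps_series_mult_right t_linear_series[OF f])
  qed (rule c)
qed

end

lemma hom_fps_tensor_map:
  assumes f: "t_linear f" "hom_ring f" and g: "t_linear g" "hom_ring g"
  shows "hom_ring (fps_tensor_map f g)"
proof -
  have "hom_ring (tensor_lift (\<lambda>a b. inj1 (f (fps_const a)) * inj2 (g (fps_const b))))"
    by (intro hom_tensor_lift hom_ring_comp[OF hom_inj1] hom_ring_comp[OF hom_inj2] hom_ring_comp[OF f(2) hom_fps_const]
        hom_ring_comp[OF g(2) hom_fps_const]) (rule inj_commute)
  then show ?thesis
    unfolding fps_tensor_map_ext[OF f(1) g(1)] fps_tens_inj(1) by (rule hom_ext_map)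
qed

lemma t_linear_tensor_eqI:
  fixes F G :: "('a::augmented_ring, 'b::augmented_ring) tensor fps \<Rightarrow> 'c::ring_1 fps"
  assumes "t_linear F" "t_linear G" "\<And>a b. F (fps_const (a \<otimes> b)) = G (fps_const (a \<otimes> b))"
  shows "F P = G P"
proof (rule t_linear_eqI[OF assms(1,2)])
  fix z :: "('a, 'b) tensor"
  show "F (fps_const z) = G (fps_const z)"
    by (induction z rule: tensor_induct)
      (simp_all add: assms(3) t_linear_add[OF assms(1)] t_linear_add[OF assms(2)] flip: fps_const_add)
qed

text \<open>Reduces the Hopf identities between algebra maps to elements of the Lie ring.\<close>

lemma hom_uea_fps_eqI:
  fixes f g :: "'l::lie_ring uea fps \<Rightarrow> 'b::ring_1 fps"
  assumes "hom_ring f" "t_linear f" "hom_ring g" "t_linear g" "\<And>x. f (fps_const (ugen x)) = g (fps_const (ugen x))"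
  shows "f A = g A"
  by (rule t_linear_eqI[OF assms(2,4)],
      rule hom_uea_eqI[OF hom_ring_comp[OF assms(1) hom_fps_const] hom_ring_comp[OF assms(3) hom_fps_const] assms(5)])

subsection \<open>Rational scalars\<close>

abbreviation rat_scalar :: "rat \<Rightarrow> 'a::augmented_ring rat_ext" where
  "rat_scalar c \<equiv> c \<otimes> 1"

interpretation rat_ext: rat_scalars "rat_scalar :: rat \<Rightarrow> 'a::augmented_ring rat_ext"
proof
  show "hom_ring (rat_scalar :: rat \<Rightarrow> 'a rat_ext)" by (rule hom_tens_left)
  show "rat_scalar c * x = x * rat_scalar c" for c and x :: "'a rat_ext"
    by (induction x rule: tensor_induct) (simp_all add: tens_mult distrib_left distrib_right mult.commute)
qed

lemma of_int_rat_ext: "(of_int n :: 'a::augmented_ring rat_ext) = rat_scalar (of_int n)"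
  by (rule hom_of_int[OF hom_tens_left, symmetric])

lemma rat_map_tens: "(\<And>x y. f (x + y) = f x + f y) \<Longrightarrow> rat_map f (c \<otimes> a) = c \<otimes> f a"
  by (simp add: rat_map_def tensor_map_add)

lemma hom_rat_map: "hom_ring f \<Longrightarrow> hom_ring (rat_map f)"
  for f :: "'a::augmented_ring \<Rightarrow> 'b::augmented_ring"
  unfolding rat_map_def by (rule hom_tensor_map) (simp_all add: hom_ring_def)

lemma map_rat_map_twist_series:
  fixes f :: "'a::augmented_ring \<Rightarrow> 'b::augmented_ring"
  assumes f: "hom_ring f"
  shows "map_fps (rat_map f) (rat_ext.twist_series (1 \<otimes> H) (1 \<otimes> e) 0) = rat_ext.twist_series (1 \<otimes> f H) (1 \<otimes> f e) 0"
proof -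
  have g: "rat_map f (c \<otimes> a) = c \<otimes> f a" for c a by (rule rat_map_tens) (rule hom_add[OF f])
  show ?thesis
    by (rule fps_ext) (simp add: rat_ext.twist_series_def homs[OF hom_rat_map[OF f]] g hom_one[OF f])
qed

lemma rat_emb_inj2: "rat_emb = inj2"
  by (simp add: rat_emb_def fun_eq_iff)

lemma twist_elt_series: "twist_elt h e = rat_ext.twist_series (1 \<otimes> (ugen h \<otimes> 1)) (1 \<otimes> (1 \<otimes> ugen e)) 0"
proof (rule fps_ext)
  fix r
  have H: "falling (1 \<otimes> (ugen h \<otimes> 1)) r = 1 \<otimes> (falling (ugen h) r \<otimes> 1)"
    by (simp only: hom_falling[OF hom_tens_right] hom_falling[OF hom_tens_left])
  have "(- (1 \<otimes> (1 \<otimes> ugen e))) ^ r = 1 \<otimes> (1 \<otimes> (- ugen e) ^ r)"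
    by (simp only: hom_power[OF hom_tens_right] hom_minus[OF hom_tens_right])
  also have "(- ugen e) ^ r = of_int ((- 1) ^ r) * ugen e ^ r"
    by (subst power_minus) simp
  also have "1 \<otimes> (1 \<otimes> (of_int ((- 1) ^ r) * ugen e ^ r)) = of_int ((- 1) ^ r) * (1 \<otimes> (1 \<otimes> ugen e ^ r))"
    by (simp only: hom_mult[OF hom_tens_right] hom_of_int[OF hom_tens_right])
  also have "(of_int ((- 1) ^ r) :: ('a uea, 'a uea) tensor rat_ext) = rat_scalar ((- 1) ^ r)"
    unfolding of_int_rat_ext by simp
  finally show "fps_nth (twist_elt h e) r = fps_nth (rat_ext.twist_series (1 \<otimes> (ugen h \<otimes> 1)) (1 \<otimes> (1 \<otimes> ugen e)) 0) r"
    by (simp add: twist_elt_def rat_ext.twist_series_def H tens_mult)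
qed

text \<open>The standard antipode sends e^r to (-1)^r e^r, which cancels the sign in the
  twist.\<close>

lemma twist_w_series: "twist_w (twist_elt h e) = rat_ext.antipode_series (1 \<otimes> ugen h) (1 \<otimes> ugen e) 0"
proof (rule fps_ext)
  fix r
  have b: "biadditive (\<lambda>a b :: 'a uea. a * antipode0 b)"
    by (simp add: biadditive_def antipode0_add algebra_simps)
  have a: "antipode0 (x ^ r) = antipode0 x ^ r" for x :: "'a uea"
    by (induction r) (simp_all add: antipode0_simps antipode0_mult power_commutes)
  have "fps_nth (twist_w (twist_elt h e)) r
      = ((- 1) ^ r / fact r) \<otimes> (falling (ugen h) r * (- ugen e) ^ r)"
    by (simp add: twist_w_def twist_elt_def rat_map_tens tensor_lift_biadditive[OF b] a antipode0_simps)
  also have "(- ugen e) ^ r = of_int ((- 1) ^ r) * ugen e ^ r"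
    by (subst power_minus) simp
  also have "falling (ugen h) r * (of_int ((- 1) ^ r) * ugen e ^ r) = of_int ((- 1) ^ r) * (falling (ugen h) r * ugen e ^ r)"
    by (rule mult_swap_assoc) (simp only: mult_of_int_commute)
  also have "((- 1) ^ r / fact r) \<otimes> (of_int ((- 1) ^ r) * (falling (ugen h) r * ugen e ^ r))
      = ((- 1) ^ r / fact r) \<otimes> 1 * (of_int ((- 1) ^ r) * (1 \<otimes> (falling (ugen h) r * ugen e ^ r)))"
    by (subst tens_split(1)) (simp only: hom_mult[OF hom_tens_right] hom_of_int[OF hom_tens_right])
  also have "(of_int ((- 1) ^ r) :: 'a uea rat_ext) = rat_scalar ((- 1) ^ r)"
    unfolding of_int_rat_ext by simp
  also have "((- 1) ^ r / fact r) \<otimes> 1 * (rat_scalar ((- 1) ^ r) * (1 \<otimes> (falling (ugen h) r * ugen e ^ r)))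
     = (1 / fact r) \<otimes> (falling (ugen h) r * ugen e ^ r)"
    by (simp add: tens_mult flip: power_mult_distrib)
  finally show "fps_nth (twist_w (twist_elt h e)) r
      = fps_nth (rat_ext.antipode_series (1 \<otimes> ugen h) (1 \<otimes> ugen e) 0) r"
    by (simp add: rat_ext.antipode_series_def tens_mult flip: hom_falling[OF hom_tens_right] hom_power[OF hom_tens_right])
qed

section \<open>Convolution\<close>

lemma const_tens_mult: "fps_const (a \<otimes> b) * fps_const (a' \<otimes> b') = fps_const ((a * a') \<otimes> (b * b'))"
  for a a' :: "'x::augmented_ring" and b b' :: "'y::augmented_ring"
  by (simp add: tens_mult)

text \<open>Composed with a coproduct this is the convolution product of f and g.\<close>

definition fps_conv :: "('a::ring_1 fps \<Rightarrow> 'c::augmented_ring fps) \<Rightarrow> ('b::ring_1 fps \<Rightarrow> 'c fps)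
    \<Rightarrow> ('a, 'b) tensor fps \<Rightarrow> 'c fps" where
  "fps_conv f g P = map_fps tensor_mult (fps_tensor_map f g P)"

lemma tensor_mult_fps_tens: "map_fps tensor_mult (A \<otimes>\<^sub>t B) = A * B"
proof (rule fps_ext)
  fix n
  show "fps_nth (map_fps tensor_mult (A \<otimes>\<^sub>t B)) n = fps_nth (A * B) n"
    by (simp add: fps_tens_def fps_mult_nth' additive_sum[of tensor_mult, OF tensor_mult_add] tensor_mult_tens)
qed

context
  fixes f :: "'a::augmented_ring fps \<Rightarrow> 'c::augmented_ring fps" and g :: "'b::augmented_ring fps \<Rightarrow> 'c fps"
  assumes f: "t_linear f" and g: "t_linear g"
begin

lemma t_linear_fps_conv: "t_linear (fps_conv f g)"
  unfolding fps_conv_def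
  by (rule t_linear_comp[OF t_linear_map_fps t_linear_fps_tensor_map[OF f g]]) (rule tensor_mult_add)

lemma fps_conv_tens: "fps_conv f g (inj1 A * inj2 B) = f A * g B"
  by (simp add: fps_conv_def fps_tensor_map_tens[OF f g] tensor_mult_fps_tens flip: fps_tens_inj(1))

lemma fps_conv_tens_const: "fps_conv f g (fps_const (a \<otimes> b)) = f (fps_const a) * g (fps_const b)"
  using fps_conv_tens[of "fps_const a" "fps_const b"] by (simp add: fps_tens_const flip: fps_tens_inj(1))

lemma hom_fps_conv:
  assumes "hom_ring f" "hom_ring g" and c: "\<And>A B. f A * g B = g B * f A"
  shows "hom_ring (fps_conv f g)"
proof -
  note F = hom_ring_comp[OF assms(1) hom_fps_const] and G = hom_ring_comp[OF assms(2) hom_fps_const]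
  let ?t = "tensor_lift (\<lambda>a b. f (fps_const a) * g (fps_const b))"
  have t: "hom_ring ?t" by (rule hom_tensor_lift[OF F G c])
  have "fps_conv f g P = fps_ext_map ?t P" for P
    by (rule t_linear_tensor_eqI[OF t_linear_fps_conv t_linear_ext_map[of ?t, OF hom_add[OF t]]])
      (simp only: fps_conv_tens_const fps_ext_map_const[of ?t, OF hom_add[OF t]] tensor_lift_mult_tens[OF F G])
  then have "fps_conv f g = fps_ext_map ?t" by (rule ext)
  then show ?thesis using hom_ext_map[OF t] by simp
qed

text \<open>A convolution with an antihomomorphism is not multiplicative in general: at P times a
  \<otimes> b it wraps the value at P as f a ... g b. A central value can be pulled out; in the
  application it is an integer, the counit.\<close>

lemma fps_conv_central_antihom_left:
  assumes fm: "\<And>A B. f (A * B) = f B * f A" and gm: "\<And>A B. g (A * B) = g A * g B"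
    and P: "\<And>x. fps_conv f g P * x = x * fps_conv f g P"
  shows "fps_conv f g (P * Q) = fps_conv f g P * fps_conv f g Q"
proof (rule t_linear_tensor_eqI[where F = "\<lambda>Q. fps_conv f g (P * Q)"])
  note lin = t_linear_fps_conv
  show "t_linear (\<lambda>Q. fps_conv f g (P * Q))" by (rule t_linear_mult_left[OF lin])
  show "t_linear (\<lambda>Q. fps_conv f g P * fps_conv f g Q)" by (rule t_linear_times_left[OF lin])
  fix a b
  have "fps_conv f g (P * fps_const (a \<otimes> b)) = f (fps_const a) * fps_conv f g P * g (fps_const b)"
  proof (rule t_linear_tensor_eqI[where F = "\<lambda>P. fps_conv f g (P * fps_const (a \<otimes> b))"])
    show "t_linear (\<lambda>P. fps_conv f g (P * fps_const (a \<otimes> b)))" by (rule t_linear_mult_right[OF lin])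
    show "t_linear (\<lambda>P. f (fps_const a) * fps_conv f g P * g (fps_const b))"
      by (intro t_linear_times_left[THEN t_linear_times_right] lin)
    show "fps_conv f g (fps_const (a' \<otimes> b') * fps_const (a \<otimes> b))
        = f (fps_const a) * fps_conv f g (fps_const (a' \<otimes> b')) * g (fps_const b)" for a' b'
      by (simp only: const_tens_mult fps_conv_tens_const fps_const_mult[symmetric] fm gm mult.assoc)
  qed
  then show "fps_conv f g (P * fps_const (a \<otimes> b)) = fps_conv f g P * fps_conv f g (fps_const (a \<otimes> b))"
    by (simp only: fps_conv_tens_const P[symmetric] mult.assoc)
qed

text \<open>The mirror image: here the second factor is antimultiplicative and the value at Q is the
  one enclosed.\<close>

lemma fps_conv_central_antihom_right:
  assumes fm: "\<And>A B. f (A * B) = f A * f B" and gm: "\<And>A B. g (A * B) = g B * g A"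
    and Q: "\<And>x. fps_conv f g Q * x = x * fps_conv f g Q"
  shows "fps_conv f g (P * Q) = fps_conv f g P * fps_conv f g Q"
proof (rule t_linear_tensor_eqI[where F = "\<lambda>P. fps_conv f g (P * Q)"])
  note lin = t_linear_fps_conv
  show "t_linear (\<lambda>P. fps_conv f g (P * Q))" by (rule t_linear_mult_right[OF lin])
  show "t_linear (\<lambda>P. fps_conv f g P * fps_conv f g Q)" by (rule t_linear_times_right[OF lin])
  fix a b
  have "fps_conv f g (fps_const (a \<otimes> b) * Q) = f (fps_const a) * fps_conv f g Q * g (fps_const b)"
  proof (rule t_linear_tensor_eqI[where F = "\<lambda>P. fps_conv f g (fps_const (a \<otimes> b) * P)"])
    show "t_linear (\<lambda>P. fps_conv f g (fps_const (a \<otimes> b) * P))" by (rule t_linear_mult_left[OF lin])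
    show "t_linear (\<lambda>P. f (fps_const a) * fps_conv f g P * g (fps_const b))"
      by (intro t_linear_times_left[THEN t_linear_times_right] lin)
    show "fps_conv f g (fps_const (a \<otimes> b) * fps_const (a' \<otimes> b'))
        = f (fps_const a) * fps_conv f g (fps_const (a' \<otimes> b')) * g (fps_const b)" for a' b'
      by (simp only: const_tens_mult fps_conv_tens_const fps_const_mult[symmetric] fm gm mult.assoc)
  qed
  then show "fps_conv f g (fps_const (a \<otimes> b) * Q) = fps_conv f g (fps_const (a \<otimes> b)) * fps_conv f g Q"
    by (simp only: fps_conv_tens_const Q mult.assoc)
qed

end

section \<open>The quantized coproduct and antipode\<close>

text \<open>
  \<open>D l\<close> plays the role of \<open>(ad e)\<^sup>l / l!\<close>, \<open>wt m\<close> is the weight-\<open>m\<close> eigenspace of \<open>ad h\<close>, and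
  \<open>scale c\<close> multiplies it by \<open>c m\<close>.
\<close>

locale jordanian_pair =
  fixes h e :: "'l::lie_ring" and D :: "nat \<Rightarrow> 'l \<Rightarrow> 'l" and scale :: "(int \<Rightarrow> int) \<Rightarrow> 'l \<Rightarrow> 'l"
    and wt :: "int \<Rightarrow> 'l \<Rightarrow> bool"
  assumes D_0: "D 0 x = x" and D_add: "D l (x + y) = D l x + D l y"
    and D_Suc: "ugen (lie e (D l x)) = of_nat (Suc l) * ugen (D (Suc l) x)"
    and D_comp: "ugen (D j (D l x)) = of_nat (l + j choose j) * ugen (D (l + j) x)"
    and D_lie: "D n (lie x y) = (\<Sum>i\<le>n. lie (D i x) (D (n - i) y))"
    and D_e: "D (Suc l) e = 0" and D_h: "D (Suc 0) h = - e" "D (Suc (Suc l)) h = 0"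
    and scale_add: "scale c (x + y) = scale c x + scale c y"
    and wt_scale: "wt m x \<Longrightarrow> ugen (D l (scale c x)) = of_int (c m) * ugen (D l x)"
    and wt_lie: "wt m x \<Longrightarrow> wt m' y \<Longrightarrow> wt (m + m') (lie x y)"
    and wt_ad_h: "wt m x \<Longrightarrow> ugen (lie h x) = of_int m * ugen x"
    and wt_D: "wt m x \<Longrightarrow> wt (m + int l) (D l x)"
    and wt_h: "wt 0 h" and wt_e: "wt 1 e"
    and wt_span: "(\<And>m x. wt m x \<Longrightarrow> P x) \<Longrightarrow> (\<And>x y. P x \<Longrightarrow> P y \<Longrightarrow> P (x + y)) \<Longrightarrow> P x"
begin

abbreviation "h\<^sub>U \<equiv> ugen h"
abbreviation "e\<^sub>U \<equiv> ugen e"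
abbreviation "p \<equiv> tpow e\<^sub>U"

definition seq :: "'l \<Rightarrow> nat \<Rightarrow> 'l uea" where "seq x l = ugen (D l x)"

lemma seq_0: "seq x 0 = ugen x" by (simp add: seq_def D_0)

lemma seq_add: "seq (x + y) l = seq x l + seq y l" by (simp add: seq_def D_add ugen_add)

lemma divided_seq: "divided_seq e\<^sub>U (seq x)"
  unfolding divided_seq_def seq_def using D_Suc by (simp add: ugen_lie)

lemma seq_D: "seq (D l x) = seq_shift l (seq x)"
  by (rule ext) (simp add: seq_def seq_shift_def D_comp)

lemma seq_lie: "seq (lie x y) n = seq_mult (seq x) (seq y) n - seq_mult (seq y) (seq x) n"
proof -
  have "(\<Sum>i\<le>n. seq y (n - i) * seq x i) = seq_mult (seq y) (seq x) n"
    unfolding seq_mult_def by (rule sum_rev[symmetric])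
  then show ?thesis
    by (simp add: seq_def[of "lie x y"] D_lie ugen_sum ugen_lie sum_subtractf seq_def[symmetric] seq_mult_def[of "seq x"])
qed

lemma he: "h\<^sub>U * e\<^sub>U - e\<^sub>U * h\<^sub>U = e\<^sub>U"
  using wt_ad_h[OF wt_e] by (simp add: ugen_lie)

lemma wt_commute: "wt m x \<Longrightarrow> ugen x * h\<^sub>U = (h\<^sub>U - of_int m) * ugen x"
  using wt_ad_h[of m x] by (simp add: ugen_lie algebra_simps)

lemma wt_seq: "wt m x \<Longrightarrow> seq x l * h\<^sub>U = (h\<^sub>U - of_int (m + int l)) * seq x l"
  unfolding seq_def by (rule wt_commute) (rule wt_D)

lemma borel: "borel_rel e\<^sub>U (fps_const h\<^sub>U)"
  by (rule borel_rel_const) (rule he)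

abbreviation "H\<^sub>2 \<equiv> fps_const (h\<^sub>U \<otimes> (1 :: 'l uea))"
abbreviation "e\<^sub>2 \<equiv> (1 :: 'l uea) \<otimes> e\<^sub>U"

text \<open>On weight m this is x \<otimes> u^m. The power of u is expanded in e so that each
  coefficient is an integral function of the weight, which \<open>scale\<close> applies to all
  weight components at once; this makes the map additive on the whole Lie ring.\<close>

definition copr_left :: "'l \<Rightarrow> ('l uea, 'l uea) tensor fps" where
  "copr_left x = Abs_fps (\<lambda>n. ugen (scale (tcoeff n) x) \<otimes> (- e\<^sub>U) ^ n)"

definition copr_right :: "'l \<Rightarrow> ('l uea, 'l uea) tensor fps" where
  "copr_right x = conj_series e\<^sub>2 H\<^sub>2 (\<lambda>l. 1 \<otimes> seq x l)"

lemma copr_left_wt: "wt m x \<Longrightarrow> copr_left x = fps_const (ugen x \<otimes> 1) * tpow e\<^sub>2 m"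
proof (rule fps_ext)
  fix n assume "wt m x"
  from wt_scale[OF this, of 0] have "ugen (scale c x) = of_int (c m) * ugen x" for c
    by (simp add: D_0)
  moreover have "(- e\<^sub>2) ^ n = 1 \<otimes> (- e\<^sub>U) ^ n"
    by (simp add: hom_power[OF hom_tens_right] hom_minus[OF hom_tens_right])
  moreover have "(of_int k * ugen x) \<otimes> y = (ugen x \<otimes> 1) * (of_int k * (1 \<otimes> y))" for k y
  proof -
    have "(of_int k * ugen x) \<otimes> y = of_int k * (ugen x \<otimes> 1) * (1 \<otimes> y)"
      by (subst tens_split(1)) (simp only: hom_mult[OF hom_tens_left] hom_of_int[OF hom_tens_left])
    then show ?thesis
      by (simp only: mult.assoc mult_swap_assoc[of "ugen x \<otimes> 1" "of_int k" "of_int k" "ugen x \<otimes> 1", OF mult_of_int_commute[symmetric]])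
  qed
  ultimately show "fps_nth (copr_left x) n = fps_nth (fps_const (ugen x \<otimes> 1) * tpow e\<^sub>2 m) n"
    by (simp add: copr_left_def tpow_nth)
qed

lemma copr_left_add: "copr_left (x + y) = copr_left x + copr_left y"
  by (rule fps_ext) (simp add: copr_left_def scale_add ugen_add tens_add_left)

lemma copr_right_add: "copr_right (x + y) = copr_right x + copr_right y"
  by (simp add: copr_right_def seq_add tens_add_right conj_series_add)

lemma divided_seq2: "divided_seq e\<^sub>2 (\<lambda>l. 1 \<otimes> seq x l)"
  by (rule divided_seq_hom[OF hom_tens_right divided_seq])

lemma H2_tunit: "H\<^sub>2 * tunit e\<^sub>2 = tunit e\<^sub>2 * H\<^sub>2"
  using tpow_commute_const[of "h\<^sub>U \<otimes> 1" e\<^sub>2 1] by (simp add: tens_mult unit_powi_1)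

lemma copr_right_mult:
  "copr_right x * copr_right y = conj_series e\<^sub>2 H\<^sub>2 (\<lambda>l. 1 \<otimes> seq_mult (seq x) (seq y) l)"
proof -
  have "seq_mult (\<lambda>l. 1 \<otimes> seq x l) (\<lambda>l. 1 \<otimes> seq y l) = (\<lambda>l. (1 :: 'l uea) \<otimes> seq_mult (seq x) (seq y) l)"
    by (rule ext) (simp add: seq_mult_def hom_sum[OF hom_tens_right] tens_mult)
  then show ?thesis
    unfolding copr_right_def
    by (subst conj_series_mult[OF divided_seq2 H2_tunit]) (simp_all add: tens_mult)
qed

lemma copr_right_lie: "copr_right (lie x y) = copr_right x * copr_right y - copr_right y * copr_right x"
  unfolding copr_right_mult conj_series_diff[symmetric]
  by (simp add: copr_right_def seq_lie tens_diff)

lemma copr_commute: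
  assumes "wt m x"
  shows "copr_left x * copr_right y = copr_right y * copr_left x"
  unfolding copr_left_wt[OF assms] copr_right_def
proof (rule conj_series_commute_weight[OF divided_seq2 H2_tunit])
  have "(h\<^sub>U \<otimes> 1 - of_int m) * (ugen x \<otimes> 1) = ((h\<^sub>U - of_int m) * ugen x) \<otimes> (1 :: 'l uea)"
    by (simp add: hom_mult[OF hom_tens_left] hom_diff[OF hom_tens_left] hom_of_int[OF hom_tens_left])
  then show "fps_const (ugen x \<otimes> 1) * H\<^sub>2 = (H\<^sub>2 - of_int m) * fps_const (ugen x \<otimes> 1)"
    by (simp add: tens_mult wt_commute[OF assms] fps_of_int[symmetric])
  show "fps_const (ugen x \<otimes> 1) * tunit e\<^sub>2 = tunit e\<^sub>2 * fps_const (ugen x \<otimes> 1)"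
    using tpow_commute_const[of "ugen x \<otimes> 1" e\<^sub>2 1] by (simp add: tens_mult unit_powi_1)
qed (simp add: tens_mult)

lemma copr_left_lie:
  assumes x: "wt m x" and y: "wt m' y"
  shows "copr_left (lie x y) = copr_left x * copr_left y - copr_left y * copr_left x"
proof -
  have m: "copr_left x * copr_left y = fps_const ((ugen x * ugen y) \<otimes> 1) * tpow e\<^sub>2 (m + m')"
    if "wt m x" "wt m' y" for x y m m'
  proof -
    have "tpow e\<^sub>2 m * fps_const (ugen y \<otimes> 1) = fps_const (ugen y \<otimes> 1) * tpow e\<^sub>2 m"
      by (rule tpow_commute_const[symmetric]) (simp add: tens_mult)
    from mult_swap_assoc[OF this] have "copr_left x * copr_left y
        = fps_const (ugen x \<otimes> 1) * fps_const (ugen y \<otimes> 1) * (tpow e\<^sub>2 m * tpow e\<^sub>2 m')"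
      by (simp only: copr_left_wt[OF that(1)] copr_left_wt[OF that(2)] mult.assoc)
    then show ?thesis by (simp add: tens_mult flip: tpow_add)
  qed
  show ?thesis
    unfolding m[OF x y] m[OF y x] copr_left_wt[OF wt_lie[OF x y]]
    by (simp add: ugen_lie tens_diff left_diff_distrib add.commute flip: fps_const_sub)
qed

text \<open>The left and right parts respect brackets separately and commute with one another, so
  the cross terms of the commutator cancel. The left part is controlled only on weight vectors,
  hence the two inductions over \<open>wt_span\<close>.\<close>

lemma lie_map_copr: "lie_map (\<lambda>x. copr_left x + copr_right x)"
  unfolding lie_map_def
proof (intro conjI allI)
  let ?f = "\<lambda>x. copr_left x + copr_right x"
  show add: "?f (x + y) = ?f x + ?f y" for x y
    by (simp add: copr_left_add copr_right_add)
  show "?f (lie x y) = ?f x * ?f y - ?f y * ?f x" for x y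
  proof (induction x rule: wt_span)
    case (1 m x)
    show ?case
    proof (induction y rule: wt_span)
      case (1 m' y)
      show ?case
        using copr_commute[OF \<open>wt m x\<close>, of y] copr_commute[OF \<open>wt m' y\<close>, of x]
        by (simp add: copr_left_lie[OF \<open>wt m x\<close> \<open>wt m' y\<close>] copr_right_lie distrib_left distrib_right)
    next
      case (2 y z)
      show ?case by (simp only: lie_add_right add 2 distrib_left distrib_right) (simp add: algebra_simps)
    qed
  next
    case (2 x z)
    show ?case by (simp only: lie_add_left add 2 distrib_left distrib_right) (simp add: algebra_simps)
  qed
qed

definition copr_uea :: "'l uea \<Rightarrow> ('l uea, 'l uea) tensor fps" where
  "copr_uea = uea_lift (\<lambda>x. copr_left x + copr_right x)"

definition copr :: "'l uea fps \<Rightarrow> ('l uea, 'l uea) tensor fps" where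
  "copr = fps_ext_map copr_uea"

lemma hom_copr_uea: "hom_ring copr_uea"
  unfolding copr_uea_def by (rule hom_uea_lift[OF lie_map_copr])

lemma hom_copr: "hom_ring copr"
  unfolding copr_def by (rule hom_ext_map[OF hom_copr_uea])

lemma t_linear_copr: "t_linear copr"
  unfolding copr_def by (rule t_linear_ext_map) (rule hom_add[OF hom_copr_uea])

lemma copr_const: "copr (fps_const a) = copr_uea a"
  unfolding copr_def by (rule fps_ext_map_const) (rule hom_add[OF hom_copr_uea])

lemma copr_ugen: "copr (fps_const (ugen x)) = copr_left x + copr_right x"
  by (simp add: copr_const copr_uea_def uea_lift_ugen[OF lie_map_copr])

lemma copr_right_series:
  "copr_right x = fps_series (\<lambda>l. falling (- inj1 (fps_const h\<^sub>U)) l * inj2 (p (- int l) * fps_const (seq x l)))"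
  unfolding copr_right_def conj_series_def
  by (simp add: map_fps_const hom_mult[OF hom_inj2] map_fps_tpow[OF hom_tens_right] mult.assoc)

lemma copr_wt:
  assumes "wt m x"
  shows "copr (fps_const (ugen x)) = inj1 (fps_const (ugen x)) * inj2 (p m)
     + fps_series (\<lambda>l. falling (- inj1 (fps_const h\<^sub>U)) l * inj2 (p (- int l) * fps_const (seq x l)))"
  by (simp add: copr_ugen copr_right_series copr_left_wt[OF assms] map_fps_const map_fps_tpow[OF hom_tens_right])

lemma p_minus_one: "1 + fps_X * (p (- 1) * fps_const e\<^sub>U) = p (- 1)"
proof -
  have "p (- 1) * tunit e\<^sub>U = 1"
    using unit_powi_Suc(2)[OF is_unit_tunit, of e\<^sub>U "- 1"] by (simp add: unit_powi_0)
  then have "p (- 1) - p (- 1) * fps_const e\<^sub>U * fps_X = 1"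
    by (simp add: tunit_def right_diff_distrib mult.assoc)
  then show ?thesis by (simp add: fps_X_commute algebra_simps)
qed

text \<open>The series stops after l = 1 because D_1 h = -e. Its degree-one term turns h \<otimes> 1
  into h \<otimes> u^(-1), since 1 + t u^(-1) e = u^(-1).\<close>

lemma copr_h: "copr (fps_const h\<^sub>U) = inj1 (fps_const h\<^sub>U) * inj2 (p (- 1)) + inj2 (fps_const h\<^sub>U)"
proof -
  let ?H = "inj1 (fps_const h\<^sub>U) :: ('l uea, 'l uea) tensor fps"
  have "fps_series (\<lambda>l. falling (- ?H) l * inj2 (p (- int l) * fps_const (seq h l)))
      = inj2 (fps_const h\<^sub>U) + fps_X * ((- ?H) * inj2 (p (- 1) * fps_const (- e\<^sub>U)))"
    by (subst fps_series_Suc, subst fps_series_Suc)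
      (simp add: seq_def D_0 D_h ugen_minus unit_powi_0 fps_series_zero hom_zero[OF hom_inj2])
  also have "(- ?H) * inj2 (p (- 1) * fps_const (- e\<^sub>U)) = ?H * inj2 (p (- 1) * fps_const e\<^sub>U)"
    by (simp add: hom_minus[OF hom_inj2] flip: fps_const_neg)
  also have "fps_X * \<dots> = ?H * inj2 (fps_X * (p (- 1) * fps_const e\<^sub>U))"
    by (simp only: hom_mult[OF hom_inj2, of fps_X] map_fps_X[OF hom_tens_right] mult_swap_assoc[OF fps_X_commute])
  finally have "copr (fps_const h\<^sub>U) = ?H * inj2 (1 + fps_X * (p (- 1) * fps_const e\<^sub>U)) + inj2 (fps_const h\<^sub>U)"
    by (simp add: copr_wt[OF wt_h] unit_powi_0 hom_add[OF hom_inj2] hom_one[OF hom_inj2] distrib_left)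
  then show ?thesis by (simp only: p_minus_one)
qed

lemma copr_e: "copr (fps_const e\<^sub>U) = inj1 (fps_const e\<^sub>U) * inj2 (tunit e\<^sub>U) + inj2 (fps_const e\<^sub>U)"
  unfolding copr_wt[OF wt_e]
  by (subst fps_series_single) (simp_all add: seq_def D_0 D_e unit_powi_0 unit_powi_1 hom_zero[OF hom_inj2])

text \<open>The unit u is group-like. This evaluates the coproduct on all its integer powers, where
  expanding in e would be unwieldy.\<close>

lemma copr_tunit: "copr (tunit e\<^sub>U) = inj1 (tunit e\<^sub>U) * inj2 (tunit e\<^sub>U)"
proof -
  have t: "tunit a = 1 - fps_X * fps_const a" for a :: "'l uea"
    by (simp add: tunit_def fps_X_commute)
  have "copr (tunit e\<^sub>U) = 1 - fps_X * (inj1 (fps_const e\<^sub>U) * inj2 (tunit e\<^sub>U)) - fps_X * inj2 (fps_const e\<^sub>U)"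
    by (simp add: t hom_diff[OF hom_copr] hom_one[OF hom_copr] t_linear_X[OF t_linear_copr] copr_e distrib_left)
  also have "\<dots> = 1 - fps_X * inj2 (fps_const e\<^sub>U) - fps_X * (inj1 (fps_const e\<^sub>U) * inj2 (tunit e\<^sub>U))"
    by (simp add: algebra_simps)
  also have "1 - fps_X * inj2 (fps_const e\<^sub>U) = (inj2 (tunit e\<^sub>U) :: ('l uea, 'l uea) tensor fps)"
    by (simp only: t hom_diff[OF hom_inj2] hom_one[OF hom_inj2] hom_mult[OF hom_inj2] map_fps_X[OF hom_tens_right])
  also have "inj2 (tunit e\<^sub>U) - fps_X * (inj1 (fps_const e\<^sub>U) * inj2 (tunit e\<^sub>U)) = inj1 (tunit e\<^sub>U) * inj2 (tunit e\<^sub>U)"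
  proof -
    have "(inj1 (tunit e\<^sub>U) :: ('l uea, 'l uea) tensor fps) = 1 - fps_X * inj1 (fps_const e\<^sub>U)"
      by (simp only: t hom_diff[OF hom_inj1] hom_one[OF hom_inj1] hom_mult[OF hom_inj1] map_fps_X[OF hom_tens_left])
    then show ?thesis by (simp only: left_diff_distrib mult_1_left mult.assoc)
  qed
  finally show ?thesis .
qed

lemma copr_p: "copr (p m) = inj1 (p m) * inj2 (p m)"
proof -
  let ?a = "\<lambda>m. inj1 (p m) * inj2 (p m) :: ('l uea, 'l uea) tensor fps"
  have a: "?a m * copr (tunit e\<^sub>U) = ?a (m + 1)" for m
    by (simp only: copr_tunit mult.assoc mult_swap_assoc[OF inj_commute[symmetric]]
        unit_powi_Suc(2)[OF is_unit_tunit] hom_mult[OF hom_inj1] hom_mult[OF hom_inj2])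
  have u: "is_unit_elt (copr (tunit e\<^sub>U))" by (rule is_unit_elt_hom[OF hom_copr is_unit_tunit])
  show ?thesis
    using unit_powi_intertwine[of _ ?a 0 m, OF u a]
    by (simp add: hom_unit_powi[OF hom_copr is_unit_tunit] unit_powi_0 hom_one[OF hom_inj1] hom_one[OF hom_inj2])
qed

end

context jordanian_pair
begin

subsection \<open>Coassociativity\<close>

text \<open>Both sides are algebra maps, so weight vectors of the Lie ring suffice. On the left,
  falling factorials of the coproduct of h expand by \<open>falling_coproduct\<close>; on the right,
  the coproduct is applied again to D_l x. The binomial coefficients of the two expansions agree by
  the composition rule for the D_l.\<close>

lemma copr_coassoc:
  "fps_tensor_map copr id (copr a) = map_fps tensor_assoc (fps_tensor_map id copr (copr a))"
proof -
  let ?L = "fps_tensor_map copr id :: _ \<Rightarrow> (('l uea, 'l uea) tensor, 'l uea) tensor fps"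
  let ?R = "\<lambda>P. map_fps tensor_assoc (fps_tensor_map id copr P) :: (('l uea, 'l uea) tensor, 'l uea) tensor fps"
  \<comment> \<open>The three commuting embeddings of U(L)[[t]] into the completed tensor cube;
    \<open>?J\<close> below embeds the tensor square into positions two and three.\<close>
  let ?j1 = "\<lambda>A. inj1 (inj1 A) :: (('l uea, 'l uea) tensor, 'l uea) tensor fps"
  let ?j2 = "\<lambda>A. inj1 (inj2 A) :: (('l uea, 'l uea) tensor, 'l uea) tensor fps"
  let ?j3 = "\<lambda>A. inj2 A :: (('l uea, 'l uea) tensor, 'l uea) tensor fps"
  let ?J = "map_fps (\<lambda>z. tensor_assoc (1 \<otimes> z)) :: _ \<Rightarrow> (('l uea, 'l uea) tensor, 'l uea) tensor fps"
  have id: "t_linear id" "hom_ring id" using t_linear_id hom_ring_id by (simp_all add: id_def)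
  have L: "hom_ring ?L" "t_linear ?L"
    by (rule hom_fps_tensor_map[OF t_linear_copr hom_copr id], rule t_linear_fps_tensor_map[OF t_linear_copr id(1)])
  have R: "hom_ring ?R" "t_linear ?R"
    by (rule hom_ring_comp[OF hom_map_fps[OF hom_tensor_assoc] hom_fps_tensor_map[OF id t_linear_copr hom_copr]],
        rule t_linear_comp[OF t_linear_map_fps t_linear_fps_tensor_map[OF id(1) t_linear_copr]], rule tensor_assoc_add)
  have J: "hom_ring ?J" "t_linear ?J"
    by (rule hom_map_fps[OF hom_ring_comp[OF hom_tensor_assoc hom_tens_right]],
        rule t_linear_map_fps) (simp add: tens_add_right tensor_assoc_add)
  have L1: "?L (inj1 A) = inj1 (copr A)" and L2: "?L (inj2 A) = ?j3 A" for A
    using fps_tensor_map_tens[OF t_linear_copr id(1), of A 1] fps_tensor_map_tens[OF t_linear_copr id(1), of 1 A]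
    by (simp_all add: fps_tens_inj(1) hom_one[OF hom_inj1] hom_one[OF hom_inj2] hom_one[OF hom_copr])
  have R1: "?R (inj1 A) = ?j1 A" for A
  proof -
    have "?R (inj1 A) = map_fps tensor_assoc (inj1 A)"
      using fps_tensor_map_tens[OF id(1) t_linear_copr, of A 1]
      by (simp add: fps_tens_inj(1) hom_one[OF hom_inj2] hom_one[OF hom_copr])
    also have "\<dots> = ?j1 A"
      by (simp add: map_fps_comp tensor_assoc_tens flip: tens_one)
    finally show ?thesis .
  qed
  have R2: "?R (inj2 A) = ?J (copr A)" for A
    using fps_tensor_map_tens[OF id(1) t_linear_copr, of "1 :: 'l uea fps" A]
    by (simp add: fps_tens_inj(1) hom_one[OF hom_inj1] map_fps_comp)
  have J1: "?J (inj1 A) = ?j2 A" and J2: "?J (inj2 A) = ?j3 A" for A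
    by (simp_all add: map_fps_comp tensor_assoc_tens tens_one)
  have j1: "hom_ring ?j1" and j2: "hom_ring ?j2" and j3: "hom_ring ?j3"
    by (rule hom_ring_comp[OF hom_inj1 hom_inj1], rule hom_ring_comp[OF hom_inj1 hom_inj2], rule hom_inj2)
  have c23: "?j2 A * ?j3 B = ?j3 B * ?j2 A" and c13: "?j1 A * ?j3 B = ?j3 B * ?j1 A" for A B
    by (rule inj_commute)+
  have c12: "?j1 A * ?j2 B = ?j2 B * ?j1 A" for A B
    by (simp only: inj_commute flip: hom_mult[OF hom_inj1])
  have "?L (copr (fps_const (ugen x))) = ?R (copr (fps_const (ugen x)))" for x
  proof (induction x rule: wt_span)
    case (2 x y)
    then show ?case
      by (simp only: ugen_add fps_const_add[symmetric] hom_add[OF hom_copr] hom_add[OF L(1)] hom_add[OF R(1)])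
  next
    case (1 m x)
    let ?x = "fps_const (ugen x)" and ?h = "fps_const h\<^sub>U" and ?s = "\<lambda>l. fps_const (seq x l)"
    \<comment> \<open>The common double series of both sides: l counts falling factors in the first
      position, i those in the second.\<close>
    let ?T = "\<lambda>l i. of_nat (l + i choose i) * (falling (- ?j1 ?h) l * (?j2 (p (- int l)) * (falling (- ?j2 ?h) i * ?j3 (p (- int (l + i)) * ?s (l + i)))))"
    have "?L (copr ?x) = inj1 (copr ?x) * ?j3 (p m)
        + fps_series (\<lambda>l. falling (- inj1 (copr ?h)) l * ?j3 (p (- int l) * ?s l))"
      by (simp add: copr_wt[OF 1] homs[OF L(1)] t_linear_series[OF L(2)] L1 L2)
    also have "inj1 (copr ?x) * ?j3 (p m) = ?j1 ?x * ?j2 (p m) * ?j3 (p m)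
        + fps_series (\<lambda>l. falling (- ?j1 ?h) l * ?j2 (p (- int l) * ?s l) * ?j3 (p m))"
      by (simp add: copr_wt[OF 1] homs[OF hom_inj1] inj1_series distrib_right fps_series_mult_right)
    also have "fps_series (\<lambda>l. falling (- inj1 (copr ?h)) l * ?j3 (p (- int l) * ?s l))
        = fps_series (\<lambda>n. \<Sum>l\<le>n. ?T l (n - l))"
    proof (rule fps_series_cong)
      fix n
      have b: "borel_rel ((1 \<otimes> e\<^sub>U) \<otimes> 1) (?j2 ?h)"
        using borel unfolding borel_rel_def
        by (simp add: map_fps_tunit[OF hom_tens_left, symmetric] map_fps_tunit[OF hom_tens_right, symmetric]
            flip: homs[OF j2])
      have jp: "?j2 (p k) = tpow ((1 \<otimes> e\<^sub>U) \<otimes> 1) k" for k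
        by (simp add: map_fps_tpow[OF hom_tens_left] map_fps_tpow[OF hom_tens_right])
      have jt: "?j2 (tunit e\<^sub>U) = tunit ((1 \<otimes> e\<^sub>U) \<otimes> 1)"
        by (simp add: map_fps_tunit[OF hom_tens_left] map_fps_tunit[OF hom_tens_right])
      have "inj1 (copr ?h) = ?j1 ?h * ?j2 (p (- 1)) + ?j2 ?h"
        by (simp add: copr_h homs[OF hom_inj1])
      then have "falling (- inj1 (copr ?h)) n
          = (\<Sum>l\<le>n. of_nat (n choose l) * (falling (- ?j1 ?h) l * ?j2 (p (- int l)) * falling (- ?j2 ?h) (n - l)))"
        using falling_coproduct[OF b c12, of ?h n] c12[of ?h "tunit e\<^sub>U"] by (simp only: jp jt)
      then show "falling (- inj1 (copr ?h)) n * ?j3 (p (- int n) * ?s n) = (\<Sum>l\<le>n. ?T l (n - l))"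
        by (simp only: sum_distrib_right mult.assoc)
          (rule sum.cong[OF refl], simp add: binomial_symmetric[symmetric])
    qed
    finally have LHS: "?L (copr ?x) = ?j1 ?x * ?j2 (p m) * ?j3 (p m)
        + fps_series (\<lambda>l. falling (- ?j1 ?h) l * ?j2 (p (- int l) * ?s l) * ?j3 (p m))
        + fps_series (\<lambda>n. \<Sum>l\<le>n. ?T l (n - l))" .
    have R: "?R (copr ?x) = ?j1 ?x * ?J (copr (p m))
        + fps_series (\<lambda>l. falling (- ?j1 ?h) l * (?J (copr (p (- int l))) * ?J (copr (?s l))))"
      by (simp only: copr_wt[OF 1] homs[OF R(1)] t_linear_series[OF R(2)] R1 R2 hom_mult[OF hom_copr] hom_mult[OF J(1)])
    have Jp: "?J (copr (p k)) = ?j2 (p k) * ?j3 (p k)" for k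
      by (simp only: copr_p hom_mult[OF J(1)] J1 J2)
    \<comment> \<open>As D_l x has weight m + l, its coproduct carries u^(m+l) in the third
      position, and the factor u^(-l) there restores u^m.\<close>
    have s: "?j2 (p (- int l)) * ?j3 (p (- int l)) * ?J (copr (?s l))
        = ?j2 (p (- int l) * ?s l) * ?j3 (p m)
          + fps_series (\<lambda>i. of_nat (l + i choose i) * (?j2 (p (- int l)) * (falling (- ?j2 ?h) i * ?j3 (p (- int (l + i)) * ?s (l + i)))))" for l
    proof -
      have "?J (copr (?s l)) = ?j2 (?s l) * ?j3 (p (m + int l))
          + fps_series (\<lambda>i. falling (- ?j2 ?h) i * ?j3 (p (- int i) * fps_const (seq (D l x) i)))"
        unfolding seq_def[of x]
        by (simp only: copr_wt[OF wt_D[OF 1]] homs[OF J(1)] t_linear_series[OF J(2)] J1 J2)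
      then have "?j2 (p (- int l)) * ?j3 (p (- int l)) * ?J (copr (?s l))
          = ?j2 (p (- int l)) * (?j3 (p (- int l)) * (?j2 (?s l) * ?j3 (p (m + int l))))
          + fps_series (\<lambda>i. ?j2 (p (- int l)) * (?j3 (p (- int l)) * (falling (- ?j2 ?h) i * ?j3 (p (- int i) * fps_const (seq (D l x) i)))))"
        by (simp only: distrib_left fps_series_mult_left mult.assoc)
      also have "?j2 (p (- int l)) * (?j3 (p (- int l)) * (?j2 (?s l) * ?j3 (p (m + int l))))
          = ?j2 (p (- int l) * ?s l) * ?j3 (p (- int l) * p (m + int l))"
        by (simp only: hom_mult[OF j2] hom_mult[OF j3] mult_swap_assoc[OF c23[symmetric]] mult.assoc)
      also have "p (- int l) * p (m + int l) = p m"
        by (simp flip: tpow_add)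
      also have "(\<lambda>i. ?j2 (p (- int l)) * (?j3 (p (- int l)) * (falling (- ?j2 ?h) i * ?j3 (p (- int i) * fps_const (seq (D l x) i)))))
          = (\<lambda>i. of_nat (l + i choose i) * (?j2 (p (- int l)) * (falling (- ?j2 ?h) i * ?j3 (p (- int (l + i)) * ?s (l + i)))))"
      proof
        fix i
        have f: "?j3 (p (- int l)) * falling (- ?j2 ?h) i = falling (- ?j2 ?h) i * ?j3 (p (- int l))"
          by (rule falling_commute) (simp add: c23)
        have "fps_const (seq (D l x) i) = of_nat (l + i choose i) * ?s (l + i)"
          unfolding seq_D seq_shift_def by (simp add: hom_mult[OF hom_fps_const, symmetric] flip: fps_of_nat)
        then have "p (- int l) * (p (- int i) * fps_const (seq (D l x) i)) = of_nat (l + i choose i) * (p (- int (l + i)) * ?s (l + i))"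
          by (simp add: of_nat_mult_left flip: mult.assoc tpow_add) (simp add: of_nat_mult_left mult.assoc)
        then have "?j3 (p (- int l)) * ?j3 (p (- int i) * fps_const (seq (D l x) i))
            = of_nat (l + i choose i) * ?j3 (p (- int (l + i)) * ?s (l + i))"
          by (simp only: hom_mult[OF j3, symmetric]) (simp only: hom_mult[OF j3, of "of_nat _"] hom_of_nat[OF j3])
        then show "?j2 (p (- int l)) * (?j3 (p (- int l)) * (falling (- ?j2 ?h) i * ?j3 (p (- int i) * fps_const (seq (D l x) i))))
            = of_nat (l + i choose i) * (?j2 (p (- int l)) * (falling (- ?j2 ?h) i * ?j3 (p (- int (l + i)) * ?s (l + i))))"
          by (simp only: mult_swap_assoc[OF f] of_nat_mult_left)
      qed
      finally show ?thesis .
    qed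
    have "?R (copr ?x) = ?j1 ?x * ?j2 (p m) * ?j3 (p m)
        + fps_series (\<lambda>l. falling (- ?j1 ?h) l * ?j2 (p (- int l) * ?s l) * ?j3 (p m) + fps_series (?T l))"
      unfolding R Jp s by (simp only: distrib_left fps_series_mult_left of_nat_mult_left mult.assoc)
    also have "\<dots> = ?L (copr ?x)"
      unfolding LHS fps_series_add fps_series_nested by (simp only: add.assoc)
    finally show ?case ..
  qed
  then show ?thesis
    using hom_uea_fps_eqI[of "\<lambda>a. ?L (copr a)" "\<lambda>a. ?R (copr a)", OF hom_ring_comp[OF L(1) hom_copr]
        t_linear_comp[OF L(2) t_linear_copr] hom_ring_comp[OF R(1) hom_copr] t_linear_comp[OF R(2) t_linear_copr]]
    by blast
qed

subsection \<open>Counit\<close>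

definition counit_fps :: "'l uea fps \<Rightarrow> int fps" where "counit_fps = map_fps counit0"

lemma hom_counit_fps: "hom_ring counit_fps"
  unfolding counit_fps_def by (rule hom_map_fps[OF hom_counit0])

lemma t_linear_counit_fps: "t_linear counit_fps"
  unfolding counit_fps_def by (rule t_linear_map_fps) simp

abbreviation scalar_counit :: "'l uea fps \<Rightarrow> 'l uea fps" where
  "scalar_counit \<equiv> map_fps of_int \<circ> counit_fps"

lemma hom_scalar_counit: "hom_ring scalar_counit"
  unfolding comp_def by (rule hom_ring_comp[OF hom_of_int_fps hom_counit_fps])

lemma t_linear_scalar_counit: "t_linear scalar_counit"
  unfolding comp_def by (rule t_linear_comp[OF t_linear_of_int_fps t_linear_counit_fps])

lemma scalar_counit_const: "scalar_counit (fps_const (ugen x)) = 0"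
  by (rule fps_ext) (simp add: counit_fps_def map_fps_const)

lemma scalar_counit_p: "scalar_counit (p m) = 1"
proof -
  have "scalar_counit (tunit e\<^sub>U) = 1"
    using scalar_counit_const[of e]
    by (simp add: tunit_def hom_diff[OF hom_scalar_counit] hom_mult[OF hom_scalar_counit] hom_one[OF hom_scalar_counit] del: comp_apply)
  then show ?thesis
    by (simp add: hom_unit_powi[OF hom_scalar_counit is_unit_tunit] unit_powi_one del: comp_apply)
qed

lemma fps_conv_copr:
  assumes f: "t_linear f" and g: "t_linear g" and "wt m x"
  shows "fps_conv f g (copr (fps_const (ugen x))) = f (fps_const (ugen x)) * g (p m)
     + fps_series (\<lambda>l. f (falling (- fps_const h\<^sub>U) l) * g (p (- int l) * fps_const (seq x l)))"
proof -
  have "falling (- inj1 (fps_const h\<^sub>U) :: ('l uea, 'l uea) tensor fps) l = inj1 (falling (- fps_const h\<^sub>U) l)" for l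
    by (simp only: hom_falling[OF hom_inj1] hom_minus[OF hom_inj1])
  then show ?thesis
    by (simp only: copr_wt[OF assms(3)] t_linear_add[OF t_linear_fps_conv[OF f g]]
        t_linear_series[OF t_linear_fps_conv[OF f g]] fps_conv_tens[OF f g])
qed

text \<open>The counit kills h, so applied on the left it leaves only the term l = 0 of the series.
  Applied on the right it kills every D_l x and sends u^m to 1, leaving x.\<close>

lemma copr_counit:
  "fps_conv scalar_counit id (copr a) = a" "fps_conv id scalar_counit (copr a) = a"
proof -
  have id: "t_linear id" "hom_ring id" using t_linear_id hom_ring_id by (simp_all add: id_def)
  note e = t_linear_scalar_counit hom_scalar_counit
  have "hom_ring (fps_conv scalar_counit id)" "hom_ring (fps_conv id scalar_counit)"
    by (intro hom_fps_conv e id, simp add: of_int_fps_commute)+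
  note h = hom_ring_comp[OF this(1) hom_copr] hom_ring_comp[OF this(2) hom_copr]
  note l = t_linear_comp[OF t_linear_fps_conv[OF e(1) id(1)] t_linear_copr]
    t_linear_comp[OF t_linear_fps_conv[OF id(1) e(1)] t_linear_copr]
  have "fps_conv scalar_counit id (copr (fps_const (ugen x))) = fps_const (ugen x)" for x
  proof (induction x rule: wt_span)
    case (1 m x)
    have "scalar_counit (falling (- fps_const h\<^sub>U) l) = (if l = 0 then 1 else 0)" for l
      by (simp only: hom_falling[OF e(2)] hom_minus[OF e(2)] scalar_counit_const minus_zero falling_zero)
    then have "fps_conv scalar_counit id (copr (fps_const (ugen x)))
        = fps_series (\<lambda>l. (if l = 0 then 1 else 0) * (p (- int l) * fps_const (seq x l)))"
      using scalar_counit_const[of x] by (simp only: fps_conv_copr[OF e(1) id(1) 1] id_apply mult_zero_left add_0)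
    also have "\<dots> = fps_const (ugen x)"
      by (subst fps_series_single) (simp_all add: unit_powi_0 seq_0)
    finally show ?case .
  next
    case (2 x y)
    then show ?case by (simp only: ugen_add fps_const_add[symmetric] hom_add[OF h(1)])
  qed
  then show "fps_conv scalar_counit id (copr a) = a"
    by (rule hom_uea_fps_eqI[OF h(1) l(1) hom_ring_id t_linear_id])
  have "fps_conv id scalar_counit (copr (fps_const (ugen x))) = fps_const (ugen x)" for x
  proof (induction x rule: wt_span)
    case (1 m x)
    have "scalar_counit (p (- int l) * fps_const (seq x l)) = 0" for l
      using scalar_counit_const[of "D l x"] by (simp add: hom_mult[OF e(2)] seq_def del: comp_apply)
    then show ?case
      unfolding fps_conv_copr[OF id(1) e(1) 1]
      by (simp only: id_apply scalar_counit_p mult_zero_right fps_series_zero add_0_right mult_1_right)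
  next
    case (2 x y)
    then show ?case by (simp only: ugen_add fps_const_add[symmetric] hom_add[OF h(2)])
  qed
  then show "fps_conv id scalar_counit (copr a) = a"
    by (rule hom_uea_fps_eqI[OF h(2) l(2) hom_ring_id t_linear_id])
qed

end

context jordanian_pair
begin

subsection \<open>Antipode\<close>

text \<open>The integral form of w x w' with w' the inverse of w, for arbitrary x. The trailing
  factor u^(-m) is again expanded in e and distributed over the weights by
  \<open>scale\<close>.\<close>

definition anti_gen :: "'l \<Rightarrow> 'l uea fps" where
  "anti_gen x = fps_series (\<lambda>l. falling (fps_const h\<^sub>U) l
     * Abs_fps (\<lambda>n. seq (scale (\<lambda>m. tcoeff n (- m)) x) l * (- e\<^sub>U) ^ n))"

lemma anti_gen_add: "anti_gen (x + y) = anti_gen x + anti_gen y"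
proof -
  have "Abs_fps (\<lambda>n. seq (scale (\<lambda>m. tcoeff n (- m)) (x + y)) l * (- e\<^sub>U) ^ n)
      = Abs_fps (\<lambda>n. seq (scale (\<lambda>m. tcoeff n (- m)) x) l * (- e\<^sub>U) ^ n)
      + Abs_fps (\<lambda>n. seq (scale (\<lambda>m. tcoeff n (- m)) y) l * (- e\<^sub>U) ^ n)" for l
    by (rule fps_ext) (simp add: scale_add seq_add distrib_right)
  then show ?thesis by (simp add: anti_gen_def distrib_left fps_series_add)
qed

lemma anti_gen_wt:
  assumes "wt m x"
  shows "anti_gen x = weight_series (fps_const h\<^sub>U) 0 (seq x) * p (- m)"
proof -
  have "Abs_fps (\<lambda>n. seq (scale (\<lambda>m. tcoeff n (- m)) x) l * (- e\<^sub>U) ^ n) = fps_const (seq x l) * p (- m)" for l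
  proof (rule fps_ext)
    fix n
    have "seq (scale c x) l = seq x l * of_int (c m)" for c
      using wt_scale[OF assms, of l c] by (simp add: seq_def mult_of_int_commute)
    then show "fps_nth (Abs_fps (\<lambda>n. seq (scale (\<lambda>m. tcoeff n (- m)) x) l * (- e\<^sub>U) ^ n)) n
        = fps_nth (fps_const (seq x l) * p (- m)) n"
      by (simp add: tpow_nth mult.assoc)
  qed
  then show ?thesis
    by (simp add: anti_gen_def weight_series_def fps_series_mult_right mult.assoc)
qed

lemma p_weight_series: "p j * weight_series (fps_const h\<^sub>U) s (seq x) = weight_series (fps_const h\<^sub>U) (s + j) (seq x) * p j"
  by (rule weight_series_tpow[OF divided_seq borel])

text \<open>Moving u^(-m) past the second series shifts it to s = -m, the position at which
  \<open>weight_series_mult\<close> joins it to the first.\<close>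

lemma anti_gen_mult:
  assumes x: "wt m x" and y: "wt m' y"
  shows "anti_gen x * anti_gen y = weight_series (fps_const h\<^sub>U) 0 (seq_mult (seq x) (seq y)) * p (- (m + m'))"
proof -
  let ?w = "weight_series (fps_const h\<^sub>U)"
  have "anti_gen x * anti_gen y = ?w (- m + m) (seq x) * ?w (- m) (seq y) * (p (- m) * p (- m'))"
    using p_weight_series[of "- m" 0 y] by (simp only: anti_gen_wt[OF x] anti_gen_wt[OF y] mult.assoc mult_swap_assoc[of "p (- m)"]) simp
  also have "?w (- m + m) (seq x) * ?w (- m) (seq y) = ?w (- m + m) (seq_mult (seq x) (seq y))"
  proof (rule weight_series_mult)
    fix l
    show "fps_const (seq x l) * fps_const h\<^sub>U = (fps_const h\<^sub>U - of_int (m + int l)) * fps_const (seq x l)"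
      using arg_cong[OF wt_seq[OF x, of l], of fps_const] by (simp add: homs[OF hom_fps_const, symmetric] del: of_int_add)
  qed
  also have "p (- m) * p (- m') = p (- (m + m'))"
    by (simp flip: tpow_add)
  finally show ?thesis by simp
qed

lemma lie_map_anti_gen: "lie_map anti_gen"
  unfolding lie_map_def
proof (intro conjI allI)
  show "anti_gen (x + y) = anti_gen x + anti_gen y" for x y by (rule anti_gen_add)
  show "anti_gen (lie x y) = anti_gen x * anti_gen y - anti_gen y * anti_gen x" for x y
  proof (induction x rule: wt_span)
    case (1 m x)
    show ?case
    proof (induction y rule: wt_span)
      case (1 m' y)
      have "seq (lie x y) = (\<lambda>n. seq_mult (seq x) (seq y) n - seq_mult (seq y) (seq x) n)"
        by (rule ext) (rule seq_lie)
      then show ?case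
        unfolding anti_gen_mult[OF \<open>wt m x\<close> \<open>wt m' y\<close>] anti_gen_mult[OF \<open>wt m' y\<close> \<open>wt m x\<close>] anti_gen_wt[OF wt_lie[OF \<open>wt m x\<close> \<open>wt m' y\<close>]]
        by (simp add: weight_series_diff left_diff_distrib add.commute)
    next
      case (2 y z)
      show ?case by (simp only: lie_add_right anti_gen_add 2 distrib_left distrib_right) (simp add: algebra_simps)
    qed
  next
    case (2 x z)
    show ?case by (simp only: lie_add_left anti_gen_add 2 distrib_left distrib_right) (simp add: algebra_simps)
  qed
qed

definition anti_conj :: "'l uea \<Rightarrow> 'l uea fps" where
  "anti_conj = uea_lift anti_gen"

text \<open>The standard antipode followed by the integral form of conjugation by w. All
  denominators of w have disappeared from that conjugation.\<close>

definition antip :: "'l uea fps \<Rightarrow> 'l uea fps" where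
  "antip = fps_ext_map (\<lambda>a. anti_conj (antipode0 a))"

lemma hom_anti_conj: "hom_ring anti_conj"
  unfolding anti_conj_def by (rule hom_uea_lift[OF lie_map_anti_gen])

lemma anti_conj_ugen: "anti_conj (ugen x) = anti_gen x"
  unfolding anti_conj_def by (rule uea_lift_ugen[OF lie_map_anti_gen])

lemma t_linear_antip: "t_linear antip"
  unfolding antip_def by (rule t_linear_ext_map) (simp add: antipode0_add hom_add[OF hom_anti_conj])

lemma antip_mult: "antip (A * B) = antip B * antip A"
  unfolding antip_def
  by (rule antihom_ext_map) (simp_all add: antipode0_add antipode0_mult hom_add[OF hom_anti_conj] hom_mult[OF hom_anti_conj])

lemma antip_const: "antip (fps_const a) = anti_conj (antipode0 a)"
  unfolding antip_def by (rule fps_ext_map_const) (simp add: antipode0_add hom_add[OF hom_anti_conj])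

lemma antip_ugen: "antip (fps_const (ugen x)) = - anti_gen x"
  by (simp add: antip_const antipode0_simps hom_minus[OF hom_anti_conj] anti_conj_ugen)

lemma antip_one: "antip 1 = 1"
  using antip_const[of 1] by (simp add: antipode0_simps hom_one[OF hom_anti_conj])

lemma weight_series_0: "weight_series (fps_const h\<^sub>U) 0 (seq e) = fps_const e\<^sub>U"
  "weight_series (fps_const h\<^sub>U) 0 (seq h) = fps_const h\<^sub>U * tunit e\<^sub>U"
proof -
  show "weight_series (fps_const h\<^sub>U) 0 (seq e) = fps_const e\<^sub>U"
    unfolding weight_series_def by (subst fps_series_single) (simp_all add: seq_def D_0 D_e)
  have "weight_series (fps_const h\<^sub>U) 0 (seq h) = fps_const h\<^sub>U - fps_X * (fps_const h\<^sub>U * fps_const e\<^sub>U)"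
    unfolding weight_series_def
    by (subst fps_series_Suc, subst fps_series_Suc) (simp add: seq_def D_0 D_h ugen_minus fps_series_zero flip: fps_const_neg)
  then show "weight_series (fps_const h\<^sub>U) 0 (seq h) = fps_const h\<^sub>U * tunit e\<^sub>U"
    by (simp only: tunit_def right_diff_distrib mult_1_right mult.assoc[symmetric] fps_X_commute)
qed

lemma antip_h: "antip (fps_const h\<^sub>U) = - (fps_const h\<^sub>U * tunit e\<^sub>U)"
  by (simp add: antip_ugen anti_gen_wt[OF wt_h] unit_powi_0 weight_series_0)

text \<open>The antipode sends -h to h u. It also reverses the order of the factors, which is
  harmless because they are all polynomials in h u.\<close>

lemma antip_falling: "antip (falling (- fps_const h\<^sub>U) l) = falling (fps_const h\<^sub>U) l * p (int l)"
proof -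
  have "antip (falling (- fps_const h\<^sub>U) l) = falling (fps_const h\<^sub>U * tunit e\<^sub>U) l"
  proof (induction l)
    case (Suc l)
    have "antip (of_nat l) = of_nat l"
      by (induction l) (simp_all add: t_linear_zero[OF t_linear_antip] t_linear_add[OF t_linear_antip] antip_one)
    then show ?case
      unfolding falling.simps(2)[of "- fps_const h\<^sub>U"] antip_mult Suc falling_Suc_right
      by (simp only: t_linear_diff[OF t_linear_antip] t_linear_minus[OF t_linear_antip] antip_h minus_minus)
        (simp only: falling.simps(2)[symmetric] falling_Suc_right[symmetric])
  qed (simp add: antip_one)
  then show ?thesis by (simp only: falling_mult_tunit[OF borel])
qed

text \<open>The group-like u goes to its inverse: the antipode of e is -u^(-1) e, and 1 + t u^(-1) e
  = u^(-1). The other powers follow by cancelling u.\<close>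

lemma antip_p: "antip (p m) = p (- m)"
proof -
  have "antip (tunit e\<^sub>U) = 1 - fps_X * antip (fps_const e\<^sub>U)"
    by (simp only: tunit_def fps_X_commute t_linear_diff[OF t_linear_antip] antip_one t_linear_X[OF t_linear_antip])
  also have "antip (fps_const e\<^sub>U) = - (p (- 1) * fps_const e\<^sub>U)"
    by (simp add: antip_ugen anti_gen_wt[OF wt_e] weight_series_0 tpow_commute_const)
  finally have u: "antip (tunit e\<^sub>U) = p (- 1)"
    by (simp add: p_minus_one)
  have "antip (p (- m)) * tunit e\<^sub>U = antip (p (- (m + 1)))" for m
  proof -
    have "antip (p (- m)) = antip (p (- (m + 1))) * p (- 1)"
      using unit_powi_Suc(1)[OF is_unit_tunit, of e\<^sub>U "- (m + 1)"] by (simp add: antip_mult u)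
    then show ?thesis
      using unit_powi_Suc(2)[OF is_unit_tunit, of e\<^sub>U "- 1"] by (simp add: mult.assoc unit_powi_0)
  qed
  from unit_powi_intertwine[OF is_unit_tunit, of "\<lambda>m. antip (p (- m))" e\<^sub>U 0 "- m", OF this]
  show ?thesis by (simp add: unit_powi_0 antip_one)
qed

text \<open>Moving u^(-m) to the front replaces h by h - m. Moving the falling factorial to the
  right past D_l x, of weight m + l, then replaces h - m by h + l, and l factors down from there
  form the shifted rising factorial.\<close>

lemma antip_wt:
  assumes "wt m x"
  shows "antip (fps_const (ugen x)) = - (p (- m) * fps_series (\<lambda>l. fps_const (seq x l * rising 1 h\<^sub>U l)))"
proof -
  have "seq x l * rising 1 h\<^sub>U l = falling (h\<^sub>U - of_int m) l * seq x l" for l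
    unfolding rising_one
    by (rule falling_intertwine) (simp add: distrib_left wt_seq[OF assms] left_diff_distrib distrib_right mult_of_int_commute mult_of_nat_commute)
  then have "weight_series (fps_const h\<^sub>U) m (seq x) = fps_series (\<lambda>l. fps_const (seq x l * rising 1 h\<^sub>U l))"
    by (simp add: weight_series_def hom_falling[OF hom_fps_const] hom_diff[OF hom_fps_const] hom_of_int[OF hom_fps_const]
        flip: fps_const_mult)
  then show ?thesis
    using p_weight_series[of "- m" m x] by (simp add: antip_ugen anti_gen_wt[OF assms])
qed

text \<open>With the antipode on the left, the images of the falling factorials carry u^l, which
  meets u^(-l), so the series becomes the weight series and cancels the leading term. With it on the
  right, the series collapses to -x u^(-m) by the inversion
  \<open>weight_series_conj_falling\<close>.\<close>

lemma fps_conv_antip_gen: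
  "fps_conv antip id (copr (fps_const (ugen x))) = 0" "fps_conv id antip (copr (fps_const (ugen x))) = 0"
proof -
  have id: "t_linear id" using t_linear_id by (simp add: id_def)
  note S = t_linear_antip
  note l1 = t_linear_comp[OF t_linear_fps_conv[OF S id] t_linear_copr]
    and l2 = t_linear_comp[OF t_linear_fps_conv[OF id S] t_linear_copr]
  let ?h = "fps_const h\<^sub>U"
  show "fps_conv antip id (copr (fps_const (ugen x))) = 0"
  proof (induction x rule: wt_span)
    case (1 m x)
    have "fps_series (\<lambda>l. antip (falling (- ?h) l) * (p (- int l) * fps_const (seq x l))) = weight_series ?h 0 (seq x)"
      unfolding weight_series_def antip_falling
    proof (rule fps_series_cong)
      fix l
      have "p (int l) * p (- int l) = 1" by (simp add: unit_powi_0 flip: tpow_add)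
      then show "falling ?h l * p (int l) * (p (- int l) * fps_const (seq x l)) = falling (?h - of_int 0) l * fps_const (seq x l)"
        by (simp add: mult.assoc mult_swap_assoc[of "p (int l)" "p (- int l)" 1 1])
    qed
    moreover have "anti_gen x * p m = weight_series ?h 0 (seq x)"
      by (simp add: anti_gen_wt[OF 1] mult.assoc unit_powi_0 flip: tpow_add)
    ultimately show ?case
      unfolding fps_conv_copr[OF S id 1] by (simp add: antip_ugen)
  next
    case (2 x y)
    then show ?case by (simp only: ugen_add fps_const_add[symmetric] t_linear_add[OF l1] add_0)
  qed
  show "fps_conv id antip (copr (fps_const (ugen x))) = 0"
  proof (induction x rule: wt_span)
    case (1 m x)
    have a: "antip (p (- int l) * fps_const (seq x l)) = - (weight_series ?h 0 (seq_shift l (seq x)) * p (- m))" for l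
    proof -
      have "antip (p (- int l) * fps_const (seq x l)) = - (weight_series ?h 0 (seq (D l x)) * (p (- (m + int l)) * p (int l)))"
        unfolding seq_def[of x] by (simp add: antip_mult antip_p antip_ugen anti_gen_wt[OF wt_D[OF 1]] mult.assoc)
      then show ?thesis by (simp add: seq_D flip: tpow_add)
    qed
    have "fps_series (\<lambda>l. falling (- ?h) l * antip (p (- int l) * fps_const (seq x l)))
        = - (fps_series (\<lambda>l. falling (- ?h) l * weight_series ?h 0 (seq_shift l (seq x))) * p (- m))"
      unfolding a by (simp add: fps_series_mult_right fps_series_minus mult.assoc)
    also have "\<dots> = - (fps_const (ugen x) * p (- m))"
      by (simp only: weight_series_conj_falling seq_0)
    finally show ?case
      unfolding fps_conv_copr[OF id S 1] by (simp add: antip_p)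
  next
    case (2 x y)
    then show ?case by (simp only: ugen_add fps_const_add[symmetric] t_linear_add[OF l2] add_0)
  qed
qed

text \<open>The induction over U(L) passes products because the inductive values are integers, hence
  central, as the two lemmas on convolutions require.\<close>

lemma copr_antipode:
  "fps_conv antip id (copr a) = scalar_counit a" "fps_conv id antip (copr a) = scalar_counit a"
proof -
  define i :: "'l uea fps \<Rightarrow> 'l uea fps" where "i = id"
  have id: "t_linear i" using t_linear_id by (simp add: i_def id_def)
  have i: "i A = A" for A by (simp add: i_def)
  note S = t_linear_antip
  have of_int_const: "scalar_counit (fps_const b) = of_int (counit0 b)" for b
    by (simp add: counit_fps_def map_fps_const fps_of_int)
  have copr_simps: "copr (fps_const (b + c)) = copr (fps_const b) + copr (fps_const c)"
    "copr (fps_const (- b)) = - copr (fps_const b)" "copr (fps_const (b * c)) = copr (fps_const b) * copr (fps_const c)"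
    "copr (fps_const 0) = 0" "copr (fps_const 1) = 1" for b c
    by (simp_all add: copr_const homs[OF hom_copr_uea] hom_zero[OF hom_copr] hom_one[OF hom_copr])
  have c_minus: "counit0 (- b) = - counit0 b" for b :: "'l uea"
    by (rule hom_minus[OF hom_counit0])
  have one: "fps_conv antip i 1 = 1" "fps_conv i antip 1 = 1"
    using fps_conv_tens[OF S id, of 1 1] fps_conv_tens[OF id S, of 1 1]
    by (simp_all add: hom_one[OF hom_inj1] hom_one[OF hom_inj2] antip_one i)
  have "fps_conv antip i (copr (fps_const b)) = of_int (counit0 b)" for b
  proof (induction b rule: uea_induct)
    case (mult a b)
    have "fps_conv antip i (copr (fps_const a) * copr (fps_const b))
        = fps_conv antip i (copr (fps_const a)) * fps_conv antip i (copr (fps_const b))"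
      by (rule fps_conv_central_antihom_left[OF S id]) (simp_all add: antip_mult i mult mult_of_int_commute)
    then show ?case by (simp only: copr_simps mult counit0_simps of_int_mult)
  qed (simp_all add: copr_simps one fps_conv_antip_gen[folded i_def] hom_zero[OF hom_copr] hom_one[OF hom_copr] c_minus t_linear_add[OF t_linear_fps_conv[OF S id]]
      t_linear_minus[OF t_linear_fps_conv[OF S id]] t_linear_zero[OF t_linear_fps_conv[OF S id]])
  note eq = this
  show "fps_conv antip id (copr a) = scalar_counit a"
    unfolding i_def[symmetric]
    by (rule t_linear_eqI[where f = "\<lambda>a. fps_conv antip i (copr a)", OF t_linear_comp[OF t_linear_fps_conv[OF S id] t_linear_copr] t_linear_scalar_counit])
      (simp only: eq of_int_const)
  have "fps_conv i antip (copr (fps_const b)) = of_int (counit0 b)" for b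
  proof (induction b rule: uea_induct)
    case (mult a b)
    have "fps_conv i antip (copr (fps_const a) * copr (fps_const b))
        = fps_conv i antip (copr (fps_const a)) * fps_conv i antip (copr (fps_const b))"
      by (rule fps_conv_central_antihom_right[OF id S]) (simp_all add: antip_mult i mult mult_of_int_commute)
    then show ?case by (simp only: copr_simps mult counit0_simps of_int_mult)
  qed (simp_all add: copr_simps one fps_conv_antip_gen[folded i_def] hom_zero[OF hom_copr] hom_one[OF hom_copr] c_minus t_linear_add[OF t_linear_fps_conv[OF id S]]
      t_linear_minus[OF t_linear_fps_conv[OF id S]] t_linear_zero[OF t_linear_fps_conv[OF id S]])
  note eq = this
  show "fps_conv id antip (copr a) = scalar_counit a"
    unfolding i_def[symmetric]
    by (rule t_linear_eqI[where f = "\<lambda>a. fps_conv i antip (copr a)", OF t_linear_comp[OF t_linear_fps_conv[OF id S] t_linear_copr] t_linear_scalar_counit])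
      (simp only: eq of_int_const)
qed

lemma hopf_copr: "hopf_fps copr counit_fps antip"
  unfolding hopf_fps_def
  using hom_copr t_linear_copr hom_counit_fps t_linear_counit_fps t_linear_antip copr_coassoc copr_counit copr_antipode
  unfolding fps_conv_def by simp

end

section \<open>Comparison with conjugation by the twist and by w\<close>

lemma fps_conj_closed:
  fixes f g :: "'l::lie_ring uea fps \<Rightarrow> 'b::ring_1 fps"
  assumes f: "hom_ring f" "t_linear f" and g: "hom_ring g" "t_linear g"
    and gen: "\<And>x. f (fps_const (ugen x)) * F = F * g (fps_const (ugen x))"
  shows "f A * F = F * g A"
proof (rule t_linear_eqI[where f = "\<lambda>A. f A * F"])
  show "t_linear (\<lambda>A. f A * F)" by (rule t_linear_times_right[OF f(2)])
  show "t_linear (\<lambda>A. F * g A)" by (rule t_linear_times_left[OF g(2)])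
  fix a
  note F = homs[OF hom_ring_comp[OF f(1) hom_fps_const]] and G = homs[OF hom_ring_comp[OF g(1) hom_fps_const]]
  show "f (fps_const a) * F = F * g (fps_const a)"
  proof (induction a rule: uea_induct)
    case (mult a b)
    have "f (fps_const (a * b)) * F = f (fps_const a) * (F * g (fps_const b))"
      by (simp only: F mult.assoc mult(2))
    also have "\<dots> = F * g (fps_const (a * b))"
      by (simp only: G mult.assoc[symmetric] mult(1))
    finally show ?case .
  qed (simp_all only: F G gen distrib_left distrib_right mult_zero_left mult_zero_right mult_1_left mult_1_right
      mult_minus_left mult_minus_right)
qed

context jordanian_pair
begin

abbreviation "H\<^sub>q \<equiv> (1 :: rat) \<otimes> (h\<^sub>U \<otimes> (1 :: 'l uea))"
abbreviation "e\<^sub>q \<equiv> (1 :: rat) \<otimes> ((1 :: 'l uea) \<otimes> e\<^sub>U)"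

lemma drinfeld_twist: "drinfeld_twist (twist_elt h e)"
  unfolding drinfeld_twist_def
proof (intro conjI)
  let ?F = "rat_ext.twist_series H\<^sub>q e\<^sub>q 0"
  note F = twist_elt_series
  have he': "e\<^sub>U + e\<^sub>U * h\<^sub>U = h\<^sub>U * e\<^sub>U" using he by (simp add: algebra_simps)
  show "is_unit_elt (twist_elt h e)"
    unfolding F by (rule rat_ext.is_unit_twist_series)
  have id: "hom_ring (id :: 'l uea \<Rightarrow> 'l uea)" by (simp add: hom_ring_def)
  note c1 = hom_tensor_map[OF hom_comult0 id] and c2 = hom_tensor_map[OF id hom_comult0]
  have t1: "tensor_map comult0 id (a \<otimes> b) = comult0 a \<otimes> b" and t2: "tensor_map id comult0 (a \<otimes> b) = a \<otimes> comult0 b"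
    for a b :: "'l uea"
    by (simp_all add: tensor_map_add hom_add[OF hom_comult0])
  show "map_fps (rat_map (\<lambda>z. z \<otimes> 1)) (twist_elt h e) * map_fps (rat_map (tensor_map comult0 id)) (twist_elt h e)
     = map_fps (rat_map tensor_assoc)
         (map_fps (rat_map (\<lambda>z. 1 \<otimes> z)) (twist_elt h e) * map_fps (rat_map (tensor_map id comult0)) (twist_elt h e))"
  proof -
    let ?G = "\<lambda>H e :: (('l uea, 'l uea) tensor, 'l uea) tensor. rat_ext.twist_series (1 \<otimes> H) (1 \<otimes> e) 0"
    \<comment> \<open>Subscripts are tensor positions. The standard coproduct of h gives h1 + h2,
      that of e gives e2 + e3, so the cocycle condition becomes an identity of formal powers in the
      cube.\<close>
    let ?h1 = "(h\<^sub>U \<otimes> 1) \<otimes> 1" and ?h2 = "(1 \<otimes> h\<^sub>U) \<otimes> 1" and ?e2 = "(1 \<otimes> e\<^sub>U) \<otimes> 1" and ?e3 = "1 \<otimes> e\<^sub>U"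
    have as: "tensor_assoc (a \<otimes> 1) = (a \<otimes> (1 :: 'l uea)) \<otimes> (1 :: 'l uea)" for a :: "'l uea"
      using tensor_assoc_tens[of a "1 :: 'l uea" "1 :: 'l uea"] by (simp add: tens_one)
    have l1: "map_fps (rat_map (\<lambda>z. z \<otimes> 1)) ?F = ?G ?h1 ?e2"
      by (rule map_rat_map_twist_series[OF hom_tens_left])
    have l2: "map_fps (rat_map (tensor_map comult0 id)) ?F = ?G (?h1 + ?h2) ?e3"
      by (simp only: map_rat_map_twist_series[OF c1] t1 comult0_ugen hom_one[OF hom_comult0] tens_add_left)
    have r1: "map_fps (rat_map tensor_assoc) (map_fps (rat_map (\<lambda>z. 1 \<otimes> z)) ?F) = ?G ?h2 ?e3"
      by (simp only: map_rat_map_twist_series[OF hom_tens_right] map_rat_map_twist_series[OF hom_tensor_assoc]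
          tensor_assoc_tens tens_one)
    have r2: "map_fps (rat_map tensor_assoc) (map_fps (rat_map (tensor_map id comult0)) ?F) = ?G ?h1 (?e2 + ?e3)"
      by (simp only: map_rat_map_twist_series[OF c2] map_rat_map_twist_series[OF hom_tensor_assoc] t2)
        (simp only: comult0_ugen hom_one[OF hom_comult0] as tens_add_right tensor_assoc_add tensor_assoc_tens tens_one)
    have "?G ?h1 ?e2 * ?G (?h1 + ?h2) ?e3 = ?G ?h2 ?e3 * ?G ?h1 (?e2 + ?e3)"
      unfolding tens_add_right[of "1 :: rat"]
      by (rule rat_ext.twist_equation) (simp_all add: tens_mult he flip: tens_diff)
    then show ?thesis
      by (simp only: F hom_mult[OF hom_map_fps[OF hom_rat_map[OF hom_tensor_assoc]]] l1 l2 r1 r2)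
  qed
  have e1: "hom_ring (\<lambda>a. of_int (counit0 a) :: 'l uea)"
    by (rule hom_ringI) simp_all
  have c1: "hom_ring (tensor_lift (\<lambda>(a :: 'l uea) (b :: 'l uea). of_int (counit0 a) * b))"
    by (rule hom_tensor_lift[OF e1 hom_ring_id]) (rule mult_of_int_commute)
  have c2: "hom_ring (tensor_lift (\<lambda>(a :: 'l uea) (b :: 'l uea). a * of_int (counit0 b)))"
    by (rule hom_tensor_lift[OF hom_ring_id e1]) (rule mult_of_int_commute[symmetric])
  show "map_fps (rat_map (tensor_lift (\<lambda>a b. of_int (counit0 a) * b))) (twist_elt h e) = 1"
    unfolding F map_rat_map_twist_series[OF c1] by (simp add: tensor_lift_mult_tens[OF e1 hom_ring_id] rat_ext.twist_series_0)
  show "map_fps (rat_map (tensor_lift (\<lambda>a b. a * of_int (counit0 b)))) (twist_elt h e) = 1"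
    unfolding F map_rat_map_twist_series[OF c2] by (simp add: tensor_lift_mult_tens[OF hom_ring_id e1] rat_ext.twist_series_0)
qed

text \<open>The twist intertwines x \<otimes> 1 with the left part, by the weight of x, and 1
  \<otimes> x with the right part, by inverting falling factorials. Their sum is the claim on
  generators.\<close>

lemma copr_twist: "rat_emb (copr a) * twist_elt h e = twist_elt h e * rat_emb (map_fps comult0 a)"
  unfolding rat_emb_inj2 twist_elt_series
proof (rule fps_conj_closed[where f = "\<lambda>a. inj2 (copr a)" and g = "\<lambda>a. inj2 (map_fps comult0 a)"])
  let ?F = "rat_ext.twist_series H\<^sub>q e\<^sub>q 0"
  show "hom_ring (\<lambda>a. inj2 (copr a))" by (rule hom_ring_comp[OF hom_inj2 hom_copr])
  show "t_linear (\<lambda>a. inj2 (copr a))" by (rule t_linear_comp[OF t_linear_inj2 t_linear_copr])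
  show "hom_ring (\<lambda>a. inj2 (map_fps comult0 a))" by (rule hom_ring_comp[OF hom_inj2 hom_map_fps[OF hom_comult0]])
  show "t_linear (\<lambda>a. inj2 (map_fps comult0 a))"
    by (rule t_linear_comp[OF t_linear_inj2 t_linear_map_fps]) (rule hom_add[OF hom_comult0])
  fix x
  have right: "inj2 (copr_right x) * ?F = ?F * fps_const (1 \<otimes> (1 \<otimes> ugen x))"
  proof -
    have "inj2 (copr_right x) = conj_series e\<^sub>q (fps_const H\<^sub>q) (\<lambda>l. 1 \<otimes> (1 \<otimes> seq x l))"
      unfolding copr_right_def by (simp add: map_fps_conj_series[OF hom_tens_right] map_fps_const)
    then show ?thesis
      using rat_ext.conj_series_twist[OF divided_seq_hom[OF hom_tens_right divided_seq2, of x], of H\<^sub>q]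
      by (simp add: tens_mult seq_0)
  qed
  have left: "inj2 (copr_left x) * ?F = ?F * fps_const (1 \<otimes> (ugen x \<otimes> 1))" for x
  proof (induction x rule: wt_span)
    case (1 m x)
    have "inj2 (copr_left x) = fps_const (1 \<otimes> (ugen x \<otimes> 1)) * tpow e\<^sub>q m"
      by (simp add: copr_left_wt[OF 1] hom_mult[OF hom_inj2] map_fps_const map_fps_tpow[OF hom_tens_right])
    moreover have "?F * fps_const (1 \<otimes> (ugen x \<otimes> 1)) = fps_const (1 \<otimes> (ugen x \<otimes> 1)) * tpow e\<^sub>q m * ?F"
    proof (rule rat_ext.twist_series_weight)
      have "h\<^sub>U * ugen x = ugen x * (h\<^sub>U + of_int m)"
        using wt_commute[OF 1] by (simp add: algebra_simps mult_of_int_commute)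
      then have "H\<^sub>q * (1 \<otimes> (ugen x \<otimes> 1)) = (1 :: rat) \<otimes> ((ugen x * (h\<^sub>U + of_int m)) \<otimes> (1 :: 'l uea))"
        by (simp add: tens_mult)
      also have "\<dots> = 1 \<otimes> (ugen x \<otimes> 1) * (H\<^sub>q + of_int m)"
        by (simp only: homs[OF hom_tens_left] homs[OF hom_tens_right])
      finally show "H\<^sub>q * (1 \<otimes> (ugen x \<otimes> 1)) = 1 \<otimes> (ugen x \<otimes> 1) * (H\<^sub>q + of_int m)" .
    qed (simp_all add: tens_mult)
    ultimately show ?case by simp
  next
    case (2 x y)
    then show ?case
      by (simp add: copr_left_add hom_add[OF hom_inj2] ugen_add tens_add_left tens_add_right distrib_left distrib_right
          flip: fps_const_add)
  qed
  show "inj2 (copr (fps_const (ugen x))) * ?F = ?F * inj2 (map_fps comult0 (fps_const (ugen x)))"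
    using left[of x] right
    by (simp add: copr_ugen hom_add[OF hom_inj2] distrib_left distrib_right map_fps_const hom_zero[OF hom_comult0]
        comult0_ugen tens_add_right flip: fps_const_add)
qed

text \<open>The antipode reverses products, so the extension from generators is carried out for the
  homomorphism \<open>anti_conj\<close>; the standard antipode is inserted afterwards.\<close>

lemma antip_twist:
  "rat_emb (antip a) * twist_w (twist_elt h e) = twist_w (twist_elt h e) * rat_emb (map_fps antipode0 a)"
proof -
  let ?h = "(1 :: rat) \<otimes> h\<^sub>U" and ?e = "(1 :: rat) \<otimes> e\<^sub>U"
  let ?w = "rat_ext.antipode_series ?h ?e 0"
  have "inj2 (fps_ext_map anti_conj a) * ?w = ?w * inj2 a" for a
  proof (rule fps_conj_closed[where f = "\<lambda>a. inj2 (fps_ext_map anti_conj a)" and g = inj2])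
    show "hom_ring (\<lambda>a. inj2 (fps_ext_map anti_conj a))"
      by (rule hom_ring_comp[OF hom_inj2 hom_ext_map[OF hom_anti_conj]])
    show "t_linear (\<lambda>a. inj2 (fps_ext_map anti_conj a))"
      by (rule t_linear_comp[OF t_linear_inj2 t_linear_ext_map]) (rule hom_add[OF hom_anti_conj])
    fix x
    have "inj2 (anti_gen x) * ?w = ?w * fps_const (1 \<otimes> ugen x)" for x
    proof (induction x rule: wt_span)
      case (1 m x)
      have "inj2 (anti_gen x) = weight_series (fps_const ?h) 0 (\<lambda>l. 1 \<otimes> seq x l) * tpow ?e (- m)"
        by (simp add: anti_gen_wt[OF 1] weight_series_def hom_mult[OF hom_inj2] inj2_series hom_falling[OF hom_inj2]
            map_fps_const map_fps_tpow[OF hom_tens_right])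
      moreover have "?w * fps_const (1 \<otimes> seq x 0) = weight_series (fps_const ?h) 0 (\<lambda>l. 1 \<otimes> seq x l) * tpow ?e (- m) * ?w"
      proof (rule rat_ext.antipode_series_weight)
        show "divided_seq ?e (\<lambda>l. 1 \<otimes> seq x l)" by (rule divided_seq_hom[OF hom_tens_right divided_seq])
        show "1 \<otimes> seq x l * ?h = (?h - of_int (m + int l)) * 1 \<otimes> seq x l" for l
          by (simp only: homs[OF hom_tens_right, symmetric] wt_seq[OF 1])
        show "?h * ?e - ?e * ?h = ?e" by (simp only: homs[OF hom_tens_right, symmetric] he)
      qed
      ultimately show ?case by (simp add: seq_0)
    next
      case (2 x y)
      then show ?case
        by (simp add: anti_gen_add hom_add[OF hom_inj2] ugen_add tens_add_right distrib_left distrib_right flip: fps_const_add)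
    qed
    then show "inj2 (fps_ext_map anti_conj (fps_const (ugen x))) * ?w = ?w * inj2 (fps_const (ugen x))"
      by (simp add: fps_ext_map_const[of anti_conj, OF hom_add[OF hom_anti_conj]] anti_conj_ugen map_fps_const)
  qed (rule hom_inj2, rule t_linear_inj2)
  note conj = this
  have "antip a = fps_ext_map anti_conj (map_fps antipode0 a)"
    by (simp add: antip_def fps_ext_map_def)
  then show ?thesis
    unfolding twist_w_series rat_emb_inj2 using conj[of "map_fps antipode0 a"] by simp
qed

lemma copr_nth_0: "fps_nth (copr a) 0 = comult0 (fps_nth a 0)"
proof -
  have "fps_nth (copr_uea b) 0 = comult0 b" for b
  proof (rule hom_uea_eqI[OF hom_ring_comp[OF hom_fps_nth_0 hom_copr_uea] hom_comult0])
    show "fps_nth (copr_uea (ugen x)) 0 = comult0 (ugen x)" for x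
    proof (induction x rule: wt_span)
      case (1 m x)
      show ?case
        using copr_wt[OF 1] by (simp add: copr_const comult0_ugen fps_series_nth_0 tpow_nth_0 tens_one seq_0)
    next
      case (2 x y)
      then show ?case by (simp add: ugen_add hom_add[OF hom_copr_uea] hom_add[OF hom_comult0])
    qed
  qed
  then show ?thesis by (simp add: copr_def fps_ext_map_def fps_series_nth_0)
qed

lemma antip_nth_0: "fps_nth (antip a) 0 = antipode0 (fps_nth a 0)"
proof -
  have "fps_nth (anti_conj b) 0 = b" for b
  proof (rule hom_uea_eqI[OF hom_ring_comp[OF hom_fps_nth_0 hom_anti_conj] hom_ring_id])
    show "fps_nth (anti_conj (ugen x)) 0 = ugen x" for x
    proof (induction x rule: wt_span)
      case (1 m x)
      show ?case
        by (simp add: anti_conj_ugen anti_gen_wt[OF 1] tpow_nth_0 weight_series_def fps_series_nth_0 seq_0)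
    next
      case (2 x y)
      then show ?case by (simp add: ugen_add hom_add[OF hom_anti_conj])
    qed
  qed
  then show ?thesis by (simp add: antip_def fps_ext_map_def fps_series_nth_0)
qed

lemma quantization: "twist_quantization (twist_elt h e) copr counit_fps antip"
proof -
  have F: "is_unit_elt (twist_elt h e)" using drinfeld_twist by (simp add: drinfeld_twist_def)
  have w: "is_unit_elt (twist_w (twist_elt h e))"
    unfolding twist_w_series by (rule rat_ext.is_unit_antipode_series)
  show ?thesis
    unfolding twist_quantization_def
    using drinfeld_twist w hopf_copr unit_conj[OF F copr_twist] unit_conj[OF w antip_twist] copr_nth_0 antip_nth_0
    by (simp add: counit_fps_def)
qed

end

section \<open>Divided powers of \<open>ad e\<close> on the Lie ring\<close>

definition wext :: "(int ^ 'n::finite \<Rightarrow> int ^ 'n \<Rightarrow> 'b::ab_group_add) \<Rightarrow> 'n wvec \<Rightarrow> 'b" where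
  "wext \<phi> f = (\<Sum>\<alpha>\<in>Poly_Mapping.keys f. \<phi> \<alpha> (Poly_Mapping.lookup f \<alpha>))"

context
  fixes \<phi> :: "int ^ 'n::finite \<Rightarrow> int ^ 'n \<Rightarrow> 'b::ab_group_add"
  assumes \<phi>: "\<And>\<alpha> d d'. \<phi> \<alpha> (d + d') = \<phi> \<alpha> d + \<phi> \<alpha> d'"
begin

lemma wext_superset:
  assumes "finite A" "Poly_Mapping.keys f \<subseteq> A"
  shows "wext \<phi> f = (\<Sum>\<alpha>\<in>A. \<phi> \<alpha> (Poly_Mapping.lookup f \<alpha>))"
  unfolding wext_def
  by (rule sum.mono_neutral_left) (use assms additive_zero[of "\<phi> _", OF \<phi>] in \<open>auto simp: in_keys_iff\<close>)

lemma wext_add: "wext \<phi> (f + g) = wext \<phi> f + wext \<phi> g"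
proof -
  let ?A = "Poly_Mapping.keys f \<union> Poly_Mapping.keys g"
  have "Poly_Mapping.keys (f + g) \<subseteq> ?A" by (rule Poly_Mapping.keys_add)
  then show ?thesis
    by (simp add: wext_superset[of ?A] lookup_add \<phi> sum.distrib)
qed

lemma wext_xd: "wext \<phi> (xd \<alpha> d) = \<phi> \<alpha> d"
  using wext_superset[of "{\<alpha>}" "xd \<alpha> d"] by (simp add: xd_def)

end

lemma xd_add: "xd \<alpha> (d + d') = xd \<alpha> d + xd \<alpha> d'"
  by (simp add: xd_def single_add)

lemma xd_zero [simp]: "xd \<alpha> 0 = 0"
  by (simp add: xd_def)

lemma additive_wvec_eqI:
  fixes F G :: "'n::finite wvec \<Rightarrow> 'b::ab_group_add"
  assumes F: "\<And>f g. F (f + g) = F f + F g" and G: "\<And>f g. G (f + g) = G f + G g"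
    and "\<And>\<alpha> d. F (xd \<alpha> d) = G (xd \<alpha> d)"
  shows "F f = G f"
  by (induction f rule: wvec_induct) (simp_all add: assms additive_zero[of F, OF F] additive_zero[of G, OF G])

lemma lookup_xd: "Poly_Mapping.lookup (xd \<alpha> d) \<beta> = (if \<alpha> = \<beta> then d else 0)"
  by (simp add: xd_def lookup_single when_def)

definition wscale :: "(int ^ 'n::finite \<Rightarrow> int) \<Rightarrow> 'n wvec \<Rightarrow> 'n wvec" where
  "wscale c = wext (\<lambda>\<alpha> d. xd \<alpha> (c \<alpha> *s d))"

abbreviation wsmul :: "int \<Rightarrow> 'n::finite wvec \<Rightarrow> 'n wvec" where
  "wsmul n \<equiv> wscale (\<lambda>_. n)"

lemma wscale_add: "wscale c (f + g) = wscale c f + wscale c g"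
  unfolding wscale_def by (rule wext_add) (simp add: xd_add vector_add_ldistrib)

lemma wscale_xd: "wscale c (xd \<alpha> d) = xd \<alpha> (c \<alpha> *s d)"
  unfolding wscale_def by (rule wext_xd) (simp add: xd_add vector_add_ldistrib)

lemma wsmul_distrib: "wscale (\<lambda>\<alpha>. c \<alpha> + c' \<alpha>) f = wscale c f + wscale c' f"
  by (rule additive_wvec_eqI[where F = "wscale (\<lambda>\<alpha>. c \<alpha> + c' \<alpha>)"])
    (simp_all add: wscale_add wscale_xd vector_sadd_rdistrib xd_add)

lemma wsmul_mult: "wscale c (wscale c' f) = wscale (\<lambda>\<alpha>. c \<alpha> * c' \<alpha>) f"
  by (rule additive_wvec_eqI[where F = "\<lambda>f. wscale c (wscale c' f)"])
    (simp_all add: wscale_add wscale_xd vector_smult_assoc)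

lemma wsmul_zero: "wsmul 0 f = 0"
  by (rule additive_wvec_eqI[where F = "wsmul 0"]) (simp_all add: wscale_add wscale_xd)

lemma wsmul_one: "wsmul 1 f = f"
  by (rule additive_wvec_eqI[where F = "wsmul 1"]) (simp_all add: wscale_add wscale_xd)

lemma lookup_wscale: "Poly_Mapping.lookup (wscale c f) \<alpha> = c \<alpha> *s Poly_Mapping.lookup f \<alpha>"
  by (rule additive_wvec_eqI[where F = "\<lambda>f. Poly_Mapping.lookup (wscale c f) \<alpha>"])
    (simp_all add: wscale_add wscale_xd lookup_add vector_add_ldistrib lookup_xd)

lemma wsmul_Suc: "wsmul (n + 1) f = wsmul n f + f"
  by (simp add: wsmul_distrib[of "\<lambda>_. n" "\<lambda>_. 1"] wsmul_one)

text \<open>Torsion-freeness of the ambient vector fields. It replaces division by l! in the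
  identities for divided powers.\<close>

lemma wsmul_cancel: "n \<noteq> 0 \<Longrightarrow> wsmul n f = wsmul n g \<Longrightarrow> f = g"
proof (rule poly_mapping_eqI)
  fix \<alpha> assume n: "n \<noteq> 0" "wsmul n f = wsmul n g"
  then have "n *s Poly_Mapping.lookup f \<alpha> = n *s Poly_Mapping.lookup g \<alpha>"
    by (simp flip: lookup_wscale[of "\<lambda>_. n"])
  with n(1) show "Poly_Mapping.lookup f \<alpha> = Poly_Mapping.lookup g \<alpha>"
    by (simp add: vec_eq_iff)
qed

lemma additive_wsmul:
  fixes F :: "'n::finite wvec \<Rightarrow> 'm::finite wvec"
  assumes F: "\<And>f g. F (f + g) = F f + F g"
  shows "F (wsmul n f) = wsmul n (F f)"
proof (induction n rule: int_shift_induct)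
  case (up n)
  then show ?case by (simp add: wsmul_Suc F)
next
  case (down n)
  then show ?case by (simp add: wsmul_Suc F)
qed (simp add: wsmul_zero additive_zero[of F, OF F])

lemma wlie_wsmul: "wlie (wsmul n f) g = wsmul n (wlie f g)" "wlie f (wsmul n g) = wsmul n (wlie f g)"
  by (rule additive_wsmul[of "\<lambda>f. wlie f g"], rule wlie_add, rule additive_wsmul[of "wlie f"], rule wlie_add)

lemma wsmul_sum: "wsmul n (\<Sum>i\<in>I. f i) = (\<Sum>i\<in>I. wsmul n (f i))"
  by (rule additive_sum) (rule wscale_add)

lemma wlie_sum: "wlie f (\<Sum>i\<in>I. g i) = (\<Sum>i\<in>I. wlie f (g i))"
  by (rule additive_sum) (rule wlie_add)

lemma A_coeff_0 [simp]: "A_coeff k k' \<alpha> 0 = 1"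
  by (simp add: A_coeff_def)

text \<open>The exactness of the division in \<open>A_coeff\<close> enters here, as divisibility of
  a Pochhammer product by l!. Later arguments need only this recursion and the initial
  value.\<close>

lemma A_coeff_Suc:
  "int (Suc l) * A_coeff k k' \<alpha> (Suc l) = (\<alpha> $ k - 2 * \<alpha> $ k' + int l) * A_coeff k k' \<alpha> l"
proof -
  let ?P = "\<lambda>l. \<Prod>j<l. \<alpha> $ k - 2 * \<alpha> $ k' + int j"
  have f: "fact l * A_coeff k k' \<alpha> l = ?P l" for l
    using fact_dvd_pochhammer[of l "\<alpha> $ k - 2 * \<alpha> $ k'"]
    by (simp add: A_coeff_def pochhammer_prod atLeast0LessThan)
  have "fact l * (int (Suc l) * A_coeff k k' \<alpha> (Suc l)) = ?P (Suc l)"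
    unfolding f[symmetric] by (simp add: algebra_simps)
  also have "\<dots> = ?P l * (\<alpha> $ k - 2 * \<alpha> $ k' + int l)"
    by (rule prod.lessThan_Suc)
  also have "?P l = fact l * A_coeff k k' \<alpha> l"
    by (rule f[symmetric])
  finally have "fact l * (int (Suc l) * A_coeff k k' \<alpha> (Suc l))
      = fact l * ((\<alpha> $ k - 2 * \<alpha> $ k' + int l) * A_coeff k k' \<alpha> l)"
    by (simp only: mult_ac)
  then show ?thesis by simp
qed

text \<open>The l-th divided power of ad e in closed form; \<open>wD_Suc\<close> justifies the
  name.\<close>

definition wD :: "'n::finite \<Rightarrow> 'n \<Rightarrow> nat \<Rightarrow> 'n wvec \<Rightarrow> 'n wvec" where
  "wD k k' l = wext (\<lambda>\<alpha> d. xd (shift_exp k \<alpha> l) (shift_dir k k' \<alpha> d l))"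

lemma shift_dir_add: "shift_dir k k' \<alpha> (d + d') l = shift_dir k k' \<alpha> d l + shift_dir k k' \<alpha> d' l"
  by (simp add: shift_dir_def B_coeff_def tapp_simps vec_eq_iff algebra_simps)

lemma wD_add: "wD k k' l (f + g) = wD k k' l f + wD k k' l g"
  unfolding wD_def by (rule wext_add) (simp add: shift_dir_add xd_add)

lemma wD_xd: "wD k k' l (xd \<alpha> d) = xd (shift_exp k \<alpha> l) (shift_dir k k' \<alpha> d l)"
  unfolding wD_def by (rule wext_xd) (simp add: shift_dir_add xd_add)

lemma wD_0: "wD k k' 0 f = f"
  by (rule additive_wvec_eqI[where F = "wD k k' 0"])
    (simp_all add: wD_add wD_xd shift_exp_def shift_dir_def B_coeff_def)

lemma wD_diff: "wD k k' l (f - g) = wD k k' l f - wD k k' l g"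
  by (rule additive_diff) (rule wD_add)

lemma wD_zero: "wD k k' l 0 = 0"
  by (rule additive_zero) (rule wD_add)

lemma eps_nth: "eps i $ j = (if j = i then 1 else 0)"
  by (simp add: axis_def)

lemma tapp_eps: "tapp d (eps i) = d $ i" "tapp (eps i) d = d $ i"
  unfolding tapp_def axis_def by (simp_all add: if_distrib[of "(*) _"] if_distrib[of "\<lambda>x. x * _"] cong: if_cong)

context
  fixes k k' :: "'n::finite"
  assumes kk': "k \<noteq> k'"
begin

abbreviation (input) "we \<equiv> xd (eps k) (e_dir k k')"

lemma e_dir_nth: "e_dir k k' $ j = (if j = k then 1 else if j = k' then - 2 else 0)"
  using kk' by (auto simp: e_dir_def axis_def)

lemma h_dir_nth: "h_dir k k' $ j = (if j = k then 1 else if j = k' then - 1 else 0)"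
  using kk' by (auto simp: h_dir_def axis_def)

lemma tapp_e_dir: "tapp (e_dir k k') \<beta> = \<beta> $ k - 2 * \<beta> $ k'"
  by (simp add: e_dir_def tapp_simps tapp_eps)

lemma wD_Suc: "wlie we (wD k k' l f) = wsmul (int (Suc l)) (wD k k' (Suc l) f)"
proof (rule additive_wvec_eqI[where F = "\<lambda>f. wlie we (wD k k' l f)"])
  fix \<alpha> d
  let ?s = "\<alpha> $ k - 2 * \<alpha> $ k'" and ?A = "A_coeff k k' \<alpha>" and ?B = "B_coeff k k' \<alpha> d"
  have sh: "eps k + shift_exp k \<alpha> l = shift_exp k \<alpha> (Suc l)"
    by (simp add: shift_exp_def vec_eq_iff algebra_simps)
  have t1: "tapp (e_dir k k') (shift_exp k \<alpha> l) = ?s + int l"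
    using kk' by (simp add: tapp_e_dir shift_exp_def axis_def)
  have t2: "tapp (shift_dir k k' \<alpha> d l) (eps k) = ?A l * d $ k - ?B l"
    by (simp add: tapp_eps shift_dir_def e_dir_nth)
  have A: "int (Suc l) * ?A (Suc l) = (?s + int l) * ?A l" by (rule A_coeff_Suc)
  \<comment> \<open>B at l is built from A at l - 1, so the recursion of A is used one index lower.
    At l = 0 the convention that B vanishes takes its place.\<close>
  have B: "int (Suc l) * ?B (Suc l) = (?s + int l) * ?B l + (?A l * d $ k - ?B l)"
  proof (cases l)
    case (Suc m)
    have "int l * ?A l = (?s + int m) * ?A m" unfolding Suc by (rule A_coeff_Suc)
    then have "d $ k * (int l * ?A l) = d $ k * ((?s + int m) * ?A m)" by simp
    then show ?thesis by (simp add: B_coeff_def tapp_eps Suc algebra_simps)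
  qed (simp add: B_coeff_def tapp_eps)
  have "(?s + int l) *s shift_dir k k' \<alpha> d l - (?A l * d $ k - ?B l) *s e_dir k k'
      = (int (Suc l) * ?A (Suc l)) *s d - (int (Suc l) * ?B (Suc l)) *s e_dir k k'"
    unfolding A B by (simp add: shift_dir_def vec_eq_iff algebra_simps)
  also have "\<dots> = int (Suc l) *s shift_dir k k' \<alpha> d (Suc l)"
    by (simp add: shift_dir_def vec_eq_iff algebra_simps)
  finally show "wlie we (wD k k' l (xd \<alpha> d)) = wsmul (int (Suc l)) (wD k k' (Suc l) (xd \<alpha> d))"
    unfolding wD_xd wlie_xd wlie1_def wscale_xd sh t1 t2 by simp
qed (simp_all add: wD_add wlie_add wscale_add)

lemma wD_comp: "wD k k' j (wD k k' l f) = wsmul (int (l + j choose j)) (wD k k' (l + j) f)"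
proof (induction j)
  case (Suc j)
  have "wsmul (int (Suc j)) (wD k k' (Suc j) (wD k k' l f)) = wsmul (int (l + j choose j)) (wlie we (wD k k' (l + j) f))"
    by (simp only: wD_Suc[symmetric] Suc wlie_wsmul)
  also have "\<dots> = wsmul (int (Suc j)) (wsmul (int (l + Suc j choose Suc j)) (wD k k' (l + Suc j) f))"
  proof -
    have "(l + j choose j) * Suc (l + j) = Suc j * (l + Suc j choose Suc j)"
      by (metis Suc_times_binomial_eq add_Suc_right mult.commute)
    then show ?thesis
      by (simp only: wD_Suc wsmul_mult of_nat_mult[symmetric] add_Suc_right)
  qed
  finally show ?case by (rule wsmul_cancel[rotated]) simp
qed (simp add: wD_0 wsmul_one)

lemma wlie_derivation: "wlie e (wlie f g) = wlie (wlie e f) g + wlie f (wlie e g)"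
  using wlie_jacobi[of e f g] wlie_antisym[of g "wlie e f"] wlie_antisym[of g e]
    additive_minus[of "wlie f" "wlie e g", OF wlie_add(2)]
  by (simp add: algebra_simps eq_neg_iff_add_eq_0)

text \<open>Applying the derivation ad e to the rule for n gives each bracket the coefficients i and
  n + 1 - i. They add up to n + 1, which is then cancelled.\<close>

lemma wD_lie: "wD k k' n (wlie f g) = (\<Sum>i\<le>n. wlie (wD k k' i f) (wD k k' (n - i) g))"
proof (induction n)
  case (Suc n)
  let ?D = "wD k k'"
  let ?t = "\<lambda>i. wlie (?D i f) (?D (Suc n - i) g)"
  have "wsmul (int (Suc n)) (?D (Suc n) (wlie f g)) = (\<Sum>i\<le>n. wlie we (wlie (?D i f) (?D (n - i) g)))"
    by (simp only: wD_Suc[symmetric] Suc wlie_sum)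
  also have "\<dots> = (\<Sum>i\<le>n. wsmul (int (Suc i)) (?t (Suc i)) + wsmul (int (Suc n - i)) (?t i))"
  proof (rule sum.cong[OF refl])
    fix i assume "i \<in> {..n}"
    then have i: "Suc (n - i) = Suc n - i" "int (Suc (n - i)) = int (Suc n - i)" by auto
    show "wlie we (wlie (?D i f) (?D (n - i) g)) = wsmul (int (Suc i)) (?t (Suc i)) + wsmul (int (Suc n - i)) (?t i)"
      unfolding wlie_derivation[of we] wD_Suc wlie_wsmul i diff_Suc_Suc ..
  qed
  also have "\<dots> = (\<Sum>i\<le>Suc n. wsmul (int i) (?t i)) + (\<Sum>i\<le>Suc n. wsmul (int (Suc n - i)) (?t i))"
  proof -
    have "(\<Sum>i\<le>Suc n. wsmul (int i) (?t i)) = (\<Sum>i\<le>n. wsmul (int (Suc i)) (?t (Suc i)))"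
      by (simp only: sum.atMost_Suc_shift) (simp add: wsmul_zero)
    moreover have "(\<Sum>i\<le>Suc n. wsmul (int (Suc n - i)) (?t i)) = (\<Sum>i\<le>n. wsmul (int (Suc n - i)) (?t i))"
      by (simp add: wsmul_zero)
    ultimately show ?thesis by (simp only: sum.distrib)
  qed
  also have "\<dots> = wsmul (int (Suc n)) (\<Sum>i\<le>Suc n. ?t i)"
    unfolding sum.distrib[symmetric] wsmul_sum
  proof (rule sum.cong[OF refl])
    fix i assume "i \<in> {..Suc n}"
    then have "int i + int (Suc n - i) = int (Suc n)" by auto
    then show "wsmul (int i) (?t i) + wsmul (int (Suc n - i)) (?t i) = wsmul (int (Suc n)) (?t i)"
      by (simp only: wsmul_distrib[symmetric])
  qed
  finally show ?case by (rule wsmul_cancel[rotated]) simp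
qed (simp add: wD_0)

end

section \<open>The Lie ring contains the divided powers\<close>

lemma S_Z_wsmul: "f \<in> S_Z \<Longrightarrow> wsmul n f \<in> S_Z"
proof (induction n rule: int_shift_induct)
  case (up n)
  then show ?case using S_Z_add[of "wsmul n f" f] by (simp add: wsmul_Suc)
next
  case (down n)
  then show ?case using S_Z.diff[of "wsmul (n + 1) f" f] by (simp add: wsmul_Suc)
qed (simp add: wsmul_zero S_Z.zero)

text \<open>With \<open>\<gamma> = \<alpha> - \<epsilon>\<^sub>a - \<epsilon>\<^sub>b\<close> this is \<open>D\<^sub>b(x\<^sup>\<alpha>) D\<^sub>a - D\<^sub>a(x\<^sup>\<alpha>) D\<^sub>b\<close>.\<close>

definition ham :: "int ^ 'n::finite \<Rightarrow> 'n \<Rightarrow> 'n \<Rightarrow> 'n wvec" where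
  "ham \<gamma> a b = xd \<gamma> ((\<gamma> $ b + 1) *s eps a - (\<gamma> $ a + 1) *s eps b)"

text \<open>The exponent \<alpha> = \<gamma> + \<epsilon>_a + \<epsilon>_b is non-negative, so the
  field comes from an honest monomial.\<close>

definition ham_ok :: "int ^ 'n::finite \<Rightarrow> 'n \<Rightarrow> 'n \<Rightarrow> bool" where
  "ham_ok \<gamma> a b \<longleftrightarrow> (\<forall>j. 0 \<le> (\<gamma> + eps a + eps b) $ j)"

lemma xd_uminus: "xd \<alpha> (- d) = - xd \<alpha> d"
  by (simp add: xd_def single_uminus)

lemma xd_diff: "xd \<alpha> (d - d') = xd \<alpha> d - xd \<alpha> d'"
  by (simp add: xd_def single_diff)

lemma ham_self: "ham \<gamma> a a = 0"
  by (simp add: ham_def)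

lemma ham_swap: "ham \<gamma> b a = - ham \<gamma> a b"
  by (simp add: ham_def flip: xd_uminus)

lemma ham_in_S_Z:
  assumes "ham_ok \<gamma> i last_index"
  shows "ham \<gamma> i last_index \<in> S_Z" "ham \<gamma> last_index i \<in> S_Z"
proof -
  show 1: "ham \<gamma> i last_index \<in> S_Z"
  proof (cases "i = last_index")
    case False
    let ?\<alpha> = "\<gamma> + eps i + eps last_index"
    have "S_gen ?\<alpha> i \<in> S_Z"
      using assms False by (intro S_Z.gen) (auto simp: ham_ok_def)
    moreover have "S_gen ?\<alpha> i = ham \<gamma> i last_index"
      using False by (simp add: S_gen_def ham_def axis_def)
    ultimately show ?thesis by simp
  qed (simp add: ham_self S_Z.zero)
  then show "ham \<gamma> last_index i \<in> S_Z"
    using S_Z_uminus[OF 1] by (simp add: ham_swap[of \<gamma> last_index i])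
qed

lemma S_gen_ham: "i \<noteq> last_index \<Longrightarrow> S_gen \<alpha> i = ham (\<alpha> - eps i - eps last_index) i last_index"
  by (simp add: S_gen_def ham_def axis_def)

text \<open>
  Up to fields known to lie in \<open>S_Z\<close>, bracketing the fields of \<open>x\<^sub>n\<^sup>p\<close> and of a multiple of \<open>x\<^sub>n\<^sup>q\<close> with
  \<open>p + q = \<gamma>\<^sub>n + 2\<close> gives \<open>p q\<close> times the field. The greatest common divisor of these products divides 2,
  and \<open>p = 1, 2\<close> suffice.
\<close>

lemma double_ham_in_S_Z:
  assumes ok: "ham_ok \<gamma> a b"
  shows "wsmul 2 (ham \<gamma> a b) \<in> S_Z"
proof -
  let ?n = "last_index :: 'a"
  consider "a = ?n" | "b = ?n" | "a = b" | "a \<noteq> ?n" "b \<noteq> ?n" "a \<noteq> b" by blast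
  then show ?thesis
  proof cases
    case 1
    then show ?thesis using ham_in_S_Z(2)[of \<gamma> b] ok by (simp add: S_Z_wsmul ham_ok_def add_ac)
  next
    case 2
    then show ?thesis using ham_in_S_Z(1)[of \<gamma> a] ok by (simp add: S_Z_wsmul)
  next
    case 3
    then show ?thesis using S_Z_wsmul[OF S_Z.zero] by (simp add: ham_self)
  next
    case 4
    \<comment> \<open>\<open>?X1\<close> is D_a, from x_n, and \<open>?X2\<close> is 2 x_n D_a, from
      x_n^2. The \<partial>_n parts of their brackets with \<open>?Y1\<close> and \<open>?Y2\<close>
      are in the ratio 1 to 2, so they cancel in the combination below.\<close>
    let ?X1 = "ham (- eps a) a ?n" and ?Y1 = "ham (\<gamma> + eps a) b ?n"
    let ?X2 = "ham (eps ?n - eps a) a ?n" and ?Y2 = "ham (\<gamma> + eps a - eps ?n) b ?n"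
    have e: "0 \<le> eps i $ j" for i j :: 'a
      by (simp add: axis_def)
    have "ham_ok (- eps a) a ?n" "ham_ok (eps ?n - eps a) a ?n"
      by (simp_all add: ham_ok_def e)
    moreover have "ham_ok (\<gamma> + eps a) b ?n"
      unfolding ham_ok_def
    proof
      fix j
      show "0 \<le> (\<gamma> + eps a + eps b + eps ?n) $ j"
        using ok e[of ?n j] unfolding ham_ok_def vector_add_component[of _ "eps ?n"] by (intro add_nonneg_nonneg) simp_all
    qed
    moreover have "ham_ok (\<gamma> + eps a - eps ?n) b ?n"
      using ok by (simp add: ham_ok_def add.assoc)
    ultimately have "?X1 \<in> S_Z" "?Y1 \<in> S_Z" "?X2 \<in> S_Z" "?Y2 \<in> S_Z"
      by (simp_all add: ham_in_S_Z)
    then have "wlie ?X2 ?Y2 - wsmul 2 (wlie ?X1 ?Y1) \<in> S_Z"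
      by (intro S_Z.diff S_Z_wsmul S_Z.bracket)
    also have "wlie ?X2 ?Y2 - wsmul 2 (wlie ?X1 ?Y1) = wsmul 2 (ham \<gamma> a b)"
    proof -
      have w: "eps ?n - eps a + (\<gamma> + eps a - eps ?n) = \<gamma>" "- eps a + (\<gamma> + eps a) = \<gamma>"
        by (simp_all add: algebra_simps)
      show ?thesis
        unfolding ham_def wlie_xd wlie1_def w wscale_xd xd_diff[symmetric]
        by (rule arg_cong[of _ _ "xd \<gamma>"])
          (use 4 in \<open>simp add: tapp_simps tapp_eps vec_eq_iff eps_nth algebra_simps\<close>)
    qed
    finally show ?thesis .
  qed
qed

context
  fixes k k' :: "'n::{finite, linorder}"
  assumes kk': "k \<noteq> k'"
begin

lemma A_coeff_pred:
  assumes "l > 0"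
  shows "int l * A_coeff k k' \<gamma> l = (\<gamma> $ k - 2 * \<gamma> $ k' + int l - 1) * A_coeff k k' \<gamma> (l - 1)"
  using A_coeff_Suc[of "l - 1" k k' \<gamma>] assms by (simp add: of_nat_diff algebra_simps)

lemma shift_exp_nth: "shift_exp k \<gamma> l $ j = \<gamma> $ j + (if j = k then int l else 0)"
  by (simp add: shift_exp_def axis_def)

text \<open>A field without index k has no \<partial>_k part, so B vanishes and A merely scales it.
  Otherwise the -2 in e brings in the index k' with an even coefficient; the remaining coefficients
  match by the recursion for A.\<close>

lemma wD_ham:
  fixes \<gamma> :: "int ^ 'n::{finite, linorder}"
  assumes l: "l > 0"
  defines "A \<equiv> A_coeff k k' \<gamma> l" and "A' \<equiv> A_coeff k k' \<gamma> (l - 1)" and "\<gamma>' \<equiv> shift_exp k \<gamma> l"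
  shows "k \<noteq> a \<Longrightarrow> k \<noteq> b \<Longrightarrow> wD k k' l (ham \<gamma> a b) = wsmul A (ham \<gamma>' a b)"
    and "k \<noteq> b \<Longrightarrow> wD k k' l (ham \<gamma> k b) = wsmul (A - A') (ham \<gamma>' k b) + wsmul A' (wsmul 2 (ham \<gamma>' k' b))"
proof -
  have D: "wD k k' l (xd \<gamma> d) = xd \<gamma>' (A *s d - (d $ k * A') *s e_dir k k')" for d
    using l by (simp add: wD_xd shift_dir_def B_coeff_def tapp_eps A_def A'_def \<gamma>'_def)
  show "wD k k' l (ham \<gamma> a b) = wsmul A (ham \<gamma>' a b)" if "k \<noteq> a" "k \<noteq> b"
    using that unfolding ham_def D wscale_xd
    by (intro arg_cong[of _ _ "xd \<gamma>'"]) (simp add: \<gamma>'_def shift_exp_nth axis_def)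
  show "wD k k' l (ham \<gamma> k b) = wsmul (A - A') (ham \<gamma>' k b) + wsmul A' (wsmul 2 (ham \<gamma>' k' b))" if "k \<noteq> b"
    unfolding ham_def D wscale_xd xd_add[symmetric]
  proof (rule arg_cong[of _ _ "xd \<gamma>'"])
    have A: "int l * A = (\<gamma> $ k - 2 * \<gamma> $ k' + int l - 1) * A'"
      unfolding A_def A'_def by (rule A_coeff_pred[OF l])
    have nth: "\<gamma>' $ k = \<gamma> $ k + int l" "\<gamma>' $ k' = \<gamma> $ k'" "\<gamma>' $ b = \<gamma> $ b"
      using kk' that by (simp_all add: \<gamma>'_def shift_exp_nth)
    show "A *s ((\<gamma> $ b + 1) *s eps k - (\<gamma> $ k + 1) *s eps b)
        - (((\<gamma> $ b + 1) *s eps k - (\<gamma> $ k + 1) *s eps b) $ k * A') *s e_dir k k'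
      = (A - A') *s ((\<gamma>' $ b + 1) *s eps k - (\<gamma>' $ k + 1) *s eps b)
        + A' *s (2 *s ((\<gamma>' $ b + 1) *s eps k' - (\<gamma>' $ k' + 1) *s eps b))"
      unfolding nth vec_eq_iff
    proof
      fix j
      \<comment> \<open>The index b may equal k', in which case the second field on the right
        vanishes; hence the separate case.\<close>
      consider "j = k" | "j = b" "j = k'" | "j = b" "j \<noteq> k'" | "j \<noteq> k" "j \<noteq> b" "j = k'" | "j \<noteq> k" "j \<noteq> b" "j \<noteq> k'" by blast
      then show "(A *s ((\<gamma> $ b + 1) *s eps k - (\<gamma> $ k + 1) *s eps b)
        - (((\<gamma> $ b + 1) *s eps k - (\<gamma> $ k + 1) *s eps b) $ k * A') *s e_dir k k') $ j
      = ((A - A') *s ((\<gamma> $ b + 1) *s eps k - (\<gamma> $ k + int l + 1) *s eps b)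
        + A' *s (2 *s ((\<gamma> $ b + 1) *s eps k' - (\<gamma> $ k' + 1) *s eps b))) $ j"
        using that kk' A e_dir_nth[OF kk', of j]
        by cases (auto simp: eps_nth algebra_simps)
    qed
  qed
qed

text \<open>When index k is replaced by c, the unit lost in the exponent of x_k is regained from the
  shift by l > 0.\<close>

lemma ham_ok_shift:
  assumes "ham_ok \<gamma> a b"
  shows "ham_ok (shift_exp k \<gamma> l) a b" "l > 0 \<Longrightarrow> a = k \<Longrightarrow> ham_ok (shift_exp k \<gamma> l) c b"
proof -
  have *: "0 \<le> \<gamma> $ j + eps a $ j + eps b $ j" for j using assms by (simp add: ham_ok_def)
  show "ham_ok (shift_exp k \<gamma> l) a b"
    unfolding ham_ok_def
  proof
    fix j
    show "0 \<le> (shift_exp k \<gamma> l + eps a + eps b) $ j" using *[of j] by (cases "j = k") (auto simp: shift_exp_nth)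
  qed
  show "ham_ok (shift_exp k \<gamma> l) c b" if "l > 0" "a = k"
    unfolding ham_ok_def
  proof
    fix j
    show "0 \<le> (shift_exp k \<gamma> l + eps c + eps b) $ j"
      using *[of j] that by (cases "j = k") (auto simp: shift_exp_nth eps_nth)
  qed
qed

lemma ham_ok_swap: "ham_ok \<gamma> a b \<Longrightarrow> ham_ok \<gamma> b a"
  by (simp add: ham_ok_def add_ac)

lemma wD_ham_in_S_Z:
  assumes ok: "ham_ok \<gamma> i last_index" and i: "i \<noteq> last_index"
  shows "wD k k' l (ham \<gamma> i last_index) \<in> S_Z"
proof (cases "l = 0")
  case True
  then show ?thesis using ham_in_S_Z(1)[OF ok] by (simp add: wD_0)
next
  case False
  then have l: "l > 0" by simp
  let ?n = "last_index :: 'n"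
  consider "k \<noteq> i" "k \<noteq> ?n" | "k = i" | "k = ?n" by blast
  then show ?thesis
  proof cases
    case 1
    then show ?thesis
      by (simp add: wD_ham(1)[OF l] S_Z_wsmul ham_in_S_Z(1) ham_ok_shift(1)[OF ok])
  next
    case 2
    have "wD k k' l (ham \<gamma> k ?n) \<in> S_Z"
      unfolding wD_ham(2)[OF l, of ?n, simplified, OF i[folded 2]]
      using ok 2 l by (intro S_Z_add S_Z_wsmul ham_in_S_Z(1) ham_ok_shift(1) ham_ok_shift(2)[of _ k]) simp_all
    then show ?thesis by (simp add: 2)
  next
    case 3
    have ok': "ham_ok \<gamma> k i" using ham_ok_swap[OF ok] 3 by simp
    have "wD k k' l (ham \<gamma> k i) \<in> S_Z"
      unfolding wD_ham(2)[OF l, of i, simplified, OF i[folded 3, symmetric]]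
    proof (rule S_Z_add[OF S_Z_wsmul S_Z_wsmul])
      show "ham (shift_exp k \<gamma> l) k i \<in> S_Z"
        using ham_in_S_Z(2)[of "shift_exp k \<gamma> l" i] ham_ok_shift(1)[OF ok] 3 by simp
      \<comment> \<open>Here k = n, so neither k' nor i is n and the field itself need not lie in
        the Lie ring; its double does.\<close>
      show "wsmul 2 (ham (shift_exp k \<gamma> l) k' i) \<in> S_Z"
        by (rule double_ham_in_S_Z) (rule ham_ok_shift(2)[OF ok' l refl])
    qed
    then have "- wD k k' l (ham \<gamma> k i) \<in> S_Z" by (rule S_Z_uminus)
    also have "- wD k k' l (ham \<gamma> k i) = wD k k' l (ham \<gamma> i ?n)"
      unfolding 3 ham_swap[of \<gamma> i ?n] by (simp add: additive_minus[of "wD ?n k' l", OF wD_add])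
    finally show ?thesis .
  qed
qed

lemma wD_in_S_Z: "f \<in> S_Z \<Longrightarrow> wD k k' l f \<in> S_Z"
proof (induction f arbitrary: l rule: S_Z.induct)
  case (gen \<alpha> i)
  then have "ham_ok (\<alpha> - eps i - eps last_index) i last_index"
    by (simp add: ham_ok_def)
  then show ?case using wD_ham_in_S_Z gen(2) by (simp add: S_gen_ham)
next
  case (bracket f g)
  have "(\<Sum>i\<in>I. wlie (wD k k' i f) (wD k k' (l - i) g)) \<in> S_Z" for I
    by (induction I rule: infinite_finite_induct) (auto intro: S_Z.zero S_Z_add S_Z.bracket bracket.IH)
  then show ?case by (simp add: wD_lie[OF kk'])
qed (simp_all add: wD_zero wD_diff S_Z.zero S_Z.diff)

text \<open>For k = n the element e is a generator up to sign. Otherwise it combines two fields with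
  second index n so that their \<partial>_n parts cancel.\<close>

lemma e_in_S_Z: "xd (eps k) (e_dir k k') \<in> S_Z"
proof -
  let ?n = "last_index :: 'n"
  have ok: "ham_ok (eps k) a b" for a b by (simp add: ham_ok_def axis_def)
  show ?thesis
  proof (cases "k = ?n")
    case True
    have "ham (eps k) ?n k' \<in> S_Z" by (rule ham_in_S_Z(2)[OF ok])
    moreover have "ham (eps k) ?n k' = xd (eps k) (e_dir k k')"
      unfolding ham_def True[symmetric] by (rule arg_cong[of _ _ "xd (eps k)"])
        (use kk' in \<open>auto simp: e_dir_def vec_eq_iff axis_def\<close>)
    ultimately show ?thesis by simp
  next
    case False
    have "ham (eps k) k ?n - wsmul 2 (ham (eps k) k' ?n) \<in> S_Z"
      by (intro S_Z.diff S_Z_wsmul ham_in_S_Z(1) ok)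
    moreover have "ham (eps k) k ?n - wsmul 2 (ham (eps k) k' ?n) = xd (eps k) (e_dir k k')"
      unfolding ham_def wscale_xd xd_diff[symmetric] by (rule arg_cong[of _ _ "xd (eps k)"])
        (use kk' False in \<open>auto simp: e_dir_def vec_eq_iff axis_def\<close>)
    ultimately show ?thesis by simp
  qed
qed

lemma h_in_S_Z: "xd 0 (h_dir k k') \<in> S_Z"
proof -
  let ?n = "last_index :: 'n"
  have ok: "ham_ok 0 a b" for a b :: 'n by (simp add: ham_ok_def axis_def)
  have "ham 0 k ?n - ham 0 k' ?n \<in> S_Z"
    by (intro S_Z.diff ham_in_S_Z(1) ok)
  moreover have "ham 0 k ?n - ham 0 k' ?n = xd 0 (h_dir k k')"
    unfolding ham_def xd_diff[symmetric] by (simp add: h_dir_def)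
  ultimately show ?thesis by simp
qed

text \<open>At exponent 0 the product defining A contains a zero factor, so only B_1 = 1 survives.
  At \<epsilon>_k that product equals l!, so A_l = B_l = 1 for l > 0 and the two multiples of e
  cancel.\<close>

lemma wD_h: "wD k k' (Suc 0) (xd 0 (h_dir k k')) = - xd (eps k) (e_dir k k')"
    "wD k k' (Suc (Suc l)) (xd 0 (h_dir k k')) = 0"
  and wD_e: "wD k k' (Suc l) (xd (eps k) (e_dir k k')) = 0"
proof -
  have A: "int (Suc l) * A_coeff k k' \<gamma> (Suc l) = (\<gamma> $ k - 2 * \<gamma> $ k' + int l) * A_coeff k k' \<gamma> l" for \<gamma> l
    by (rule A_coeff_Suc)
  have A0: "A_coeff k k' 0 (Suc l) = 0" for l
  proof (induction l)
    case (Suc l)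
    then show ?case using A[of "Suc l" 0] by simp
  qed (use A[of 0 0] in simp)
  have Ae: "A_coeff k k' (eps k) l = 1" for l
  proof (induction l)
    case (Suc l)
    have "int (Suc l) * A_coeff k k' (eps k) (Suc l) = int (Suc l) * 1"
      using A[of l "eps k"] Suc kk' by (simp add: axis_def)
    then show ?case by simp
  qed simp
  show "wD k k' (Suc 0) (xd 0 (h_dir k k')) = - xd (eps k) (e_dir k k')"
    by (simp add: wD_xd shift_exp_def shift_dir_def B_coeff_def A0 tapp_eps h_dir_nth[OF kk'] flip: xd_uminus)
  show "wD k k' (Suc (Suc l)) (xd 0 (h_dir k k')) = 0"
    by (simp add: wD_xd shift_dir_def B_coeff_def A0)
  show "wD k k' (Suc l) (xd (eps k) (e_dir k k')) = 0"
    by (simp add: wD_xd shift_dir_def B_coeff_def Ae tapp_eps e_dir_nth[OF kk'])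
qed

end

section \<open>The grading of the Lie ring by exponents\<close>

inductive_set homog_span :: "'n::{finite, linorder} wvec set" where
  zero: "0 \<in> homog_span"
| single: "xd \<alpha> d \<in> S_Z \<Longrightarrow> xd \<alpha> d \<in> homog_span"
| add: "f \<in> homog_span \<Longrightarrow> g \<in> homog_span \<Longrightarrow> f + g \<in> homog_span"

lemma homog_span_uminus: "f \<in> homog_span \<Longrightarrow> - f \<in> homog_span"
proof (induction rule: homog_span.induct)
  case (single \<alpha> d)
  then show ?case using S_Z_uminus[OF single] by (simp add: homog_span.single flip: xd_uminus)
next
  case (add f g)
  then show ?case using homog_span.add[of "- f" "- g"] by simp
qed (simp add: homog_span.zero)

lemma homog_span_wlie: "f \<in> homog_span \<Longrightarrow> g \<in> homog_span \<Longrightarrow> wlie f g \<in> homog_span"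
proof (induction f rule: homog_span.induct)
  case (single \<alpha> d)
  note f = single(1)
  from single(2) show ?case
  proof (induction g rule: homog_span.induct)
    case (single \<beta> d')
    have "wlie (xd \<alpha> d) (xd \<beta> d') \<in> S_Z" by (rule S_Z.bracket[OF f single])
    then show ?case unfolding wlie_xd wlie1_def by (rule homog_span.single)
  qed (simp_all add: wlie_zero wlie_add homog_span.zero homog_span.add)
qed (simp_all add: wlie_zero wlie_add homog_span.zero homog_span.add)

text \<open>The generators are homogeneous and brackets of homogeneous elements are homogeneous, so
  every element is a sum of homogeneous elements that again lie in the Lie ring.\<close>

lemma S_Z_homog_span: "f \<in> S_Z \<Longrightarrow> f \<in> homog_span"
proof (induction rule: S_Z.induct)
  case (gen \<alpha> i)
  then have "S_gen \<alpha> i \<in> S_Z" by (rule S_Z.gen)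
  then show ?case unfolding S_gen_def by (rule homog_span.single)
next
  case (diff f g)
  show ?case using homog_span.add[OF diff.IH(1) homog_span_uminus[OF diff.IH(2)]] by simp
qed (simp_all add: homog_span.zero homog_span_wlie)

lemma homog_span_S_Z: "f \<in> homog_span \<Longrightarrow> f \<in> S_Z"
  by (induction rule: homog_span.induct) (simp_all add: S_Z.zero S_Z_add)

text \<open>On a homogeneous component the operator is an integer multiple. This supplies the
  operators \<open>scale\<close> of the abstract setting.\<close>

lemma wscale_in_S_Z:
  assumes "f \<in> S_Z"
  shows "wscale c f \<in> S_Z"
  using S_Z_homog_span[OF assms]
proof (induction rule: homog_span.induct)
  case (single \<alpha> d)
  then show ?case using S_Z_wsmul[of "xd \<alpha> d" "c \<alpha>"] by (simp add: wscale_xd)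
qed (simp_all add: wscale_add S_Z_add additive_zero[of "wscale c", OF wscale_add] S_Z.zero)

section \<open>The quantization of the special Lie ring\<close>

lift_definition szscale :: "((int, 'n) vec \<Rightarrow> int) \<Rightarrow> 'n::{finite, linorder} sz \<Rightarrow> 'n sz" is wscale
  by (rule wscale_in_S_Z)

lemma ugen_szsmul: "ugen (szscale (\<lambda>_. n) x) = of_int n * ugen x"
proof -
  have "szscale (\<lambda>_. n + 1) x = szscale (\<lambda>_. n) x + x" for n
    by transfer (rule wsmul_Suc)
  moreover have "szscale (\<lambda>_. 0) x = 0"
    by transfer (rule wsmul_zero)
  ultimately show ?thesis
    by (induction n rule: int_shift_induct) (simp_all add: ugen_add distrib_right)
qed

text \<open>Closure of the Lie ring under \<open>wD\<close> depends on k being different from k', so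
  the map is defined through the abstraction function instead of being lifted
  unconditionally.\<close>

definition szD :: "'n::{finite, linorder} \<Rightarrow> 'n \<Rightarrow> nat \<Rightarrow> 'n sz \<Rightarrow> 'n sz" where
  "szD k k' l x = Abs_sz (wD k k' l (Rep_sz x))"

lemma Rep_szD: "k \<noteq> k' \<Longrightarrow> Rep_sz (szD k k' l x) = wD k k' l (Rep_sz x)"
  unfolding szD_def by (rule Abs_sz_inverse) (rule wD_in_S_Z[OF _ Rep_sz])

text \<open>By \<open>wlie_h\<close> these are the eigenspaces of ad h, read off from the
  exponents.\<close>

definition sz_weight :: "'n::{finite, linorder} \<Rightarrow> 'n \<Rightarrow> int \<Rightarrow> 'n sz \<Rightarrow> bool" where
  "sz_weight k k' m x \<longleftrightarrow> (\<forall>\<alpha>\<in>Poly_Mapping.keys (Rep_sz x). \<alpha> $ k - \<alpha> $ k' = m)"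

lemma keys_xd: "Poly_Mapping.keys (xd \<alpha> d) \<subseteq> {\<alpha>}"
  by (simp add: xd_def)

lemma Rep_sxd: "xd \<alpha> d \<in> S_Z \<Longrightarrow> Rep_sz (sxd \<alpha> d) = xd \<alpha> d"
  unfolding sxd_def by (rule Abs_sz_inverse)

lemma sz_weight_sxd: "xd \<alpha> d \<in> S_Z \<Longrightarrow> sz_weight k k' (\<alpha> $ k - \<alpha> $ k') (sxd \<alpha> d)"
  unfolding sz_weight_def Rep_sxd using keys_xd by fastforce

lemma sz_weight_scale:
  assumes "sz_weight k k' m x"
  shows "szscale (\<lambda>\<alpha>. c (\<alpha> $ k - \<alpha> $ k')) x = szscale (\<lambda>_. c m) x"
proof -
  have "wscale (\<lambda>\<alpha>. c (\<alpha> $ k - \<alpha> $ k')) (Rep_sz x) = wsmul (c m) (Rep_sz x)"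
  proof (rule poly_mapping_eqI)
    fix \<alpha>
    show "Poly_Mapping.lookup (wscale (\<lambda>\<alpha>. c (\<alpha> $ k - \<alpha> $ k')) (Rep_sz x)) \<alpha> = Poly_Mapping.lookup (wsmul (c m) (Rep_sz x)) \<alpha>"
      using assms by (cases "\<alpha> \<in> Poly_Mapping.keys (Rep_sz x)") (auto simp: lookup_wscale sz_weight_def in_keys_iff)
  qed
  then show ?thesis by transfer
qed

lemma wlie_h: "wlie (xd 0 (h_dir k k')) f = wscale (\<lambda>\<alpha>. \<alpha> $ k - \<alpha> $ k') f"
  by (rule additive_wvec_eqI[where F = "wlie (xd 0 (h_dir k k'))"])
    (simp_all add: wlie_add wscale_add wlie_xd wlie1_def wscale_xd tapp_simps tapp_eps h_dir_def)

lemma jordanian_pair_sz: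
  fixes k k' :: "'n::{finite, linorder}"
  assumes kk': "k \<noteq> k'"
  shows "jordanian_pair (sxd 0 (h_dir k k')) (sxd (eps k) (e_dir k k')) (szD k k')
    (\<lambda>c. szscale (\<lambda>\<alpha>. c (\<alpha> $ k - \<alpha> $ k'))) (sz_weight k k')"
proof
  note h = Rep_sxd[OF h_in_S_Z[OF kk']] and e = Rep_sxd[OF e_in_S_Z[OF kk']]
  note RD = Rep_szD[OF kk']
  note R = Rep_sz_inject[symmetric] RD plus_sz.rep_eq lie_sz.rep_eq uminus_sz.rep_eq zero_sz.rep_eq szscale.rep_eq
  fix x y :: "'n sz" and l j n :: nat and m m' :: int and c :: "int \<Rightarrow> int"
  \<comment> \<open>A Lie ring has no integer scalars in its signature, so the abstract rules with
    multiplicities are stated inside U(L). This fact transports them from the vector fields.\<close>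
  have smul: "ugen u = of_int n * ugen v" if "Rep_sz u = wsmul n (Rep_sz v)" for u v :: "'n sz" and n
    using that ugen_szsmul[of n v] by (simp add: R flip: szscale.rep_eq)
      (metis Rep_sz_inject szscale.rep_eq)
  show "szD k k' 0 x = x" by (simp add: R wD_0)
  show Dadd: "szD k k' l (x + y) = szD k k' l x + szD k k' l y" for l x y by (simp add: R wD_add)
  show "ugen (lie (sxd (eps k) (e_dir k k')) (szD k k' l x)) = of_nat (Suc l) * ugen (szD k k' (Suc l) x)"
    using smul[of "lie (sxd (eps k) (e_dir k k')) (szD k k' l x)" "int (Suc l)" "szD k k' (Suc l) x"]
    by (simp add: R e wD_Suc[OF kk'])
  show "ugen (szD k k' j (szD k k' l x)) = of_nat (l + j choose j) * ugen (szD k k' (l + j) x)"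
    using smul[of "szD k k' j (szD k k' l x)" "int (l + j choose j)" "szD k k' (l + j) x"]
    by (simp add: R wD_comp[OF kk'])
  have Rsum: "Rep_sz (\<Sum>i\<in>I. f i) = (\<Sum>i\<in>I. Rep_sz (f i))" for I :: "nat set" and f :: "nat \<Rightarrow> 'n sz"
    by (induction I rule: infinite_finite_induct) (simp_all add: zero_sz.rep_eq plus_sz.rep_eq)
  show "szD k k' n (lie x y) = (\<Sum>i\<le>n. lie (szD k k' i x) (szD k k' (n - i) y))"
    by (simp add: R Rsum wD_lie[OF kk'])
  show "szD k k' (Suc l) (sxd (eps k) (e_dir k k')) = 0" by (simp add: R e wD_e[OF kk'])
  show "szD k k' (Suc 0) (sxd 0 (h_dir k k')) = - sxd (eps k) (e_dir k k')" by (simp add: R h e wD_h(1)[OF kk'])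
  show "szD k k' (Suc (Suc l)) (sxd 0 (h_dir k k')) = 0" by (simp add: R h wD_h(2)[OF kk'])
  show "szscale (\<lambda>\<alpha>. c (\<alpha> $ k - \<alpha> $ k')) (x + y) = szscale (\<lambda>\<alpha>. c (\<alpha> $ k - \<alpha> $ k')) x + szscale (\<lambda>\<alpha>. c (\<alpha> $ k - \<alpha> $ k')) y"
    by (simp add: R wscale_add)
  show "ugen (szD k k' l (szscale (\<lambda>\<alpha>. c (\<alpha> $ k - \<alpha> $ k')) x)) = of_int (c m) * ugen (szD k k' l x)" if "sz_weight k k' m x"
    unfolding sz_weight_scale[OF that] by (rule smul) (simp add: R additive_wsmul[of "wD k k' l", OF wD_add])
  show "sz_weight k k' (m + m') (lie x y)" if x: "sz_weight k k' m x" and y: "sz_weight k k' m' y"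
    unfolding sz_weight_def lie_sz.rep_eq
  proof
    fix \<gamma> assume "\<gamma> \<in> Poly_Mapping.keys (wlie (Rep_sz x) (Rep_sz y))"
    then obtain \<alpha> \<beta> where "\<alpha> \<in> Poly_Mapping.keys (Rep_sz x)" "\<beta> \<in> Poly_Mapping.keys (Rep_sz y)"
        "\<gamma> \<in> Poly_Mapping.keys (wlie1 \<alpha> (Poly_Mapping.lookup (Rep_sz x) \<alpha>) \<beta> (Poly_Mapping.lookup (Rep_sz y) \<beta>))"
      unfolding wlie_def by (blast dest: subsetD[OF keys_sum])
    moreover from this(3) have "\<gamma> = \<alpha> + \<beta>"
      unfolding wlie1_def using keys_xd by blast
    ultimately show "\<gamma> $ k - \<gamma> $ k' = m + m'"
      using x y by (auto simp: sz_weight_def)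
  qed
  show "ugen (lie (sxd 0 (h_dir k k')) x) = of_int m * ugen x" if "sz_weight k k' m x"
  proof -
    have "lie (sxd 0 (h_dir k k')) x = szscale (\<lambda>\<alpha>. \<alpha> $ k - \<alpha> $ k') x"
      by (simp add: R h wlie_h)
    then show ?thesis by (simp only: sz_weight_scale[OF that, of "\<lambda>m. m"] ugen_szsmul)
  qed
  show "sz_weight k k' (m + int l) (szD k k' l x)" if x: "sz_weight k k' m x"
    unfolding sz_weight_def RD
  proof
    fix \<gamma> assume "\<gamma> \<in> Poly_Mapping.keys (wD k k' l (Rep_sz x))"
    then obtain \<alpha> where "\<alpha> \<in> Poly_Mapping.keys (Rep_sz x)" "\<gamma> = shift_exp k \<alpha> l"
      unfolding wD_def wext_def using keys_xd by (blast dest: subsetD[OF keys_sum])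
    then show "\<gamma> $ k - \<gamma> $ k' = m + int l"
      using x kk' by (auto simp: sz_weight_def shift_exp_def axis_def)
  qed
  show "sz_weight k k' 0 (sxd 0 (h_dir k k'))"
    using sz_weight_sxd[OF h_in_S_Z[OF kk'], of k k'] by simp
  show "sz_weight k k' 1 (sxd (eps k) (e_dir k k'))"
    using sz_weight_sxd[OF e_in_S_Z[OF kk'], of k k'] kk' by (simp add: axis_def)
  show "P x" if wt: "\<And>m x. sz_weight k k' m x \<Longrightarrow> P x" and plus: "\<And>x y. P x \<Longrightarrow> P y \<Longrightarrow> P (x + y)" for P x
  proof -
    \<comment> \<open>A homogeneous element is a weight vector, so the decomposition by exponents
      refines the one by weights.\<close>
    have "P (Abs_sz f)" if "f \<in> homog_span" for f
      using that
    proof (induction rule: homog_span.induct)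
      case zero
      have "sz_weight k k' 0 (0 :: 'n sz)" by (simp add: sz_weight_def zero_sz.rep_eq)
      then show ?case using wt by (simp add: zero_sz_def)
    next
      case (single \<alpha> d)
      then show ?case using wt sz_weight_sxd[of \<alpha> d k k'] by (simp add: sxd_def)
    next
      case (add f g)
      have "Abs_sz (f + g) = Abs_sz f + Abs_sz g"
        using add(1,2) by (simp add: R Abs_sz_inverse homog_span_S_Z S_Z_add)
      then show ?case using add.IH plus by simp
    qed
    then show ?thesis using S_Z_homog_span[OF Rep_sz[of x]] by (metis Rep_sz_inverse)
  qed
qed

theorem corollary2p7:
  fixes k k' :: "'n::{finite, linorder}"
    and h e :: "'n sz"
    and p :: "int \<Rightarrow> 'n sz uea fps"
  assumes "k \<noteq> k'"
  defines "h \<equiv> sxd 0 (h_dir k k')"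
    and "e \<equiv> sxd (eps k) (e_dir k k')"
    and "p \<equiv> unit_powi (1 - fps_const (ugen e) * fps_X)"
  shows "xd 0 (h_dir k k') \<in> S_Z \<and> xd (eps k) (e_dir k k') \<in> S_Z
    \<and> is_unit_elt (1 - fps_const (ugen e) * fps_X)
    \<and> (\<exists>\<Delta> \<epsilon> S. twist_quantization (twist_elt h e) \<Delta> \<epsilon> S
        \<and> (\<forall>\<alpha> d. xd \<alpha> d \<in> S_Z \<longrightarrow>
             (\<forall>l. xd (shift_exp k \<alpha> l) (shift_dir k k' \<alpha> d l) \<in> S_Z)
           \<and> \<Delta> (fps_const (ugen (sxd \<alpha> d)))
               = fps_const (ugen (sxd \<alpha> d)) \<otimes>\<^sub>t p (\<alpha> $ k - \<alpha> $ k')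
                 + fps_series (\<lambda>l. (- 1) ^ l *
                     (fps_const (rising 0 (ugen h) l) \<otimes>\<^sub>t
                      (p (- int l) * fps_const (ugen (sxd (shift_exp k \<alpha> l) (shift_dir k k' \<alpha> d l))))))
           \<and> S (fps_const (ugen (sxd \<alpha> d)))
               = - (p (- (\<alpha> $ k - \<alpha> $ k')) *
                    fps_series (\<lambda>l. fps_const
                      (ugen (sxd (shift_exp k \<alpha> l) (shift_dir k k' \<alpha> d l)) * rising 1 (ugen h) l)))
           \<and> \<epsilon> (fps_const (ugen (sxd \<alpha> d))) = 0))"
proof -
  interpret jordanian_pair h e "szD k k'" "\<lambda>c. szscale (\<lambda>\<alpha>. c (\<alpha> $ k - \<alpha> $ k'))" "sz_weight k k'"
    unfolding h_def e_def by (rule jordanian_pair_sz[OF assms(1)])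
  have p: "p = tpow (ugen e)"
    by (simp add: p_def tunit_def)
  show ?thesis
  proof (intro conjI exI allI impI)
    show "xd 0 (h_dir k k') \<in> S_Z" "xd (eps k) (e_dir k k') \<in> S_Z"
      by (rule h_in_S_Z[OF assms(1)], rule e_in_S_Z[OF assms(1)])
    show "is_unit_elt (1 - fps_const (ugen e) * fps_X)"
      using is_unit_tunit[of "ugen e"] by (simp add: tunit_def)
    show "twist_quantization (twist_elt h e) copr counit_fps antip" by (rule quantization)
    fix \<alpha> d :: "(int, 'n) vec"
    assume x: "xd \<alpha> d \<in> S_Z"
    note wt = sz_weight_sxd[OF x, of k k']
    have D: "seq (sxd \<alpha> d) l = ugen (sxd (shift_exp k \<alpha> l) (shift_dir k k' \<alpha> d l))" for l
      unfolding seq_def szD_def Rep_sxd[OF x] wD_xd by (simp add: sxd_def)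
    show "xd (shift_exp k \<alpha> l) (shift_dir k k' \<alpha> d l) \<in> S_Z" for l
      using wD_in_S_Z[OF assms(1) x, of l] by (simp add: wD_xd)
    \<comment> \<open>The falling factorials of -h are the signed rising factorials of the stated
      coproduct; the sign is moved out of the first tensor factor.\<close>
    have "falling (- inj1 (fps_const (ugen h)) :: ('n sz uea, 'n sz uea) tensor fps) l
        = (- 1) ^ l * inj1 (fps_const (rising 0 (ugen h) l))" for l
    proof -
      have "falling (- inj1 (fps_const (ugen h)) :: ('n sz uea, 'n sz uea) tensor fps) l
          = inj1 (fps_const (falling (- ugen h) l))"
        by (simp only: hom_falling[OF hom_inj1] hom_falling[OF hom_fps_const] hom_minus[OF hom_inj1] hom_minus[OF hom_fps_const])
      then show ?thesis
        by (simp only: falling_minus hom_mult[OF hom_inj1] hom_power[OF hom_inj1] hom_minus[OF hom_inj1] hom_one[OF hom_inj1]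
            hom_mult[OF hom_fps_const] hom_power[OF hom_fps_const] hom_minus[OF hom_fps_const] hom_one[OF hom_fps_const])
    qed
    then show "copr (fps_const (ugen (sxd \<alpha> d)))
        = fps_const (ugen (sxd \<alpha> d)) \<otimes>\<^sub>t p (\<alpha> $ k - \<alpha> $ k')
          + fps_series (\<lambda>l. (- 1) ^ l *
              (fps_const (rising 0 (ugen h) l) \<otimes>\<^sub>t
               (p (- int l) * fps_const (ugen (sxd (shift_exp k \<alpha> l) (shift_dir k k' \<alpha> d l))))))"
      by (simp only: copr_wt[OF wt] fps_tens_inj(1) D p mult.assoc)
    show "antip (fps_const (ugen (sxd \<alpha> d)))
        = - (p (- (\<alpha> $ k - \<alpha> $ k')) *
            fps_series (\<lambda>l. fps_const (ugen (sxd (shift_exp k \<alpha> l) (shift_dir k k' \<alpha> d l)) * rising 1 (ugen h) l)))"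
      by (simp only: antip_wt[OF wt] D p)
    show "counit_fps (fps_const (ugen (sxd \<alpha> d))) = 0"
      by (simp add: counit_fps_def map_fps_const)
  qed
qed

end
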